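(* Let $\Omega\subseteq\mathbb{R}^k$ be open. For every grid function $z\in\mathbb{G}(\Omega)$, if $\|z\|_1$ is finite, then there exists a sequence $\{z_n\}_{n\in\mathbb{N}}$ in $L^1(\Omega)$ such that (1) $z_n$ converges weakly-$\star$ to $[z]$ in $C^0_c(\Omega)'$, and (2) $z_n$ converges to $\nu^z$ in the sense of Young measures.
   Context: Nonstandard setting: ${}^*\mathbb{R}$ is a $|\mathscr{D}(\Omega)'|$-saturated hyperreal field in Robinson's nonstandard analysis, where $\mathscr{D}(\Omega)'$ is the space of real distributions over the open set $\Omega\subseteq\mathbb{R}^k$. A hyperreal is finite if it is bounded in absolute value by a standard real; ${}^\circ x$ denotes the standard part of a finite $x$. Grid functions: fix an infinite hypernatural $N_0$, set $N=N_0!$, $\varepsilon=1/N$, $\mathbb{X}=\{n\varepsilon : n\in[-N^2,N^2]\cap{}^*\mathbb{Z}\}$, and $\Omega_{\mathbb{X}}={}^*\Omega\cap\mathbb{X}^k$ (a hyperfinite set). The space of grid functions is $\mathbb{G}(\Omega)=\{f:\Omega_{\mathbb{X}}\to{}^*\mathbb{R} : f\text{ is internal}\}$. For internal $f,h$ defined on $\Omega_{\mathbb{X}}$ (functions on ${}^*\Omega$ are restricted to $\Omega_{\mathbb{X}}$), $\langle f,h\rangle=\varepsilon^k\sum_{x\in\Omega_{\mathbb{X}}}f(x)h(x)$, and $\|f\|_1=\varepsilon^k\sum_{x\in\Omega_{\mathbb{X}}}|f(x)|$. ${}^*g(f)$ denotes the grid function $x\mapsto{}^*g(f(x))$. Function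 spaces: $C^0_b(\mathbb{R})=\{g\in C^0(\mathbb{R}) : g\text{ bounded and }\lim_{|x|\to\infty}g(x)=0\}$. $C^0_c(\Omega)$ is the space of continuous real functions with compact support in $\Omega$, with the supremum norm; $C^0_c(\Omega)'$ is its dual. A function $w\in L^1(\Omega)$ is regarded as the element $\varphi\mapsto\int_\Omega w\varphi\,dx$ of $C^0_c(\Omega)'$. The functional $[z]$: when $\|z\|_1$ is finite, $[z]\in C^0_c(\Omega)'$ denotes the continuous linear functional $\varphi\mapsto{}^\circ\langle z,{}^*\varphi\rangle$. The measure $\nu^z$: $\mathbb{M}(\mathbb{R})$ (respectively $\mathbb{M}^{\mathbb{P}}(\mathbb{R})$) is the set of Radon measures $\mu$ on $\mathbb{R}$ with $|\mu|(\mathbb{R})<\infty$ (respectively Radon probability measures). A measurable map $\nu:\Omega\to\mathbb{M}(\mathbb{R})$, $x\mapsto\nu_x$ (that is, $x\mapsto\int_{\mathbb{R}} g\,d\nu_x$ is measurable for all $g\in C^0_b(\mathbb{R})$), is called a parametrized measure, and it is called a Young measure if it takes values in $\mathbb{M}^{\mathbb{P}}(\mathbb{R})$. For every $f\in\mathbb{G}(\Omega)$ there is a parametrized measure $\nu^f$ (determined up to a null set of $x$) such that for all $g\in C^0_b(\mathbb{R})$ and $\varphi\in C^0_c(\Omega)$, $${}^\circ\langle{}^*g(f),{}^*\varphi\rangle=\int_\Omega\left(\int_{\mathbb{R}}g\,d\nu^f_x\right)\varphi(x)\,dx;$$ it is a known fact that $\nu^f$ is a Young measure if $\|f\|_1$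 is finite. Young measure convergence: a bounded sequence $\{z_n\}$ in $L^1(\Omega)$ converges to a Young measure $\nu$ in the sense of Young measures if for all $g\in C^0_b(\mathbb{R})$ and all $\varphi\in C^0_c(\Omega)$, $$\lim_{n\to\infty}\int_\Omega g(z_n(x))\varphi(x)\,dx=\int_\Omega\left(\int_{\mathbb{R}}g\,d\nu_x\right)\varphi(x)\,dx.$$ *)

theory Defs
  imports "HOL-Analysis.Analysis" "HOL-Library.Equipollence"
begin

section \<open>Nonstandard extensions\<close>

text \<open>
  First-order formulas over the full relational language of a standard universe \<open>'u\<close>: every
  finitary relation on \<open>'u\<close> is a relation symbol. An interpretation assigns to each symbol a
  relation on some domain \<open>'a\<close>. The standard interpretation is \<open>\<lambda>R. R\<close>; a nonstandard universe is an
  interpretation \<open>ext\<close> on another type \<open>'s\<close>, where \<open>ext R\<close> is the relation usually written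
  with a star in front of \<open>R\<close>.
\<close>

datatype 'u fm =
    Rel "'u list set" "nat list"
  | Eq nat nat
  | Neg "'u fm"
  | Conj "'u fm" "'u fm"
  | All nat "'u fm"

primrec sat :: "('u list set \<Rightarrow> 'a list set) \<Rightarrow> (nat \<Rightarrow> 'a) \<Rightarrow> 'u fm \<Rightarrow> bool" where
  "sat I e (Rel R vs) \<longleftrightarrow> map e vs \<in> I R"
| "sat I e (Eq v w) \<longleftrightarrow> e v = e w"
| "sat I e (Neg p) \<longleftrightarrow> \<not> sat I e p"
| "sat I e (Conj p q) \<longleftrightarrow> sat I e p \<and> sat I e q"
| "sat I e (All v p) \<longleftrightarrow> (\<forall>a. sat I (e(v := a)) p)"

text \<open>
  The transfer principle; quantifying over all \<open>e\<close> takes universal closures, so that exactly the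
  sentences are compared.
\<close>

definition transfer_principle :: "('u list set \<Rightarrow> 's list set) \<Rightarrow> bool" where
  "transfer_principle ext \<longleftrightarrow> (\<forall>p. (\<forall>e. sat (\<lambda>R. R) e p) \<longleftrightarrow> (\<forall>e. sat ext e p))"

text \<open>
  Every element of \<open>'s\<close> is an internal object. By the internal definition principle, the internal
  sets of such objects are the sections of extended standard relations at internal parameters.
\<close>

definition internal_set :: "('u list set \<Rightarrow> 's list set) \<Rightarrow> 's set \<Rightarrow> bool" where
  "internal_set ext A \<longleftrightarrow> (\<exists>R ps. A = {y. y # ps \<in> ext R})"

text \<open>\<open>|K|\<close>-saturation: fewer than \<open>|K|\<close> internal sets with the finite intersection property have
  a common element.\<close>

definition saturated :: "('u list set \<Rightarrow> 's list set) \<Rightarrow> 'c set \<Rightarrow> bool" where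
  "saturated ext K \<longleftrightarrow>
     (\<forall>F. (\<forall>A\<in>F. internal_set ext A) \<and> F \<prec> K \<and>
          (\<forall>G. G \<subseteq> F \<and> finite G \<longrightarrow> \<Inter>G \<noteq> {}) \<longrightarrow> \<Inter>F \<noteq> {})"

text \<open>The extension of an element, of a set of elements, and of an operation (through its graph).\<close>

definition star :: "('u list set \<Rightarrow> 's list set) \<Rightarrow> 'u \<Rightarrow> 's" where
  "star ext u = (THE s. [s] \<in> ext {[u]})"

definition star_set :: "('u list set \<Rightarrow> 's list set) \<Rightarrow> 'u set \<Rightarrow> 's set" where
  "star_set ext A = {s. [s] \<in> ext {[u] | u. u \<in> A}}"

definition star_op :: "('u list set \<Rightarrow> 's list set) \<Rightarrow> ('u list \<Rightarrow> 'u) \<Rightarrow> 's list \<Rightarrow> 's" where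
  "star_op ext F xs = (THE y. xs @ [y] \<in> ext {us @ [F us] | us. True})"


section \<open>The standard universe and the hyperreals\<close>

text \<open>
  The part of the superstructure over the reals that is needed for grid functions on subsets of
  \<open>real^'k\<close>: numbers, points, real functions of points, sets of points.
\<close>

datatype 'k std =
    Num (the_num: real)
  | Pt (the_pt: "real^'k")
  | Fn (the_fn: "real^'k \<Rightarrow> real")
  | St (the_st: "(real^'k) set")

text \<open>
  The operations on \<open>'k std\<close> used below are total but only ever applied (after extension) to
  arguments of the right kind; the unspecified values of the selectors play no role.
\<close>

type_synonym ('k, 's) ext = "'k std list set \<Rightarrow> 's list set"

definition hreal :: "('k::finite, 's) ext \<Rightarrow> 's set" where
  "hreal ext = star_set ext (range Num)"

definition hnat :: "('k::finite, 's) ext \<Rightarrow> 's set" where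
  "hnat ext = star_set ext (Num ` \<nat>)"

definition hint :: "('k::finite, 's) ext \<Rightarrow> 's set" where
  "hint ext = star_set ext (Num ` \<int>)"

definition hconst :: "('k::finite, 's) ext \<Rightarrow> real \<Rightarrow> 's" where
  "hconst ext r = star ext (Num r)"

definition hfun1 :: "('k::finite, 's) ext \<Rightarrow> (real \<Rightarrow> real) \<Rightarrow> 's \<Rightarrow> 's" where
  "hfun1 ext g x = star_op ext (\<lambda>us. Num (g (the_num (us ! 0)))) [x]"

definition hfun2 :: "('k::finite, 's) ext \<Rightarrow> (real \<Rightarrow> real \<Rightarrow> real) \<Rightarrow> 's \<Rightarrow> 's \<Rightarrow> 's" where
  "hfun2 ext g x y = star_op ext (\<lambda>us. Num (g (the_num (us ! 0)) (the_num (us ! 1)))) [x, y]"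

definition hless :: "('k::finite, 's) ext \<Rightarrow> 's \<Rightarrow> 's \<Rightarrow> bool" where
  "hless ext x y \<longleftrightarrow> [x, y] \<in> ext {[Num a, Num b] | a b. a < b}"

definition hle :: "('k::finite, 's) ext \<Rightarrow> 's \<Rightarrow> 's \<Rightarrow> bool" where
  "hle ext x y \<longleftrightarrow> [x, y] \<in> ext {[Num a, Num b] | a b. a \<le> b}"

definition hfinite :: "('k::finite, 's) ext \<Rightarrow> 's \<Rightarrow> bool" where
  "hfinite ext x \<longleftrightarrow> x \<in> hreal ext \<and> (\<exists>r. hle ext (hfun1 ext abs x) (hconst ext r))"

definition standard_part :: "('k::finite, 's) ext \<Rightarrow> 's \<Rightarrow> real" where
  "standard_part ext x =
     (THE r. \<forall>d>0. hless ext (hfun1 ext abs (hfun2 ext (-) x (hconst ext r))) (hconst ext d))"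

definition infinite_hnat :: "('k::finite, 's) ext \<Rightarrow> 's \<Rightarrow> bool" where
  "infinite_hnat ext n \<longleftrightarrow> n \<in> hnat ext \<and> (\<forall>m::nat. hless ext (hconst ext (real m)) n)"

text \<open>Extension of a standard function of points, and evaluation of an internal function.\<close>

definition hfield :: "('k::finite, 's) ext \<Rightarrow> (real^'k \<Rightarrow> real) \<Rightarrow> 's \<Rightarrow> 's" where
  "hfield ext \<phi> x = star_op ext (\<lambda>us. Num (\<phi> (the_pt (us ! 0)))) [x]"

definition happ :: "('k::finite, 's) ext \<Rightarrow> 's \<Rightarrow> 's \<Rightarrow> 's" where
  "happ ext F x = star_op ext (\<lambda>us. Num (the_fn (us ! 0) (the_pt (us ! 1)))) [F, x]"

definition hcoord :: "('k::finite, 's) ext \<Rightarrow> 's \<Rightarrow> 'k \<Rightarrow> 's" where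
  "hcoord ext x i = star_op ext (\<lambda>us. Num (the_pt (us ! 0) $ i)) [x]"

definition hmem :: "('k::finite, 's) ext \<Rightarrow> 's \<Rightarrow> 's \<Rightarrow> bool" where
  "hmem ext x S \<longleftrightarrow> [x, S] \<in> ext {[Pt a, St B] | a B. a \<in> B}"

text \<open>
  An internal function on an internal set \<open>A\<close> of points is the restriction of an element of the
  extension of the set of all functions \<open>real^'k \<Rightarrow> real\<close> (an internal function on \<open>A\<close>
  extends internally by zero).
\<close>

definition internal_on :: "('k::finite, 's) ext \<Rightarrow> 's set \<Rightarrow> ('s \<Rightarrow> 's) \<Rightarrow> bool" where
  "internal_on ext A f \<longleftrightarrow> (\<exists>F \<in> star_set ext (range Fn). \<forall>x\<in>A. f x = happ ext F x)"

text \<open>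
  The hyperfinite sum of an internal \<open>f\<close> over a hyperfinite set \<open>A\<close> of points: the extension of
  finite summation, applied to internal objects \<open>F\<close> and \<open>S\<close> representing \<open>f\<close> and \<open>A\<close>.
\<close>

definition hsum :: "('k::finite, 's) ext \<Rightarrow> ('s \<Rightarrow> 's) \<Rightarrow> 's set \<Rightarrow> 's" where
  "hsum ext f A =
     (THE s. \<exists>F \<in> star_set ext (range Fn). \<exists>S \<in> star_set ext (St ` Collect finite).
        (\<forall>x\<in>A. f x = happ ext F x) \<and> A = {x. hmem ext x S} \<and>
        s = star_op ext (\<lambda>us. Num (sum (the_fn (us ! 0)) (the_st (us ! 1)))) [F, S])"


section \<open>Grid functions\<close>

definition gridN :: "('k::finite, 's) ext \<Rightarrow> 's \<Rightarrow> 's" where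
  "gridN ext N0 = hfun1 ext (\<lambda>r. fact (nat \<lfloor>r\<rfloor>)) N0"

definition eps :: "('k::finite, 's) ext \<Rightarrow> 's \<Rightarrow> 's" where
  "eps ext N0 = hfun1 ext (\<lambda>r. 1 / r) (gridN ext N0)"

definition gridX :: "('k::finite, 's) ext \<Rightarrow> 's \<Rightarrow> 's set" where
  "gridX ext N0 =
     {hfun2 ext (*) n (eps ext N0) | n. n \<in> hint ext \<and>
        hle ext (hfun1 ext (\<lambda>r. - (r ^ 2)) (gridN ext N0)) n \<and>
        hle ext n (hfun1 ext (\<lambda>r. r ^ 2) (gridN ext N0))}"

definition grid_dom :: "('k::finite, 's) ext \<Rightarrow> 's \<Rightarrow> (real^'k) set \<Rightarrow> 's set" where
  "grid_dom ext N0 \<Omega> = {x \<in> star_set ext (Pt ` \<Omega>). \<forall>i. hcoord ext x i \<in> gridX ext N0}"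

text \<open>Only the values of a grid function on \<open>grid_dom ext N0 \<Omega>\<close> matter.\<close>

definition grid_functions :: "('k::finite, 's) ext \<Rightarrow> 's \<Rightarrow> (real^'k) set \<Rightarrow> ('s \<Rightarrow> 's) set" where
  "grid_functions ext N0 \<Omega> = {f. internal_on ext (grid_dom ext N0 \<Omega>) f}"

definition grid_inner ::
  "('k::finite, 's) ext \<Rightarrow> 's \<Rightarrow> (real^'k) set \<Rightarrow> ('s \<Rightarrow> 's) \<Rightarrow> ('s \<Rightarrow> 's) \<Rightarrow> 's" where
  "grid_inner ext N0 \<Omega> f h =
     hfun2 ext (*) (hfun1 ext (\<lambda>r. r ^ CARD('k)) (eps ext N0))
       (hsum ext (\<lambda>x. hfun2 ext (*) (f x) (h x)) (grid_dom ext N0 \<Omega>))"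

definition grid_norm1 ::
  "('k::finite, 's) ext \<Rightarrow> 's \<Rightarrow> (real^'k) set \<Rightarrow> ('s \<Rightarrow> 's) \<Rightarrow> 's" where
  "grid_norm1 ext N0 \<Omega> f =
     hfun2 ext (*) (hfun1 ext (\<lambda>r. r ^ CARD('k)) (eps ext N0))
       (hsum ext (\<lambda>x. hfun1 ext abs (f x)) (grid_dom ext N0 \<Omega>))"


section \<open>Function spaces and distributions\<close>

definition C0b :: "(real \<Rightarrow> real) set" where
  "C0b = {g. continuous_on UNIV g \<and> bounded (range g) \<and> (g \<longlongrightarrow> 0) at_infinity}"

definition support :: "(real^'k::finite \<Rightarrow> real) \<Rightarrow> (real^'k) set" where
  "support \<phi> = closure {x. \<phi> x \<noteq> 0}"

text \<open>Functions with compact support in \<open>\<Omega>\<close> are identified with their extensions by zero.\<close>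

definition C0c :: "(real^'k::finite) set \<Rightarrow> (real^'k \<Rightarrow> real) set" where
  "C0c \<Omega> = {\<phi>. continuous_on UNIV \<phi> \<and> compact (support \<phi>) \<and> support \<phi> \<subseteq> \<Omega>}"

definition sup_norm :: "(real^'k::finite \<Rightarrow> real) \<Rightarrow> real" where
  "sup_norm \<phi> = (SUP x. \<bar>\<phi> x\<bar>)"

definition linear_functional_on ::
  "(real^'k::finite \<Rightarrow> real) set \<Rightarrow> ((real^'k \<Rightarrow> real) \<Rightarrow> real) \<Rightarrow> bool" where
  "linear_functional_on V L \<longleftrightarrow>
     (\<forall>\<phi>\<in>V. \<forall>\<psi>\<in>V. \<forall>a b. L (\<lambda>x. a * \<phi> x + b * \<psi> x) = a * L \<phi> + b * L \<psi>)"

definition C0c_dual :: "(real^'k::finite) set \<Rightarrow> ((real^'k \<Rightarrow> real) \<Rightarrow> real) set" where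
  "C0c_dual \<Omega> =
     {L. linear_functional_on (C0c \<Omega>) L \<and> (\<exists>C. \<forall>\<phi>\<in>C0c \<Omega>. \<bar>L \<phi>\<bar> \<le> C * sup_norm \<phi>)}"

definition weak_star_tendsto ::
  "(real^'k::finite) set \<Rightarrow> (nat \<Rightarrow> (real^'k \<Rightarrow> real) \<Rightarrow> real) \<Rightarrow> ((real^'k \<Rightarrow> real) \<Rightarrow> real) \<Rightarrow> bool" where
  "weak_star_tendsto \<Omega> L l \<longleftrightarrow>
     (\<forall>n. L n \<in> C0c_dual \<Omega>) \<and> l \<in> C0c_dual \<Omega> \<and> (\<forall>\<phi>\<in>C0c \<Omega>. (\<lambda>n. L n \<phi>) \<longlonglongrightarrow> l \<phi>)"

definition L1_functional ::
  "(real^'k::finite) set \<Rightarrow> (real^'k \<Rightarrow> real) \<Rightarrow> (real^'k \<Rightarrow> real) \<Rightarrow> real" where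
  "L1_functional \<Omega> w \<phi> = (\<integral>x. w x * \<phi> x \<partial>lebesgue_on \<Omega>)"

text \<open>
  Iterated partial derivatives along a list of coordinates. A function is smooth iff all of them
  exist and are continuous, equivalently iff all of them are differentiable.
\<close>

primrec partial_derivs :: "'k list \<Rightarrow> (real^'k::finite \<Rightarrow> real) \<Rightarrow> real^'k \<Rightarrow> real" where
  "partial_derivs [] \<phi> = \<phi>"
| "partial_derivs (i # is) \<phi> = (\<lambda>x. frechet_derivative (partial_derivs is \<phi>) (at x) (axis i 1))"

definition test_functions :: "(real^'k::finite) set \<Rightarrow> (real^'k \<Rightarrow> real) set" where
  "test_functions \<Omega> =
     {\<phi>. (\<forall>is x. partial_derivs is \<phi> differentiable (at x)) \<and>
         compact (support \<phi>) \<and> support \<phi> \<subseteq> \<Omega>}"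

text \<open>
  Distributions are \<open>undefined\<close> outside the test functions, so that the set of them has the
  right cardinality. Continuity is the usual seminorm estimate on each compact set.
\<close>

definition distributions :: "(real^'k::finite) set \<Rightarrow> ((real^'k \<Rightarrow> real) \<Rightarrow> real) set" where
  "distributions \<Omega> =
     {T \<in> extensional (test_functions \<Omega>).
        linear_functional_on (test_functions \<Omega>) T \<and>
        (\<forall>K. compact K \<and> K \<subseteq> \<Omega> \<longrightarrow>
          (\<exists>C m. \<forall>\<phi>\<in>test_functions \<Omega>. support \<phi> \<subseteq> K \<longrightarrow>
            (\<forall>B. (\<forall>is x. length is \<le> m \<longrightarrow> \<bar>partial_derivs is \<phi> x\<bar> \<le> B) \<longrightarrow> \<bar>T \<phi>\<bar> \<le> C * B)))}"


section \<open>Parametrized measures\<close>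

text \<open>
  Signed measures on the real line are set functions, considered on Borel sets only. The upper
  variation and the upper variation of \<open>-\<mu>\<close> form the Jordan decomposition of \<open>\<mu>\<close>.
  Finite Borel measures on the line are automatically Radon.
\<close>

definition upper_variation :: "(real set \<Rightarrow> real) \<Rightarrow> real set \<Rightarrow> ennreal" where
  "upper_variation \<mu> A = (SUP B\<in>{B \<in> sets borel. B \<subseteq> A}. ennreal (\<mu> B))"

definition total_variation :: "(real set \<Rightarrow> real) \<Rightarrow> real set \<Rightarrow> ennreal" where
  "total_variation \<mu> A = upper_variation \<mu> A + upper_variation (\<lambda>B. - \<mu> B) A"

definition radon_measures :: "(real set \<Rightarrow> real) set" where
  "radon_measures =
     {\<mu>. \<mu> {} = 0 \<and>
         (\<forall>A::nat \<Rightarrow> real set. range A \<subseteq> sets borel \<and> disjoint_family A \<longrightarrow>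
            (\<lambda>n. \<mu> (A n)) sums \<mu> (\<Union>n. A n)) \<and>
         total_variation \<mu> UNIV < \<infinity>}"

definition radon_prob_measures :: "(real set \<Rightarrow> real) set" where
  "radon_prob_measures =
     {\<mu> \<in> radon_measures. (\<forall>A \<in> sets borel. 0 \<le> \<mu> A) \<and> \<mu> UNIV = 1}"

definition signed_integral :: "(real set \<Rightarrow> real) \<Rightarrow> (real \<Rightarrow> real) \<Rightarrow> real" where
  "signed_integral \<mu> g =
     (\<integral>t. g t \<partial>measure_of UNIV (sets borel) (upper_variation \<mu>)) -
     (\<integral>t. g t \<partial>measure_of UNIV (sets borel) (upper_variation (\<lambda>B. - \<mu> B)))"

definition parametrized_measure ::
  "(real^'k::finite) set \<Rightarrow> (real^'k \<Rightarrow> real set \<Rightarrow> real) \<Rightarrow> bool" where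
  "parametrized_measure \<Omega> \<nu> \<longleftrightarrow>
     (\<forall>x\<in>\<Omega>. \<nu> x \<in> radon_measures) \<and>
     (\<forall>g\<in>C0b. (\<lambda>x. signed_integral (\<nu> x) g) \<in> borel_measurable (lebesgue_on \<Omega>))"

text \<open>
  Parametrized measures are considered up to null sets of \<open>x\<close>, hence so is the condition of
  having probability measures as values.
\<close>

definition young_measure ::
  "(real^'k::finite) set \<Rightarrow> (real^'k \<Rightarrow> real set \<Rightarrow> real) \<Rightarrow> bool" where
  "young_measure \<Omega> \<nu> \<longleftrightarrow>
     parametrized_measure \<Omega> \<nu> \<and> (AE x in lebesgue_on \<Omega>. \<nu> x \<in> radon_prob_measures)"

definition young_tendsto ::
  "(real^'k::finite) set \<Rightarrow> (nat \<Rightarrow> real^'k \<Rightarrow> real) \<Rightarrow> (real^'k \<Rightarrow> real set \<Rightarrow> real) \<Rightarrow> bool" where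
  "young_tendsto \<Omega> zs \<nu> \<longleftrightarrow>
     (\<forall>n. integrable (lebesgue_on \<Omega>) (zs n)) \<and>
     (\<exists>C. \<forall>n. (\<integral>x. \<bar>zs n x\<bar> \<partial>lebesgue_on \<Omega>) \<le> C) \<and>
     young_measure \<Omega> \<nu> \<and>
     (\<forall>g\<in>C0b. \<forall>\<phi>\<in>C0c \<Omega>.
        (\<lambda>n. \<integral>x. g (zs n x) * \<phi> x \<partial>lebesgue_on \<Omega>)
          \<longlonglongrightarrow> (\<integral>x. signed_integral (\<nu> x) g * \<phi> x \<partial>lebesgue_on \<Omega>))"


section \<open>The functional and the parametrized measure of a grid function\<close>

definition grid_functional ::
  "('k::finite, 's) ext \<Rightarrow> 's \<Rightarrow> (real^'k) set \<Rightarrow> ('s \<Rightarrow> 's) \<Rightarrow> (real^'k \<Rightarrow> real) \<Rightarrow> real" where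
  "grid_functional ext N0 \<Omega> z \<phi> = standard_part ext (grid_inner ext N0 \<Omega> z (hfield ext \<phi>))"

text \<open>\<open>\<nu>\<close> is (a representative of) the parametrized measure associated with the grid function \<open>f\<close>.\<close>

definition grid_measure ::
  "('k::finite, 's) ext \<Rightarrow> 's \<Rightarrow> (real^'k) set \<Rightarrow> ('s \<Rightarrow> 's) \<Rightarrow> (real^'k \<Rightarrow> real set \<Rightarrow> real) \<Rightarrow> bool" where
  "grid_measure ext N0 \<Omega> f \<nu> \<longleftrightarrow>
     parametrized_measure \<Omega> \<nu> \<and>
     (\<forall>g\<in>C0b. \<forall>\<phi>\<in>C0c \<Omega>.
        has_bochner_integral (lebesgue_on \<Omega>) (\<lambda>x. signed_integral (\<nu> x) g * \<phi> x)
          (standard_part ext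
            (grid_inner ext N0 \<Omega> (\<lambda>x. hfun1 ext g (f x)) (hfield ext \<phi>))))"

end

theory Submission
  imports Defs
begin

text \<open>
  The internal objects \<open>N0\<close> and \<open>z\<close> generate an ultrafilter on the pairs of a grid size and a
  standard real function: a set of pairs belongs to it iff its extension contains \<open>(N0, z)\<close>.
  Standard parts of hyperfinite sums are limits of the corresponding finite sums along this
  ultrafilter, and a finite sum differs from the integral of the step function that is constant on the
  cells of the grid by an amount that vanishes along the ultrafilter. Uniform approximation of
  \<open>C0b\<close> and \<open>C0c\<close> by countably many step functions leaves countably many limits to be
  realized, so a sequence of pairs suffices. That \<open>\<nu>\<close> is a Young measure
  follows from positivity and the \<open>L\<^sup>1\<close> bound, which are inherited by the limits.
\<close>

section \<open>Transfer for tuples\<close>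

text \<open>Only the tuple of \<open>N0\<close> and one internal function representing
  \<open>z\<close> matters, since each inner product and norm in the statement is the extension of a
  standard function evaluated at this tuple. The resulting ultrafilter need not have a countable
  base, so a sequence cannot be expected to follow all its limits. A diagonal choice follows
  countably many of them, and uniform approximation spreads the convergence to all \<open>g\<close>
  and \<open>\<phi>\<close>. For this the pairs are confined to a set where the grid L1 norm has a
  fixed bound, because there a small uniform change of \<open>\<phi>\<close> changes the integrals
  by a uniformly small amount. Two obstacles shape the rest. First, \<open>g 0\<close> may be
  nonzero: off the grid cells the step function is 0, so composing it with \<open>g\<close> differs
  from the step function of the composite, and the cells on which \<open>\<phi>\<close> lives must
  all belong to the grid. Second, \<open>\<nu>\<close> is known only through its integrals against
  \<open>C0b\<close>, as a family of signed measures with exceptional null sets, and constants are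
  not in \<open>C0b\<close>. Positivity is therefore read off countably many test functions, and
  total mass 1 from cutoffs tending to 1.\<close>

definition hev :: "('u list set \<Rightarrow> 's list set) \<Rightarrow> 's list \<Rightarrow> ('u list \<Rightarrow> bool) \<Rightarrow> bool" where
  "hev ext xs P \<longleftrightarrow> xs \<in> ext {us. P us}"

lemma map_nth_take: "n \<le> length us \<Longrightarrow> map ((!) us) [0..<n] = take n us"
  by (simp add: list_eq_iff_nth_eq)

lemma map_nth_drop: "length us = m \<Longrightarrow> map ((!) us) [n..<m] = drop n us"
  by (auto simp: list_eq_iff_nth_eq)

lemma map_nth_append: "map ((!) (xs @ ys)) [0..<length xs] = xs"
  using map_nth_take[of "length xs" "xs @ ys"] by simp

locale nonstandard_extension =
  fixes ext :: "'u list set \<Rightarrow> 's list set"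
  assumes transfer: "transfer_principle ext"
begin

lemma transferD: "(\<And>e. sat (\<lambda>R. R) e p) \<Longrightarrow> sat ext e p"
  using transfer unfolding transfer_principle_def by blast

lemma obtain_environment: obtains e where "map e [0..<length xs] = xs"
  by (meson map_nth)

text \<open>A relation may contain lists of every length, but an atom with n variables only tests
  lists of length n. Hence the implication is required only for lists as long as
  \<open>xs\<close>.\<close>

lemma hev_mono:
  assumes "hev ext xs P" "\<And>us. length us = length xs \<Longrightarrow> P us \<Longrightarrow> Q us"
  shows "hev ext xs Q"
proof -
  obtain e where e: "map e [0..<length xs] = xs" by (rule obtain_environment)
  have "sat ext e (Neg (Conj (Rel {us. P us} [0..<length xs]) (Neg (Rel {us. Q us} [0..<length xs]))))"
    by (rule transferD) (auto intro: assms(2))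
  then show ?thesis using assms(1) e by (simp add: hev_def)
qed

lemma hev_cong:
  "(\<And>us. length us = length xs \<Longrightarrow> P us \<longleftrightarrow> Q us) \<Longrightarrow> hev ext xs P \<longleftrightarrow> hev ext xs Q"
  using hev_mono by blast

lemma hev_conj: "hev ext xs (\<lambda>us. P us \<and> Q us) \<longleftrightarrow> hev ext xs P \<and> hev ext xs Q"
proof
  obtain e where e: "map e [0..<length xs] = xs" by (rule obtain_environment)
  have "sat ext e (Neg (Conj (Conj (Rel {us. P us} [0..<length xs]) (Rel {us. Q us} [0..<length xs]))
     (Neg (Rel {us. P us \<and> Q us} [0..<length xs]))))"
    by (rule transferD) auto
  moreover assume "hev ext xs P \<and> hev ext xs Q"
  ultimately show "hev ext xs (\<lambda>us. P us \<and> Q us)" using e by (simp add: hev_def)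
qed (auto elim: hev_mono)

text \<open>The atoms for \<open>P\<close> and for its negation split the lists of the given length,
  so transfer puts \<open>xs\<close> in exactly one of the two extensions. This is what makes the
  filter of a tuple an ultrafilter.\<close>

lemma hev_not: "hev ext xs (\<lambda>us. \<not> P us) \<longleftrightarrow> \<not> hev ext xs P"
proof -
  obtain e where e: "map e [0..<length xs] = xs" by (rule obtain_environment)
  let ?A = "Rel {us. \<not> P us} [0..<length xs]" and ?B = "Rel {us. P us} [0..<length xs]"
  have "sat ext e (Conj (Neg (Conj ?A ?B)) (Neg (Conj (Neg ?A) (Neg ?B))))"
    by (rule transferD) auto
  then show ?thesis using e by (auto simp: hev_def)
qed

lemma hev_True: "(\<And>us. length us = length xs \<Longrightarrow> P us) \<Longrightarrow> hev ext xs P"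
proof (rule ccontr)
  assume P: "\<And>us. length us = length xs \<Longrightarrow> P us" and "\<not> hev ext xs P"
  then have "hev ext xs (\<lambda>us. \<not> P us)" by (simp add: hev_not)
  then show False
    using hev_mono[of xs "\<lambda>us. \<not> P us" P] P \<open>\<not> hev ext xs P\<close> by blast
qed

lemma hev_mp: "hev ext xs (\<lambda>us. P us \<longrightarrow> Q us) \<Longrightarrow> hev ext xs P \<Longrightarrow> hev ext xs Q"
  using hev_conj[of xs P "\<lambda>us. P us \<longrightarrow> Q us"] by (auto elim: hev_mono)

text \<open>All elements of the nonstandard domain are internal, so the transferred quantifier
  ranges over arbitrary y. The direction from left to right supplies internal witnesses, such as the
  values of extended operations.\<close>

lemma hev_ex: "hev ext xs (\<lambda>us. \<exists>v. P (us @ [v])) \<longleftrightarrow> (\<exists>y. hev ext (xs @ [y]) P)"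
proof -
  define n where "n = length xs"
  obtain e where e: "map e [0..<length xs] = xs" by (rule obtain_environment)
  have [simp]: "map (e(n := a)) [0..<n] = map e [0..<n]" for e :: "nat \<Rightarrow> 'b" and a
    by auto
  \<comment> \<open>The variables below n hold \<open>xs\<close>; binding variable n appends one
    entry to the tuple.\<close>
  let ?A = "Rel {us. \<exists>v. P (us @ [v])} [0..<n]" and ?B = "Neg (All n (Neg (Rel {us. P us} [0..<Suc n])))"
  have "sat ext e (Conj (Neg (Conj ?A (Neg ?B))) (Neg (Conj ?B (Neg ?A))))"
    by (rule transferD) auto
  then show ?thesis using e by (auto simp: hev_def n_def[symmetric])
qed

lemma hev_all: "hev ext xs (\<lambda>us. \<forall>v. P (us @ [v])) \<longleftrightarrow> (\<forall>y. hev ext (xs @ [y]) P)"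
  using hev_ex[of xs "\<lambda>us. \<not> P us"] hev_not[of xs "\<lambda>us. \<exists>v. \<not> P (us @ [v])"] by (simp add: hev_not)

text \<open>An atom may list its variables in any order and with repetitions, so passing to a
  selected subtuple is itself a transferred equivalence. It lets a single tuple hold all objects
  under comparison.\<close>

lemma hev_reindex:
  assumes "\<And>i. i \<in> set is \<Longrightarrow> i < length xs"
  shows "hev ext (map ((!) xs) is) P \<longleftrightarrow> hev ext xs (\<lambda>us. P (map ((!) us) is))"
proof -
  obtain e where e: "map e [0..<length xs] = xs" by (rule obtain_environment)
  have *: "map ((!) (map e [0..<length xs])) is = map e is" for e :: "nat \<Rightarrow> 'b"
    using assms by simp
  let ?A = "Rel {us. P us} is" and ?B = "Rel {us. P (map ((!) us) is)} [0..<length xs]"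
  have "sat ext e (Conj (Neg (Conj ?A (Neg ?B))) (Neg (Conj ?B (Neg ?A))))"
    by (rule transferD) (auto simp: *)
  then have "map e is \<in> ext {us. P us} \<longleftrightarrow> xs \<in> ext {us. P (map ((!) us) is)}"
    unfolding sat.simps e by blast
  then show ?thesis unfolding hev_def *[of e, unfolded e] .
qed

text \<open>\<open>Eq\<close> is interpreted as true equality in both structures. This is the link
  from coinciding coordinates of standard lists to equality of internal objects.\<close>

lemma hev_eq_nth:
  assumes "i < length xs" "j < length xs"
  shows "hev ext xs (\<lambda>us. us ! i = us ! j) \<longleftrightarrow> xs ! i = xs ! j"
proof -
  obtain e where e: "map e [0..<length xs] = xs" by (rule obtain_environment)
  let ?A = "Rel {us. us ! i = us ! j} [0..<length xs]" and ?B = "Eq i j"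
  have "sat ext e (Conj (Neg (Conj ?A (Neg ?B))) (Neg (Conj ?B (Neg ?A))))"
    by (rule transferD) (use assms in auto)
  moreover have "xs ! i = e i" "xs ! j = e j" using assms e
    by (metis add_0 length_map length_upt minus_nat.diff_0 nth_map nth_upt)+
  ultimately show ?thesis using e by (auto simp: hev_def)
qed

lemma hev_Ball_finite:
  "finite I \<Longrightarrow> hev ext xs (\<lambda>us. \<forall>i\<in>I. P i us) \<longleftrightarrow> (\<forall>i\<in>I. hev ext xs (P i))"
  by (induction I rule: finite_induct) (auto simp: hev_True hev_conj)

lemma hev_take: "n \<le> length xs \<Longrightarrow> hev ext (take n xs) P \<longleftrightarrow> hev ext xs (\<lambda>us. P (take n us))"
proof -
  assume n: "n \<le> length xs"
  have "hev ext (take n xs) P \<longleftrightarrow> hev ext (map ((!) xs) [0..<n]) P" by (simp add: map_nth_take n)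
  also have "\<dots> \<longleftrightarrow> hev ext xs (\<lambda>us. P (map ((!) us) [0..<n]))"
    by (rule hev_reindex) (use n in auto)
  also have "\<dots> \<longleftrightarrow> hev ext xs (\<lambda>us. P (take n us))"
    by (rule hev_cong) (simp add: map_nth_take n)
  finally show ?thesis .
qed

lemma hev_drop: "n \<le> length xs \<Longrightarrow> hev ext (drop n xs) P \<longleftrightarrow> hev ext xs (\<lambda>us. P (drop n us))"
proof -
  assume n: "n \<le> length xs"
  have "hev ext (drop n xs) P \<longleftrightarrow> hev ext (map ((!) xs) [n..<length xs]) P" by (simp add: map_nth_drop)
  also have "\<dots> \<longleftrightarrow> hev ext xs (\<lambda>us. P (map ((!) us) [n..<length xs]))"
    by (rule hev_reindex) (use n in auto)
  also have "\<dots> \<longleftrightarrow> hev ext xs (\<lambda>us. P (drop n us))"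
    by (rule hev_cong) (simp add: map_nth_drop)
  finally show ?thesis .
qed

section \<open>Extended operations and their values as germs\<close>

lemma graph_iff:
  "xs @ [y] \<in> ext {us @ [h us] | us. True} \<longleftrightarrow>
   hev ext (xs @ [y]) (\<lambda>us. us ! length xs = h (take (length xs) us))"
proof -
  have "xs @ [y] \<in> ext {us @ [h us] | us. True} \<longleftrightarrow>
    hev ext (xs @ [y]) (\<lambda>us. \<exists>vs. us = vs @ [h vs])"
    by (simp add: hev_def)
  also have "\<dots> \<longleftrightarrow> hev ext (xs @ [y]) (\<lambda>us. us ! length xs = h (take (length xs) us))"
  proof (rule hev_cong)
    fix us :: "'u list" assume "length us = length (xs @ [y])"
    then obtain vs v where "us = vs @ [v]" "length vs = length xs"
      by (metis append_butlast_last_id length_append_singleton length_butlast diff_Suc_1 list.size(3) nat.distinct(1))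
    then show "(\<exists>vs. us = vs @ [h vs]) \<longleftrightarrow> us ! length xs = h (take (length xs) us)"
      by (auto simp: nth_append)
  qed
  finally show ?thesis .
qed

text \<open>Existence transfers the totality of the operation. For uniqueness, two candidate values
  are placed in one tuple, where the graph property forces both entries to be the value of
  \<open>h\<close> at the preceding ones.\<close>

lemma star_op_ex1: "\<exists>!y. xs @ [y] \<in> ext {us @ [h us] | us. True}"
proof (rule ex_ex1I)
  have "hev ext xs (\<lambda>us. \<exists>v. us @ [v] \<in> {us @ [h us] | us. True})"
    by (rule hev_True) auto
  then have "\<exists>y. hev ext (xs @ [y]) (\<lambda>us. us \<in> {us @ [h us] | us. True})"
    by (rule hev_ex[THEN iffD1])
  then show "\<exists>y. xs @ [y] \<in> ext {us @ [h us] | us. True}"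
    unfolding hev_def by simp
next
  fix y y' let ?n = "length xs"
  assume y: "xs @ [y] \<in> ext {us @ [h us] | us. True}" and y': "xs @ [y'] \<in> ext {us @ [h us] | us. True}"
  let ?zs = "xs @ [y, y']"
  have "hev ext (take (Suc ?n) ?zs) (\<lambda>us. us ! ?n = h (take ?n us))"
    using y unfolding graph_iff by simp
  then have 1: "hev ext ?zs (\<lambda>us. us ! ?n = h (take ?n us))"
    by (subst (asm) hev_take) auto
  \<comment> \<open>The index list skips position \<open>?n\<close>, so it picks \<open>xs\<close>
    followed by \<open>y'\<close>.\<close>
  have m: "map ((!) ?zs) ([0..<?n] @ [Suc ?n]) = xs @ [y']"
    by (simp add: map_nth_append) (simp add: nth_append)
  have "hev ext (map ((!) ?zs) ([0..<?n] @ [Suc ?n])) (\<lambda>us. us ! ?n = h (take ?n us))"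
    using y' unfolding graph_iff m by simp
  then have "hev ext ?zs (\<lambda>us. map ((!) us) ([0..<?n] @ [Suc ?n]) ! ?n = h (take ?n (map ((!) us) ([0..<?n] @ [Suc ?n]))))"
    by (subst (asm) hev_reindex) auto
  moreover have "take ?n (map ((!) us) ([0..<?n] @ [Suc ?n])) = take ?n us"
    if "length us = ?n + 2" for us :: "'u list"
    using that by (simp add: map_nth_take)
  ultimately have "hev ext ?zs (\<lambda>us. us ! Suc ?n = h (take ?n us))"
    by (elim hev_mono) (auto simp: nth_append)
  then have "hev ext ?zs (\<lambda>us. us ! ?n = us ! Suc ?n)"
    by (rule hev_mono[OF hev_conj[THEN iffD2, OF conjI[OF 1]]]) auto
  then show "y = y'"
    by (subst (asm) hev_eq_nth) (auto simp: nth_append)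
qed

lemma star_op_graph: "hev ext (xs @ [star_op ext h xs]) (\<lambda>us. us ! length xs = h (take (length xs) us))"
  unfolding graph_iff[symmetric] star_op_def by (rule theI'[OF star_op_ex1])

text \<open>Substitution of terms. After appending the values to \<open>xs\<close>, the graph
  property says that the new entries are the standard values of the operations at the old ones, so
  the new block can be eliminated from any property. In terms of filters, the filter of the tuple of
  values is the image of the filter of \<open>xs\<close>.\<close>

lemma hev_star_op:
  "hev ext (map (\<lambda>h. star_op ext h xs) hs) P \<longleftrightarrow> hev ext xs (\<lambda>us. P (map (\<lambda>h. h us) hs))"
proof -
  let ?n = "length xs"
  define ys where "ys = map (\<lambda>h. star_op ext h xs) hs"
  have "hev ext (xs @ ys) (\<lambda>us. us ! (?n + i) = (hs ! i) (take ?n us))" if i: "i < length hs" for i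
  proof -
    have m: "map ((!) (xs @ ys)) ([0..<?n] @ [?n + i]) = xs @ [star_op ext (hs ! i) xs]"
      using i by (simp add: map_nth_append) (simp add: nth_append ys_def)
    have "hev ext (map ((!) (xs @ ys)) ([0..<?n] @ [?n + i])) (\<lambda>us. us ! ?n = (hs ! i) (take ?n us))"
      unfolding m by (rule star_op_graph)
    then have "hev ext (xs @ ys) (\<lambda>us. map ((!) us) ([0..<?n] @ [?n + i]) ! ?n =
        (hs ! i) (take ?n (map ((!) us) ([0..<?n] @ [?n + i]))))"
      by (subst (asm) hev_reindex) (use i in \<open>auto simp: ys_def\<close>)
    moreover have "take ?n (map ((!) us) ([0..<?n] @ [?n + i])) = take ?n us"
      if "length us = length (xs @ ys)" for us :: "'u list"
      using that by (simp add: map_nth_take)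
    ultimately show ?thesis
      by (elim hev_mono) (auto simp: nth_append)
  qed
  then have "hev ext (xs @ ys) (\<lambda>us. \<forall>i\<in>{..<length hs}. us ! (?n + i) = (hs ! i) (take ?n us))"
    by (subst hev_Ball_finite) auto
  then have *: "hev ext (xs @ ys) (\<lambda>us. drop ?n us = map (\<lambda>h. h (take ?n us)) hs)"
  proof (rule hev_mono)
    fix us :: "'u list"
    assume "length us = length (xs @ ys)" "\<forall>i\<in>{..<length hs}. us ! (?n + i) = (hs ! i) (take ?n us)"
    then show "drop ?n us = map (\<lambda>h. h (take ?n us)) hs"
      by (intro nth_equalityI) (simp_all add: ys_def)
  qed
  have "hev ext ys P \<longleftrightarrow> hev ext (xs @ ys) (\<lambda>us. P (drop ?n us))"
    using hev_drop[of ?n "xs @ ys" P] by simp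
  also have "\<dots> \<longleftrightarrow> hev ext (xs @ ys) (\<lambda>us. P (map (\<lambda>h. h (take ?n us)) hs))"
  proof
    show "hev ext (xs @ ys) (\<lambda>us. P (map (\<lambda>h. h (take ?n us)) hs))"
      if "hev ext (xs @ ys) (\<lambda>us. P (drop ?n us))"
      by (rule hev_mono[OF hev_conj[THEN iffD2, OF conjI[OF * that]]]) auto
    show "hev ext (xs @ ys) (\<lambda>us. P (drop ?n us))"
      if "hev ext (xs @ ys) (\<lambda>us. P (map (\<lambda>h. h (take ?n us)) hs))"
      by (rule hev_mono[OF hev_conj[THEN iffD2, OF conjI[OF * that]]]) auto
  qed
  also have "\<dots> \<longleftrightarrow> hev ext xs (\<lambda>us. P (map (\<lambda>h. h us) hs))"
    using hev_take[of ?n "xs @ ys" "\<lambda>us. P (map (\<lambda>h. h us) hs)"] by simp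
  finally show ?thesis by (simp add: ys_def)
qed

lemma hev_star_op1: "hev ext [star_op ext a xs] P \<longleftrightarrow> hev ext xs (\<lambda>us. P [a us])"
  using hev_star_op[of xs "[a]" P] by simp

lemma hev_star_op2:
  "hev ext [star_op ext a xs, star_op ext b xs] P \<longleftrightarrow> hev ext xs (\<lambda>us. P [a us, b us])"
  using hev_star_op[of xs "[a, b]" P] by simp

text \<open>Over a fixed tuple, \<open>star_op ext a xs\<close> thus behaves as the germ of
  \<open>a\<close>, as in an ultrapower.\<close>

lemma star_op_eq_iff:
  "star_op ext a xs = star_op ext b xs \<longleftrightarrow> hev ext xs (\<lambda>us. a us = b us)"
  using hev_star_op2[of a xs b "\<lambda>us. us ! 0 = us ! 1"]
    hev_eq_nth[of 0 "[star_op ext a xs, star_op ext b xs]" 1] by simp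

lemma star_op_eqI:
  assumes "hev ext (xs @ [y]) (\<lambda>us. us ! length xs = h (take (length xs) us))"
  shows "star_op ext h xs = y"
  using assms unfolding graph_iff[symmetric] star_op_def by (intro the1_equality star_op_ex1)

text \<open>Any internal object is the germ of a coordinate projection, so objects that are not
  given as terms can be rewritten over a common tuple.\<close>

lemma star_op_nth:
  assumes "i < length xs" shows "star_op ext (\<lambda>us. us ! i) xs = xs ! i"
proof (rule star_op_eqI)
  have "hev ext (xs @ [xs ! i]) (\<lambda>us. us ! length xs = us ! i)"
    using assms by (subst hev_eq_nth) (auto simp: nth_append)
  then show "hev ext (xs @ [xs ! i]) (\<lambda>us. us ! length xs = take (length xs) us ! i)"
    by (rule hev_mono) (use assms in auto)
qed

lemma star_op_comp:
  "star_op ext h (map (\<lambda>a. star_op ext a xs) as) = star_op ext (\<lambda>us. h (map (\<lambda>a. a us) as)) xs"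
proof (rule star_op_eqI)
  let ?b = "\<lambda>us. h (map (\<lambda>a. a us) as)"
  have "map (\<lambda>a. star_op ext a xs) as @ [star_op ext ?b xs] = map (\<lambda>a. star_op ext a xs) (as @ [?b])"
    by simp
  then show "hev ext (map (\<lambda>a. star_op ext a xs) as @ [star_op ext ?b xs])
     (\<lambda>us. us ! length (map (\<lambda>a. star_op ext a xs) as) =
       h (take (length (map (\<lambda>a. star_op ext a xs) as)) us))"
    by (simp only: hev_star_op) (auto intro!: hev_True simp: nth_append)
qed

lemma star_op_comp1: "star_op ext h [star_op ext a xs] = star_op ext (\<lambda>us. h [a us]) xs"
  using star_op_comp[of h xs "[a]"] by simp

lemma star_op_comp2:
  "star_op ext h [star_op ext a xs, star_op ext b xs] = star_op ext (\<lambda>us. h [a us, b us]) xs"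
  using star_op_comp[of h xs "[a, b]"] by simp

text \<open>Change of base: a germ over \<open>xs\<close> is also a germ over any longer tuple. This
  is used when a grid point joins the parameters.\<close>

lemma star_op_take: "star_op ext h xs = star_op ext (\<lambda>us. h (take (length xs) us)) (xs @ ys)"
proof -
  let ?as = "map (\<lambda>i us. us ! i) [0..<length xs] :: ('u list \<Rightarrow> 'u) list"
  have "map (\<lambda>a. star_op ext a (xs @ ys)) ?as = xs"
    by (rule nth_equalityI) (simp_all add: star_op_nth nth_append)
  then have "star_op ext h xs = star_op ext (\<lambda>us. h (map (\<lambda>a. a us) ?as)) (xs @ ys)"
    using star_op_comp[of h "xs @ ys" ?as] by simp
  also have "\<dots> = star_op ext (\<lambda>us. h (take (length xs) us)) (xs @ ys)"
    unfolding star_op_eq_iff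
    by (rule hev_True, rule arg_cong[where f = h], rule nth_equalityI) simp_all
  finally show ?thesis .
qed

lemma star_eq_star_op: "star ext u = star_op ext (\<lambda>_. u) xs"
proof -
  have *: "[s] \<in> ext {[u]} \<longleftrightarrow> [] @ [s] \<in> ext {us @ [(\<lambda>_. u) us] | us. True}" for s
  proof -
    have "[s] \<in> ext {[u]} \<longleftrightarrow> hev ext [s] (\<lambda>us. us = [u])" by (simp add: hev_def)
    also have "\<dots> \<longleftrightarrow> hev ext [s] (\<lambda>us. us ! 0 = u)"
      by (rule hev_cong) (auto simp: length_Suc_conv)
    also have "\<dots> \<longleftrightarrow> [] @ [s] \<in> ext {us @ [(\<lambda>_. u) us] | us. True}"
      unfolding graph_iff by simp
    finally show ?thesis .
  qed
  have "star ext u = star_op ext (\<lambda>_. u) []"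
    unfolding star_def * star_op_def ..
  also have "\<dots> = star_op ext (\<lambda>_. u) xs" using star_op_take[of "\<lambda>_. u" "[]" xs] by simp
  finally show ?thesis .
qed

lemma star_set_iff: "star_op ext a xs \<in> star_set ext A \<longleftrightarrow> hev ext xs (\<lambda>us. a us \<in> A)"
proof -
  have "star_op ext a xs \<in> star_set ext A \<longleftrightarrow> hev ext [star_op ext a xs] (\<lambda>us. \<exists>u\<in>A. us = [u])"
    by (simp add: star_set_def hev_def Bex_def Setcompr_eq_image conj_commute)
  then show ?thesis by (simp add: hev_star_op1)
qed

definition tuple_filter :: "'s list \<Rightarrow> 'u list filter" where
  "tuple_filter xs = Abs_filter (hev ext xs)"

lemma eventually_tuple_filter: "eventually P (tuple_filter xs) \<longleftrightarrow> hev ext xs P"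
  unfolding tuple_filter_def
proof (rule eventually_Abs_filter, standard)
qed (auto simp: hev_conj intro: hev_True elim: hev_mp[rotated] hev_mono)

lemma tuple_filter_ultra:
  "tuple_filter xs \<noteq> bot"
  "eventually P (tuple_filter xs) \<or> eventually (\<lambda>us. \<not> P us) (tuple_filter xs)"
  using hev_not[of xs "\<lambda>_. True"]
  by (auto simp: trivial_limit_def eventually_tuple_filter hev_not hev_True)

end

section \<open>Grid sums and step functions\<close>

text \<open>The formula mirrors \<open>gridX\<close>, including the form \<open>n * (1 / N)\<close>
  and the real bounds on an integer, so that \<open>grid_dom_iff\<close> can identify its extension
  with \<open>grid_dom\<close> coordinate by coordinate.\<close>

definition grid_points :: "(real^'k::finite) set \<Rightarrow> real \<Rightarrow> (real^'k) set" where
  "grid_points \<Omega> N = {x \<in> \<Omega>. \<forall>i. \<exists>n\<in>\<int>. - (N\<^sup>2) \<le> n \<and> n \<le> N\<^sup>2 \<and> x $ i = n * (1 / N)}"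

definition cell_corner :: "real \<Rightarrow> real^'k::finite \<Rightarrow> real^'k" where
  "cell_corner N x = (\<chi> i. of_int \<lfloor>N * x $ i\<rfloor> * (1 / N))"

definition grid_sum :: "(real^'k::finite) set \<Rightarrow> real \<Rightarrow> (real^'k \<Rightarrow> real) \<Rightarrow> real" where
  "grid_sum \<Omega> N w = (1 / N) ^ CARD('k) * sum w (grid_points \<Omega> N)"

text \<open>The value is 0 also on a cell that meets \<Omega> but has its corner outside, and a cell
  with its corner in \<Omega> counts in full even where it leaves \<Omega>. Integrals over the whole
  space are then exact grid sums.\<close>

definition step_fn :: "(real^'k::finite) set \<Rightarrow> real \<Rightarrow> (real^'k \<Rightarrow> real) \<Rightarrow> real^'k \<Rightarrow> real" where
  "step_fn \<Omega> N w x = (if cell_corner N x \<in> grid_points \<Omega> N then w (cell_corner N x) else 0)"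

lemma finite_grid_points: "finite (grid_points \<Omega> N)"
proof -
  define A where "A = (\<lambda>m::int. of_int m * (1 / N)) ` {\<lfloor>- (N\<^sup>2)\<rfloor>..\<lceil>N\<^sup>2\<rceil>}"
  have "x $ i \<in> A" if "x \<in> grid_points \<Omega> N" for x i
  proof -
    obtain n where n: "n \<in> \<int>" "- (N\<^sup>2) \<le> n" "n \<le> N\<^sup>2" "x $ i = n * (1 / N)"
      using \<open>x \<in> grid_points \<Omega> N\<close> unfolding grid_points_def by blast
    from n(1) obtain m where m: "n = of_int m" by (rule Ints_cases)
    have "m \<in> {\<lfloor>- (N\<^sup>2)\<rfloor>..\<lceil>N\<^sup>2\<rceil>}"
      using n(2,3) unfolding m by (auto simp: floor_le_iff le_ceiling_iff)
    then show ?thesis unfolding A_def n(4) m by blast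
  qed
  then have "grid_points \<Omega> N \<subseteq> vec_lambda ` (UNIV \<rightarrow>\<^sub>E A)"
    by (intro subsetI image_eqI[where x = "vec_nth _"]) auto
  moreover have "finite (vec_lambda ` (UNIV \<rightarrow>\<^sub>E A) :: (real^'k) set)"
    by (intro finite_imageI finite_PiE) (auto simp: A_def)
  ultimately show ?thesis by (rule finite_subset)
qed

lemma cell_eq:
  assumes "N > 0" "y \<in> grid_points \<Omega> N"
  shows "{x. cell_corner N x = y} = {x. \<forall>i. y $ i \<le> x $ i \<and> x $ i < y $ i + 1 / N}"
proof -
  have "cell_corner N x = y \<longleftrightarrow> (\<forall>i. y $ i \<le> x $ i \<and> x $ i < y $ i + 1 / N)" for x
  proof -
    have "cell_corner N x $ i = y $ i \<longleftrightarrow> y $ i \<le> x $ i \<and> x $ i < y $ i + 1 / N" for i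
    proof -
      obtain n where n: "n \<in> \<int>" "y $ i = n * (1 / N)"
        using assms(2) unfolding grid_points_def by blast
      from n(1) obtain m where m: "n = of_int m" by (rule Ints_cases)
      have "cell_corner N x $ i = y $ i \<longleftrightarrow> \<lfloor>N * x $ i\<rfloor> = m"
        using assms(1) by (simp add: cell_corner_def n m)
      also have "\<dots> \<longleftrightarrow> of_int m \<le> N * x $ i \<and> N * x $ i < of_int m + 1"
        by (rule floor_eq_iff)
      also have "\<dots> \<longleftrightarrow> y $ i \<le> x $ i \<and> x $ i < y $ i + 1 / N"
        using assms(1) by (simp add: n m field_simps)
      finally show ?thesis .
    qed
    then show ?thesis by (simp add: vec_eq_iff)
  qed
  then show ?thesis by blast
qed

text \<open>An open and a closed box of equal volume squeeze the half-open cube.\<close>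

lemma half_open_cube:
  fixes y :: "real^'k::finite"
  assumes "e > 0"
  shows "{x. \<forall>i. y $ i \<le> x $ i \<and> x $ i < y $ i + e} \<in> sets borel" (is "?A \<in> _")
    and "emeasure lborel {x. \<forall>i. y $ i \<le> x $ i \<and> x $ i < y $ i + e} = ennreal (e ^ CARD('k))"
proof -
  have "?A = (\<Inter>i. {x. y $ i \<le> x $ i} \<inter> {x. x $ i < y $ i + e})" by auto
  also have "\<dots> \<in> sets borel"
    by (intro sets.countable_INT'' sets.Int borel_closed borel_open closed_halfspace_component_ge_cart
        open_halfspace_component_lt_cart) auto
  finally show A: "?A \<in> sets borel" .
  let ?z = "\<chi> i. y $ i + e"
  have bd: "(\<forall>b\<in>Basis. y \<bullet> b \<le> ?z \<bullet> b)" "(\<Prod>b\<in>Basis. (?z - y) \<bullet> b) = e ^ CARD('k)"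
    using assms by (auto simp: Basis_vec_def inner_axis inner_diff_left)
      (simp add: image_image axis_eq_axis inner_axis prod.reindex inj_on_def UNION_singleton_eq_range flip: card_image)
  have "emeasure lborel (box y ?z) \<le> emeasure lborel ?A"
    by (intro emeasure_mono) (use A in \<open>auto simp: mem_box_cart less_imp_le\<close>)
  moreover have "emeasure lborel ?A \<le> emeasure lborel (cbox y ?z)"
    by (intro emeasure_mono) (auto simp: mem_box_cart less_imp_le)
  ultimately show "emeasure lborel ?A = ennreal (e ^ CARD('k))"
    using bd by (simp add: emeasure_lborel_box emeasure_lborel_cbox)
qed

lemma step_fn_eq:
  "step_fn \<Omega> N w x = (\<Sum>y\<in>grid_points \<Omega> N. w y * indicator {x. cell_corner N x = y} x)"
proof -
  have "(\<Sum>y\<in>grid_points \<Omega> N. w y * indicator {x. cell_corner N x = y} x) =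
    (\<Sum>y\<in>grid_points \<Omega> N. if cell_corner N x = y then w y else 0)"
    by (rule sum.cong) (auto simp: indicator_def)
  also have "\<dots> = step_fn \<Omega> N w x"
    by (simp add: step_fn_def finite_grid_points)
  finally show ?thesis ..
qed

text \<open>There is no error term, because every cell is a full cube of volume
  \<open>(1 / N) ^ CARD('k)\<close>. Applied to absolute values, it turns the bound on the grid norm
  into an L1 bound.\<close>

lemma step_fn_integral:
  fixes \<Omega> :: "(real^'k::finite) set"
  assumes "N > 0"
  shows "has_bochner_integral lborel (step_fn \<Omega> N w) (grid_sum \<Omega> N w)"
proof -
  have "has_bochner_integral lborel (\<lambda>x. w y * indicator {x. cell_corner N x = y} x)
      (w y * (1 / N) ^ CARD('k))" if "y \<in> grid_points \<Omega> N" for y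
  proof (rule has_bochner_integral_mult_right)
    have "measure lborel {x. cell_corner N x = y} = (1 / N) ^ CARD('k)"
      using half_open_cube[of "1 / N" y] assms that by (simp add: cell_eq measure_def)
    moreover have "has_bochner_integral lborel (indicator {x. cell_corner N x = y})
      (measure lborel {x. cell_corner N x = y})"
      by (rule has_bochner_integral_real_indicator)
        (use half_open_cube[of "1 / N" y] assms that in \<open>auto simp: cell_eq simp del: power_divide\<close>)
    ultimately show "w y \<noteq> 0 \<Longrightarrow> has_bochner_integral lborel (indicator {x. cell_corner N x = y}) ((1 / N) ^ CARD('k))"
      by simp
  qed
  then have "has_bochner_integral lborel (\<lambda>x. \<Sum>y\<in>grid_points \<Omega> N. w y * indicator {x. cell_corner N x = y} x)
      (\<Sum>y\<in>grid_points \<Omega> N. w y * (1 / N) ^ CARD('k))"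
    by (rule has_bochner_integral_sum)
  then show ?thesis
    unfolding step_fn_eq[abs_def] grid_sum_def sum_distrib_left by (simp only: mult.commute)
qed

lemma step_fn_measurable: "N > 0 \<Longrightarrow> step_fn \<Omega> N w \<in> borel_measurable borel"
  using step_fn_integral[of N \<Omega> w] by (auto dest: borel_measurable_has_bochner_integral)

text \<open>Each coordinate moves by at most \<open>1 / N\<close>, and the Euclidean norm is at most
  the sum of the absolute coordinates.\<close>

lemma dist_cell_corner:
  fixes x :: "real^'k::finite"
  assumes "N > 0" shows "dist (cell_corner N x) x \<le> CARD('k) / N"
proof -
  have "dist (cell_corner N x) x \<le> (\<Sum>i\<in>UNIV. \<bar>(cell_corner N x - x) $ i\<bar>)"
    unfolding dist_norm by (rule norm_le_l1_cart)
  also have "\<dots> \<le> (\<Sum>i\<in>(UNIV::'k set). 1 / N)"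
  proof (rule sum_mono)
    fix i
    have "\<bar>of_int \<lfloor>N * x $ i\<rfloor> - N * x $ i\<bar> \<le> 1" by linarith
    then have "\<bar>of_int \<lfloor>N * x $ i\<rfloor> - N * x $ i\<bar> / N \<le> 1 / N"
      using assms by (simp add: divide_right_mono)
    also have "\<bar>of_int \<lfloor>N * x $ i\<rfloor> - N * x $ i\<bar> / N = \<bar>(of_int \<lfloor>N * x $ i\<rfloor> - N * x $ i) / N\<bar>"
      using assms by simp
    also have "(of_int \<lfloor>N * x $ i\<rfloor> - N * x $ i) / N = (cell_corner N x - x) $ i"
      using assms by (simp add: cell_corner_def diff_divide_distrib)
    finally show "\<bar>(cell_corner N x - x) $ i\<bar> \<le> 1 / N" .
  qed
  also have "\<dots> = CARD('k) / N" by simp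
  finally show ?thesis .
qed

section \<open>Continuous functions with compact support\<close>

lemma C0c_D:
  assumes "\<phi> \<in> C0c \<Omega>"
  shows "continuous_on UNIV \<phi>" "compact (support \<phi>)" "support \<phi> \<subseteq> \<Omega>"
    "\<phi> x \<noteq> 0 \<Longrightarrow> x \<in> support \<phi>" "\<phi> \<in> borel_measurable borel"
  using assms closure_subset[of "{x. \<phi> x \<noteq> 0}"]
  by (auto simp: C0c_def support_def intro: borel_measurable_continuous_onI)

lemma C0c_zero: "\<phi> \<in> C0c \<Omega> \<Longrightarrow> x \<notin> \<Omega> \<Longrightarrow> \<phi> x = 0"
  using C0c_D by blast

lemma C0c_support_ball:
  assumes "\<phi> \<in> C0c \<Omega>"
  obtains R where "R > 0" "\<And>x. norm x > R \<Longrightarrow> \<phi> x = 0"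
proof -
  have "bounded (support \<phi>)" using C0c_D[OF assms] by (simp add: compact_imp_bounded)
  then obtain R where "R > 0" "\<forall>x\<in>support \<phi>. norm x \<le> R" unfolding bounded_pos by blast
  then show ?thesis using C0c_D(4)[OF assms] that by (metis not_le)
qed

lemma C0c_bounded:
  assumes "\<phi> \<in> C0c \<Omega>"
  obtains B where "B > 0" "\<And>x. \<bar>\<phi> x\<bar> \<le> B"
proof -
  have "bounded (\<phi> ` support \<phi>)"
    using C0c_D[OF assms] by (intro compact_imp_bounded compact_continuous_image)
      (auto intro: continuous_on_subset)
  then obtain B where B: "B > 0" "\<forall>x\<in>support \<phi>. \<bar>\<phi> x\<bar> \<le> B" unfolding bounded_pos by auto
  then have "\<bar>\<phi> x\<bar> \<le> B" for x using C0c_D(4)[OF assms, of x] by (cases "\<phi> x = 0") auto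
  then show ?thesis using that B(1) by blast
qed

lemma C0c_uniformly_continuous:
  assumes "\<phi> \<in> C0c \<Omega>" "\<eta> > 0"
  obtains d where "d > 0" "\<And>x y. dist x y < d \<Longrightarrow> \<bar>\<phi> x - \<phi> y\<bar> < \<eta>"
proof -
  obtain R where R: "R > 0" "\<And>x. norm x > R \<Longrightarrow> \<phi> x = 0" using C0c_support_ball[OF assms(1)] by blast
  \<comment> \<open>The margin 1 handles points outside this ball: if two points are at distance
    below 1 and one is outside, both have norm above R, where \<open>\<phi>\<close>
    vanishes.\<close>
  have "uniformly_continuous_on (cball 0 (R + 1)) \<phi>"
    using C0c_D[OF assms(1)] by (intro compact_uniformly_continuous) (auto intro: continuous_on_subset)
  then obtain d where d: "d > 0"
    "\<And>x y. x \<in> cball 0 (R + 1) \<Longrightarrow> y \<in> cball 0 (R + 1) \<Longrightarrow> dist y x < d \<Longrightarrow> dist (\<phi> y) (\<phi> x) < \<eta>"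
    unfolding uniformly_continuous_on_def using assms(2) by metis
  show ?thesis
  proof (rule that[of "min d 1"])
    fix x y :: "real^'a" assume xy: "dist x y < min d 1"
    show "\<bar>\<phi> x - \<phi> y\<bar> < \<eta>"
    proof (cases "x \<in> cball 0 (R + 1) \<and> y \<in> cball 0 (R + 1)")
      case True then show ?thesis using d(2)[of y x] xy by (simp add: dist_real_def)
    next
      case False
      have "\<bar>norm x - norm y\<bar> < 1" using xy norm_triangle_ineq3[of x y] by (simp add: dist_norm)
      then have "norm x > R" "norm y > R" using False by auto
      then show ?thesis using R assms(2) by simp
    qed
  qed (use d in auto)
qed

lemma C0c_integrable: "\<phi> \<in> C0c \<Omega> \<Longrightarrow> integrable lborel \<phi>"
proof -
  assume \<phi>: "\<phi> \<in> C0c \<Omega>"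
  have "integrable lborel (\<lambda>x. indicator (support \<phi>) x *\<^sub>R \<phi> x)"
    using C0c_D(1,2)[OF \<phi>] by (intro borel_integrable_compact) (auto intro: continuous_on_subset)
  moreover have "(\<lambda>x. indicator (support \<phi>) x *\<^sub>R \<phi> x) = \<phi>"
    using C0c_D(4)[OF \<phi>] by (auto simp: indicator_def fun_eq_iff)
  ultimately show ?thesis by simp
qed

lemma integrable_indicator_cball: "integrable lborel (indicator (cball c r) :: _ \<Rightarrow> real)"
  by (rule integrable_real_indicator) (simp, rule emeasure_lborel_cball_finite)

lemma integrable_lborel_lebesgue_on:
  fixes f :: "'a::euclidean_space \<Rightarrow> real"
  assumes "open \<Omega>" "integrable lborel f"
  shows "integrable (lebesgue_on \<Omega>) f"
proof -
  have "integrable lebesgue f"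
    using assms(2) integrable_completion[of f lborel] by auto
  then have "integrable lebesgue (\<lambda>x. indicator \<Omega> x *\<^sub>R f x)"
    using assms(1) by (intro integrable_mult_indicator) (auto intro: borel_open)
  then show ?thesis using assms(1) by (subst integrable_restrict_space) (auto intro: borel_open)
qed

lemma integral_lebesgue_on_eq_lborel:
  fixes f :: "'a::euclidean_space \<Rightarrow> real"
  assumes "open \<Omega>" "f \<in> borel_measurable borel" "\<And>x. x \<notin> \<Omega> \<Longrightarrow> f x = 0"
  shows "integral\<^sup>L (lebesgue_on \<Omega>) f = integral\<^sup>L lborel f"
proof -
  have "integral\<^sup>L (lebesgue_on \<Omega>) f = (\<integral>x. indicator \<Omega> x *\<^sub>R f x \<partial>lebesgue)"
    using assms(1) by (subst integral_restrict_space) (auto intro: borel_open)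
  also have "(\<lambda>x. indicator \<Omega> x *\<^sub>R f x) = f" using assms(3) by (auto simp: indicator_def fun_eq_iff)
  also have "integral\<^sup>L lebesgue f = integral\<^sup>L lborel f"
    using assms(2) by (intro integral_completion) simp
  finally show ?thesis .
qed

section \<open>Comparison of grid sums with integrals of step functions\<close>

lemma step_fn_mult: "step_fn \<Omega> N (\<lambda>y. w y * v y) x = step_fn \<Omega> N w x * v (cell_corner N x)"
  by (simp add: step_fn_def)

lemma step_fn_abs: "\<bar>step_fn \<Omega> N w x\<bar> = step_fn \<Omega> N (\<lambda>y. \<bar>w y\<bar>) x"
  by (simp add: step_fn_def)

text \<open>\<open>\<psi>\<close> is only bounded and Borel, because the countable family that later
  replaces \<open>\<phi>\<close> consists of functions that may be discontinuous.\<close>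

lemma step_fn_mult_integrable:
  fixes \<psi> :: "real^'k::finite \<Rightarrow> real"
  assumes "N > 0" "\<psi> \<in> borel_measurable borel" "\<And>x. \<bar>\<psi> x\<bar> \<le> B"
  shows "integrable lborel (\<lambda>x. step_fn \<Omega> N w x * \<psi> x)"
    and "\<bar>\<integral>x. step_fn \<Omega> N w x * \<psi> x \<partial>lborel\<bar> \<le> B * grid_sum \<Omega> N (\<lambda>y. \<bar>w y\<bar>)"
proof -
  have i: "integrable lborel (\<lambda>x. B * step_fn \<Omega> N (\<lambda>y. \<bar>w y\<bar>) x)"
    "(\<integral>x. B * step_fn \<Omega> N (\<lambda>y. \<bar>w y\<bar>) x \<partial>lborel) = B * grid_sum \<Omega> N (\<lambda>y. \<bar>w y\<bar>)"
    using step_fn_integral[OF assms(1), of \<Omega>] by (auto simp: has_bochner_integral_iff)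
  have le: "norm (step_fn \<Omega> N w x * \<psi> x) \<le> B * step_fn \<Omega> N (\<lambda>y. \<bar>w y\<bar>) x" for x
    unfolding real_norm_def abs_mult step_fn_abs
    using mult_left_mono[OF assms(3)[of x], of "step_fn \<Omega> N (\<lambda>y. \<bar>w y\<bar>) x"]
    by (simp add: step_fn_def mult.commute)
  show int: "integrable lborel (\<lambda>x. step_fn \<Omega> N w x * \<psi> x)"
    by (rule Bochner_Integration.integrable_bound[OF i(1)])
      (use order_trans[OF le abs_ge_self] assms step_fn_measurable[OF assms(1), of \<Omega> w] in auto)
  have "\<bar>\<integral>x. step_fn \<Omega> N w x * \<psi> x \<partial>lborel\<bar> \<le> (\<integral>x. norm (step_fn \<Omega> N w x * \<psi> x) \<partial>lborel)"
    using integral_norm_bound[of lborel "\<lambda>x. step_fn \<Omega> N w x * \<psi> x"] by simp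
  also have "\<dots> \<le> (\<integral>x. B * step_fn \<Omega> N (\<lambda>y. \<bar>w y\<bar>) x \<partial>lborel)"
    by (intro integral_mono integrable_norm int i le)
  finally show "\<bar>\<integral>x. step_fn \<Omega> N w x * \<psi> x \<partial>lborel\<bar> \<le> B * grid_sum \<Omega> N (\<lambda>y. \<bar>w y\<bar>)"
    unfolding i(2) .
qed

lemma eventually_dist_cell_corner:
  assumes "filterlim N at_top F" "d > 0"
  shows "\<forall>\<^sub>F p in F. N p > 0 \<and> (\<forall>x::real^'k::finite. dist (cell_corner (N p) x) x < d)"
proof -
  have "\<forall>\<^sub>F p in F. N p > max 0 (CARD('k) / d)"
    using assms(1) unfolding filterlim_at_top_dense by blast
  then show ?thesis
  proof eventually_elim
    case (elim p)
    then have "N p > 0" by simp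
    moreover have "CARD('k) / N p < d"
      using elim assms(2) \<open>N p > 0\<close> by (simp add: field_simps)
    ultimately show ?case using dist_cell_corner[of "N p"] by (meson le_less_trans)
  qed
qed

text \<open>A neighbourhood of the compact support stays in \<Omega> and the cells shrink, so the
  relevant corners fall in \<Omega>. What remains is the bound \<open>N\<^sup>2\<close> on the
  numerators.\<close>

lemma eventually_corner_in_grid:
  assumes \<Omega>: "open \<Omega>" and \<phi>: "\<phi> \<in> C0c \<Omega>" and N: "filterlim N at_top F"
  shows "\<forall>\<^sub>F p in F. \<forall>x. \<phi> x \<noteq> 0 \<longrightarrow> cell_corner (N p) x \<in> grid_points \<Omega> (N p)"
proof -
  obtain e where e: "e > 0" "(\<Union>x\<in>support \<phi>. ball x e) \<subseteq> \<Omega>"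
    using compact_subset_open_imp_ball_epsilon_subset[OF C0c_D(2)[OF \<phi>] \<Omega> C0c_D(3)[OF \<phi>]] by blast
  obtain R where R: "R > 0" "\<And>x. norm x > R \<Longrightarrow> \<phi> x = 0" using C0c_support_ball[OF \<phi>] by blast
  \<comment> \<open>From N > R + 1 follows \<open>N * R + N \<le> N\<^sup>2\<close>; the summand N
    absorbs the rounding by the floor, which is at most 1.\<close>
  have "\<forall>\<^sub>F p in F. N p > R + 1" using N by (auto simp: filterlim_at_top_dense)
  with eventually_dist_cell_corner[OF N e(1), where 'k = 'a] show ?thesis
  proof eventually_elim
    case (elim p)
    show ?case
    proof (intro allI impI)
      fix x assume x: "\<phi> x \<noteq> 0"
      then have "cell_corner (N p) x \<in> ball x e" "x \<in> support \<phi>"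
        using elim C0c_D(4)[OF \<phi> x] by (auto simp: dist_commute)
      then have 1: "cell_corner (N p) x \<in> \<Omega>" using e(2) by blast
      have "\<exists>n\<in>\<int>. - ((N p)\<^sup>2) \<le> n \<and> n \<le> (N p)\<^sup>2 \<and> cell_corner (N p) x $ i = n * (1 / N p)" for i
      proof (intro bexI conjI)
        have "\<bar>x $ i\<bar> \<le> R" using R(2)[of x] x component_le_norm_cart[of x i] by (meson not_le order_trans)
        then have "\<bar>N p * x $ i\<bar> \<le> N p * R" using elim by (simp add: abs_mult)
        moreover have "N p * R + N p \<le> (N p)\<^sup>2" "1 \<le> N p"
          using elim R(1) mult_left_mono[of "R + 1" "N p" "N p"] by (auto simp: power2_eq_square algebra_simps)
        ultimately show "- ((N p)\<^sup>2) \<le> of_int \<lfloor>N p * x $ i\<rfloor>" "of_int \<lfloor>N p * x $ i\<rfloor> \<le> (N p)\<^sup>2"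
          by linarith+
      qed (auto simp: cell_corner_def)
      with 1 show "cell_corner (N p) x \<in> grid_points \<Omega> (N p)" by (simp add: grid_points_def)
    qed
  qed
qed

text \<open>The grid sum is the integral of a step function that differs from the product of
  \<open>step_fn \<Omega> N w\<close> and \<open>\<phi>\<close> only in evaluating
  \<open>\<phi>\<close> at the corner. The dominating \<open>G\<close> is left open since the two
  cases below control \<open>w\<close> in different norms.\<close>

lemma grid_sum_diff:
  fixes \<phi> :: "real^'k::finite \<Rightarrow> real"
  assumes "N > 0" "\<phi> \<in> C0c \<Omega>" "integrable lborel G"
    and le: "\<And>x. \<bar>step_fn \<Omega> N w x\<bar> * \<bar>\<phi> x - \<phi> (cell_corner N x)\<bar> \<le> G x"
  shows "\<bar>(\<integral>x. step_fn \<Omega> N w x * \<phi> x \<partial>lborel) - grid_sum \<Omega> N (\<lambda>y. w y * \<phi> y)\<bar> \<le> integral\<^sup>L lborel G"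
proof -
  obtain B where B: "\<And>x. \<bar>\<phi> x\<bar> \<le> B" using C0c_bounded[OF assms(2)] by blast
  have 1: "integrable lborel (\<lambda>x. step_fn \<Omega> N w x * \<phi> x)"
    by (rule step_fn_mult_integrable(1)[OF assms(1) C0c_D(5)[OF assms(2)] B])
  have 2: "integrable lborel (step_fn \<Omega> N (\<lambda>y. w y * \<phi> y))"
    "integral\<^sup>L lborel (step_fn \<Omega> N (\<lambda>y. w y * \<phi> y)) = grid_sum \<Omega> N (\<lambda>y. w y * \<phi> y)"
    using step_fn_integral[OF assms(1), of \<Omega>] by (auto simp: has_bochner_integral_iff)
  let ?d = "\<lambda>x. step_fn \<Omega> N w x * \<phi> x - step_fn \<Omega> N (\<lambda>y. w y * \<phi> y) x"
  have "\<bar>integral\<^sup>L lborel ?d\<bar> \<le> (\<integral>x. norm (?d x) \<partial>lborel)"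
    using integral_norm_bound[of lborel ?d] by simp
  also have "\<dots> \<le> integral\<^sup>L lborel G"
  proof (intro integral_mono integrable_norm Bochner_Integration.integrable_diff 1 2 assms(3))
    show "norm (?d x) \<le> G x" for x
      using le[of x] by (simp add: step_fn_mult abs_mult right_diff_distrib[symmetric])
  qed
  finally show ?thesis using 1 2 by simp
qed

lemma tendsto_zeroI_le:
  fixes h :: "'p \<Rightarrow> real"
  assumes "\<And>\<eta>. \<eta> > 0 \<Longrightarrow> \<forall>\<^sub>F p in F. \<bar>h p\<bar> \<le> \<eta> * C" and "C \<ge> 0"
  shows "(h \<longlongrightarrow> 0) F"
proof (rule tendstoI)
  fix e :: real assume "e > 0"
  then have "\<forall>\<^sub>F p in F. \<bar>h p\<bar> \<le> e / (C + 1) * C" using assms(2) by (intro assms(1)) (simp add: add_nonneg_pos)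
  moreover have "e / (C + 1) * C < e" using \<open>e > 0\<close> assms(2) by (simp add: field_simps)
  ultimately show "\<forall>\<^sub>F p in F. dist (h p) 0 < e"
    by (auto elim!: eventually_mono)
qed

text \<open>By uniform continuity \<open>\<phi>\<close> changes by at most \<eta> between a point
  and its corner, and the other factor integrates to the grid L1 norm, which is at most C.\<close>

lemma grid_sum_tendsto_L1:
  fixes \<phi> :: "real^'k::finite \<Rightarrow> real"
  assumes \<phi>: "\<phi> \<in> C0c \<Omega>" and N: "filterlim N at_top F"
    and C: "\<forall>\<^sub>F p in F. grid_sum \<Omega> (N p) (\<lambda>y. \<bar>w p y\<bar>) \<le> C" "C \<ge> 0"
  shows "((\<lambda>p. (\<integral>x. step_fn \<Omega> (N p) (w p) x * \<phi> x \<partial>lborel) - grid_sum \<Omega> (N p) (\<lambda>y. w p y * \<phi> y)) \<longlongrightarrow> 0) F"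
proof (rule tendsto_zeroI_le[OF _ C(2)])
  fix \<eta> :: real assume "\<eta> > 0"
  then obtain d where d: "d > 0" "\<And>x y. dist x y < d \<Longrightarrow> \<bar>\<phi> x - \<phi> y\<bar> < \<eta>"
    using C0c_uniformly_continuous[OF \<phi>] by blast
  show "\<forall>\<^sub>F p in F. \<bar>(\<integral>x. step_fn \<Omega> (N p) (w p) x * \<phi> x \<partial>lborel) - grid_sum \<Omega> (N p) (\<lambda>y. w p y * \<phi> y)\<bar> \<le> \<eta> * C"
    using C(1) eventually_dist_cell_corner[OF N d(1), where 'k = 'k]
  proof eventually_elim
    case (elim p)
    have "\<bar>(\<integral>x. step_fn \<Omega> (N p) (w p) x * \<phi> x \<partial>lborel) - grid_sum \<Omega> (N p) (\<lambda>y. w p y * \<phi> y)\<bar>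
      \<le> (\<integral>x. \<eta> * step_fn \<Omega> (N p) (\<lambda>y. \<bar>w p y\<bar>) x \<partial>lborel)"
    proof (rule grid_sum_diff[OF _ \<phi>])
      show "\<bar>step_fn \<Omega> (N p) (w p) x\<bar> * \<bar>\<phi> x - \<phi> (cell_corner (N p) x)\<bar>
        \<le> \<eta> * step_fn \<Omega> (N p) (\<lambda>y. \<bar>w p y\<bar>) x" for x
        unfolding step_fn_abs mult.commute[of \<eta>]
        by (rule mult_left_mono) (use d(2)[of x "cell_corner (N p) x"] elim in \<open>auto simp: step_fn_def dist_commute less_imp_le\<close>)
    qed (use elim step_fn_integral[of "N p" \<Omega>] in \<open>auto simp: has_bochner_integral_iff\<close>)
    also have "\<dots> = \<eta> * grid_sum \<Omega> (N p) (\<lambda>y. \<bar>w p y\<bar>)"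
      using elim step_fn_integral[of "N p" \<Omega>] by (auto simp: has_bochner_integral_iff)
    also have "\<dots> \<le> \<eta> * C" using elim \<open>\<eta> > 0\<close> by simp
    finally show ?case .
  qed
qed

text \<open>Composites with \<open>g\<close> are bounded but have no uniform L1 bound, since
  \<open>g 0\<close> may be nonzero and the grid may cover regions of growing volume. The error is
  instead bounded by B times \<eta> on one fixed ball.\<close>

lemma grid_sum_tendsto_bounded:
  fixes \<phi> :: "real^'k::finite \<Rightarrow> real"
  assumes \<phi>: "\<phi> \<in> C0c \<Omega>" and N: "filterlim N at_top F" and B: "\<And>p y. \<bar>w p y\<bar> \<le> B"
  shows "((\<lambda>p. (\<integral>x. step_fn \<Omega> (N p) (w p) x * \<phi> x \<partial>lborel) - grid_sum \<Omega> (N p) (\<lambda>y. w p y * \<phi> y)) \<longlongrightarrow> 0) F"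
proof -
  have "B \<ge> 0" using B[of undefined undefined] by linarith
  obtain R where R: "R > 0" "\<And>x. norm x > R \<Longrightarrow> \<phi> x = 0" using C0c_support_ball[OF \<phi>] by blast
  define V where "V = measure lborel (cball (0::real^'k) (R + 1))"
  have V: "integrable lborel (\<lambda>x. c * indicator (cball (0::real^'k) (R + 1)) x)"
    "(\<integral>x. c * indicator (cball (0::real^'k) (R + 1)) x \<partial>lborel) = c * V" for c :: real
    by (auto simp: V_def intro!: integrable_mult_right integrable_indicator_cball)
  show ?thesis
  proof (rule tendsto_zeroI_le)
    show "B * V \<ge> 0" using \<open>B \<ge> 0\<close> by (simp add: V_def)
    fix \<eta> :: real assume \<eta>: "\<eta> > 0"
    then obtain d where d: "d > 0" "\<And>x y. dist x y < d \<Longrightarrow> \<bar>\<phi> x - \<phi> y\<bar> < \<eta>"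
      using C0c_uniformly_continuous[OF \<phi>] by blast
    \<comment> \<open>Corners closer than 1 confine the error to the ball of radius R + 1: farther
      out \<open>\<phi>\<close> is 0 both at the point and at its corner.\<close>
    have "min d 1 > 0" using d(1) by simp
    show "\<forall>\<^sub>F p in F. \<bar>(\<integral>x. step_fn \<Omega> (N p) (w p) x * \<phi> x \<partial>lborel) - grid_sum \<Omega> (N p) (\<lambda>y. w p y * \<phi> y)\<bar> \<le> \<eta> * (B * V)"
      using eventually_dist_cell_corner[OF N \<open>min d 1 > 0\<close>, where 'k = 'k]
    proof eventually_elim
      case (elim p)
      have "\<bar>(\<integral>x. step_fn \<Omega> (N p) (w p) x * \<phi> x \<partial>lborel) - grid_sum \<Omega> (N p) (\<lambda>y. w p y * \<phi> y)\<bar>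
        \<le> (\<integral>x. (B * \<eta>) * indicator (cball (0::real^'k) (R + 1)) x \<partial>lborel)"
      proof (rule grid_sum_diff[OF _ \<phi> V(1)])
        fix x :: "real^'k"
        have dx: "dist (cell_corner (N p) x) x < d" "dist (cell_corner (N p) x) x < 1" using elim by auto
        show "\<bar>step_fn \<Omega> (N p) (w p) x\<bar> * \<bar>\<phi> x - \<phi> (cell_corner (N p) x)\<bar>
          \<le> (B * \<eta>) * indicator (cball (0::real^'k) (R + 1)) x"
        proof (cases "norm x \<le> R + 1")
          case True
          have "\<bar>step_fn \<Omega> (N p) (w p) x\<bar> \<le> B" using B \<open>B \<ge> 0\<close> by (simp add: step_fn_def)
          moreover have "\<bar>\<phi> x - \<phi> (cell_corner (N p) x)\<bar> \<le> \<eta>"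
            using d(2)[of x "cell_corner (N p) x"] dx(1) by (simp add: dist_commute)
          ultimately show ?thesis using True \<open>B \<ge> 0\<close> by (simp add: mult_mono)
        next
          case False
          then have "norm (cell_corner (N p) x) > R"
            using dx(2) norm_triangle_ineq3[of "cell_corner (N p) x" x] by (simp add: dist_norm)
          then show ?thesis using False R by simp
        qed
      qed (use elim in auto)
      also have "\<dots> = \<eta> * (B * V)" by (simp only: V(2)) simp
      finally show ?case .
    qed
  qed
qed

text \<open>The step function of the composite is exchanged for the composite with the step
  function. Off the grid cells the former is 0 and the latter is \<open>g 0\<close>, but eventually
  \<open>\<phi>\<close> vanishes there.\<close>

lemma grid_sum_tendsto_comp:
  fixes \<phi> :: "real^'k::finite \<Rightarrow> real"
  assumes \<Omega>: "open \<Omega>" and \<phi>: "\<phi> \<in> C0c \<Omega>" and N: "filterlim N at_top F" and g: "\<And>t. \<bar>g t\<bar> \<le> B"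
  shows "((\<lambda>p. (\<integral>x. g (step_fn \<Omega> (N p) (f p) x) * \<phi> x \<partial>lborel) -
    grid_sum \<Omega> (N p) (\<lambda>y. g (f p y) * \<phi> y)) \<longlongrightarrow> 0) F"
proof (rule Lim_transform_eventually)
  show "((\<lambda>p. (\<integral>x. step_fn \<Omega> (N p) (\<lambda>y. g (f p y)) x * \<phi> x \<partial>lborel) -
    grid_sum \<Omega> (N p) (\<lambda>y. g (f p y) * \<phi> y)) \<longlongrightarrow> 0) F"
    by (rule grid_sum_tendsto_bounded[OF \<phi> N]) (rule g)
  show "\<forall>\<^sub>F p in F. (\<integral>x. step_fn \<Omega> (N p) (\<lambda>y. g (f p y)) x * \<phi> x \<partial>lborel) -
      grid_sum \<Omega> (N p) (\<lambda>y. g (f p y) * \<phi> y) =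
    (\<integral>x. g (step_fn \<Omega> (N p) (f p) x) * \<phi> x \<partial>lborel) - grid_sum \<Omega> (N p) (\<lambda>y. g (f p y) * \<phi> y)"
    using eventually_corner_in_grid[OF \<Omega> \<phi> N]
  proof eventually_elim
    case (elim p)
    have "(\<lambda>x. step_fn \<Omega> (N p) (\<lambda>y. g (f p y)) x * \<phi> x) = (\<lambda>x. g (step_fn \<Omega> (N p) (f p) x) * \<phi> x)"
      using elim by (auto simp: step_fn_def fun_eq_iff)
    then show ?case by simp
  qed
qed

section \<open>Sequences realizing limits along an ultrafilter\<close>

text \<open>Compactness of the interval gives a cluster point of the image filter, and a cluster
  point of an ultrafilter is a limit: otherwise the values would eventually avoid one of its
  neighbourhoods.\<close>

lemma ultrafilter_limit:
  fixes h :: "'p \<Rightarrow> real"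
  assumes U: "U \<noteq> bot" "\<And>P. eventually P U \<or> eventually (\<lambda>p. \<not> P p) U"
    and B: "\<forall>\<^sub>F p in U. \<bar>h p\<bar> \<le> B"
  shows "\<exists>c. (h \<longlongrightarrow> c) U"
proof -
  have "filtermap h U \<noteq> bot" using U(1) by (simp add: filtermap_bot_iff)
  moreover have "\<forall>\<^sub>F t in filtermap h U. t \<in> {-B..B}"
    using B by (auto simp: eventually_filtermap abs_le_iff elim!: eventually_mono)
  ultimately obtain c where c: "inf (nhds c) (filtermap h U) \<noteq> bot"
    using compact_Icc[of "-B" B] unfolding compact_filter by blast
  have "(h \<longlongrightarrow> c) U"
  proof (rule topological_tendstoI)
    fix S assume S: "open S" "c \<in> S"
    show "\<forall>\<^sub>F p in U. h p \<in> S"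
    proof (rule ccontr)
      assume "\<not> (\<forall>\<^sub>F p in U. h p \<in> S)"
      then have "\<forall>\<^sub>F p in U. h p \<notin> S" using U(2) by blast
      then have "eventually (\<lambda>t. t \<notin> S) (filtermap h U)" by (simp add: eventually_filtermap)
      moreover have "eventually (\<lambda>t. t \<in> S) (nhds c)" using S by (rule eventually_nhds_in_open)
      ultimately have "eventually (\<lambda>_. False) (inf (nhds c) (filtermap h U))"
        unfolding eventually_inf by blast
      then show False using c by (simp add: eventually_False)
    qed
  qed
  then show ?thesis by blast
qed

text \<open>Diagonal choice: the point number n brings the first n + 1 functions of \<open>H\<close>
  within \<open>1 / (n + 1)\<close> of their limits along \<open>U\<close>. These are finitely many
  conditions, so they hold at some point of \<open>K\<close>. A function that \<open>H\<close>
  approximates uniformly on \<open>K\<close> inherits convergence, with the same limit along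
  \<open>U\<close> and along the sequence.\<close>

lemma ultrafilter_sequence:
  fixes H :: "('p \<Rightarrow> real) set"
  assumes U: "U \<noteq> bot" "\<And>P. eventually P U \<or> eventually (\<lambda>p. \<not> P p) U"
    and K: "\<forall>\<^sub>F p in U. p \<in> K" and H: "countable H" "\<And>h. h \<in> H \<Longrightarrow> \<exists>B. \<forall>p\<in>K. \<bar>h p\<bar> \<le> B"
  obtains p :: "nat \<Rightarrow> 'p" where "\<And>n. p n \<in> K"
    and "\<And>h. \<forall>\<eta>>0. \<exists>h'\<in>H. \<forall>p\<in>K. \<bar>h p - h' p\<bar> \<le> \<eta> \<Longrightarrow>
      \<exists>c. (h \<longlongrightarrow> c) U \<and> (\<lambda>n. h (p n)) \<longlonglongrightarrow> c"
proof (cases "H = {}")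
  case True
  have "\<exists>p. p \<in> K" using K U(1) eventually_happens' by blast
  then obtain p where "p \<in> K" by blast
  show ?thesis
  proof (rule that[of "\<lambda>_. p"])
    fix h :: "'p \<Rightarrow> real" assume "\<forall>\<eta>>0. \<exists>h'\<in>H. \<forall>p\<in>K. \<bar>h p - h' p\<bar> \<le> \<eta>"
    \<comment> \<open>Nothing is approximated by an empty family, so any constant sequence will
      do.\<close>
    from this[rule_format, of 1] show "\<exists>c. (h \<longlongrightarrow> c) U \<and> (\<lambda>n. h p) \<longlonglongrightarrow> c" using True by simp
  qed (rule \<open>p \<in> K\<close>)
next
  case False
  define q where "q = from_nat_into H"
  have q: "q n \<in> H" "\<exists>n. h = q n" if "h \<in> H" for n h
    using False that H(1) by (auto simp: q_def from_nat_into intro: exI[of _ "to_nat_on H h"])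
  have q': "q n \<in> H" for n unfolding q_def using False by (rule from_nat_into)
  have lim: "\<exists>c. (h \<longlongrightarrow> c) U" if h: "\<exists>B. \<forall>p\<in>K. \<bar>h p\<bar> \<le> B" for h :: "'p \<Rightarrow> real"
  proof -
    obtain B where "\<forall>p\<in>K. \<bar>h p\<bar> \<le> B" using h by blast
    then have "\<forall>\<^sub>F p in U. \<bar>h p\<bar> \<le> B" using K by (auto elim: eventually_mono)
    then show ?thesis by (rule ultrafilter_limit[OF U])
  qed
  have "\<forall>n. \<exists>c. (q n \<longlongrightarrow> c) U" using lim H(2) q' by blast
  then obtain c where c: "\<And>n. (q n \<longlongrightarrow> c n) U" by metis
  have "\<exists>p. p \<in> K \<and> (\<forall>i\<in>{..n}. dist (q i p) (c i) < 1 / Suc n)" for n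
  proof -
    have "\<forall>\<^sub>F p in U. \<forall>i\<in>{..n}. dist (q i p) (c i) < 1 / Suc n"
      by (intro eventually_ball_finite ballI tendstoD[OF c]) auto
    with K have "\<forall>\<^sub>F p in U. p \<in> K \<and> (\<forall>i\<in>{..n}. dist (q i p) (c i) < 1 / Suc n)"
      by (rule eventually_conj)
    then show ?thesis using U(1) eventually_happens' by blast
  qed
  then obtain p where p: "\<And>n. p n \<in> K" "\<And>n i. i \<le> n \<Longrightarrow> dist (q i (p n)) (c i) < 1 / Suc n"
    by (metis atMost_iff)
  have seq: "(\<lambda>n. q i (p n)) \<longlonglongrightarrow> c i" for i
  proof (rule tendsto_dist_iff[THEN iffD2], rule tendsto_sandwich[OF _ _ tendsto_const])
    show "\<forall>\<^sub>F n in sequentially. dist (q i (p n)) (c i) \<le> 1 / Suc n"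
      using eventually_ge_at_top[of i] by eventually_elim (use p(2) in \<open>auto intro: less_imp_le\<close>)
    show "(\<lambda>n. 1 / Suc n) \<longlonglongrightarrow> (0::real)" by (rule LIMSEQ_Suc[OF lim_1_over_n])
    show "\<forall>\<^sub>F n in sequentially. 0 \<le> dist (q i (p n)) (c i)" by simp
  qed
  show ?thesis
  proof (rule that[OF p(1)])
    fix h :: "'p \<Rightarrow> real" assume "\<forall>\<eta>>0. \<exists>h'\<in>H. \<forall>p\<in>K. \<bar>h p - h' p\<bar> \<le> \<eta>"
    then have h: "\<exists>h'\<in>H. \<forall>p\<in>K. \<bar>h p - h' p\<bar> \<le> \<eta>" if "\<eta> > 0" for \<eta> using that by blast
    have "\<exists>B. \<forall>p\<in>K. \<bar>h p\<bar> \<le> B"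
    proof -
      obtain h' where h': "h' \<in> H" "\<forall>p\<in>K. \<bar>h p - h' p\<bar> \<le> 1" using h[of 1] by auto
      then obtain B where "\<forall>p\<in>K. \<bar>h' p\<bar> \<le> B" using H(2) by blast
      then have "\<forall>p\<in>K. \<bar>h p\<bar> \<le> B + 1" using h'(2) by fastforce
      then show ?thesis by blast
    qed
    then obtain d where d: "(h \<longlongrightarrow> d) U" using lim by blast
    have "(\<lambda>n. h (p n)) \<longlonglongrightarrow> d"
    proof (rule tendstoI)
      fix e :: real assume "e > 0"
      then obtain h' where "h' \<in> H" and h': "\<And>p. p \<in> K \<Longrightarrow> \<bar>h p - h' p\<bar> \<le> e / 4"
        using h[of "e / 4"] by auto
      then obtain i where i: "h' = q i" using q(2) by blast
      have "((\<lambda>p. \<bar>h p - q i p\<bar>) \<longlongrightarrow> \<bar>d - c i\<bar>) U" by (intro tendsto_intros d c)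
      \<comment> \<open>The uniform bound on \<open>K\<close> passes to the limit along
        \<open>U\<close>. Three errors of at most \<open>e / 4\<close> then stay below e.\<close>
      then have dc: "\<bar>d - c i\<bar> \<le> e / 4"
        by (rule tendsto_upperbound) (use K h' i U in \<open>auto elim: eventually_mono\<close>)
      have "\<forall>\<^sub>F n in sequentially. dist (q i (p n)) (c i) < e / 4"
        using \<open>e > 0\<close> by (intro tendstoD[OF seq]) simp
      then show "\<forall>\<^sub>F n in sequentially. dist (h (p n)) d < e"
      proof eventually_elim
        case (elim n)
        then show ?case using h'[OF p(1)[of n]] dc \<open>e > 0\<close> unfolding i dist_real_def by linarith
      qed
    qed
    with d show "\<exists>c. (h \<longlongrightarrow> c) U \<and> (\<lambda>n. h (p n)) \<longlonglongrightarrow> c" by blast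
  qed
qed

section \<open>Countable uniform approximation\<close>

text \<open>A step function coded by a list of sets with values, where the earlier entry wins on
  overlaps, so a cover can be used as it is. Lists over a countable set are countable. The default 0
  suits functions that are small outside a compact set.\<close>

primrec first_value :: "('a set \<times> real) list \<Rightarrow> 'a \<Rightarrow> real" where
  "first_value [] x = 0"
| "first_value (a # l) x = (if x \<in> fst a then snd a else first_value l x)"

lemma first_value_cases:
  obtains a where "a \<in> set l" "x \<in> fst a" "first_value l x = snd a"
  | "\<And>a. a \<in> set l \<Longrightarrow> x \<notin> fst a" "first_value l x = 0"
proof (induction l arbitrary: thesis)
  case (Cons b l)
  show ?case
  proof (cases "x \<in> fst b")
    case True then show ?thesis using Cons.prems(1)[of b] by simp
  next
    case False
    show ?thesis
    proof (rule Cons.IH)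
      fix a assume "a \<in> set l" "x \<in> fst a" "first_value l x = snd a"
      then show ?thesis using Cons.prems(1)[of a] False by simp
    next
      assume "\<And>a. a \<in> set l \<Longrightarrow> x \<notin> fst a" "first_value l x = 0"
      then show ?thesis using Cons.prems(2) False by auto
    qed
  qed
qed auto

lemma first_value_bounded: "\<exists>B\<ge>0. \<forall>x. \<bar>first_value l x\<bar> \<le> B"
proof (induction l)
  case (Cons a l)
  then obtain B where "B \<ge> 0" "\<forall>x. \<bar>first_value l x\<bar> \<le> B" by blast
  then show ?case by (intro exI[of _ "max B \<bar>snd a\<bar>"]) (auto simp: le_max_iff_disj)
qed auto

lemma first_value_measurable:
  "(\<And>a. a \<in> set l \<Longrightarrow> open (fst a)) \<Longrightarrow> first_value l \<in> borel_measurable borel"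
proof (induction l)
  case Nil
  have "first_value [] = (\<lambda>_. 0)" by auto
  then show ?case by simp
next
  case (Cons a l)
  have "first_value (a # l) = (\<lambda>x. if x \<in> fst a then snd a else first_value l x)" by auto
  moreover have "first_value l \<in> borel_measurable borel" "fst a \<in> sets borel"
    using Cons by auto
  ultimately show ?case by (auto intro!: measurable_If_set)
qed

text \<open>Finitely many basic open sets, on each of which \<open>\<phi>\<close> is within \<delta>
  of a rational number, cover the compact set where \<open>\<phi>\<close> is at least \<delta> in
  absolute value. At a point outside all of them the approximant is 0 and \<open>\<phi>\<close> is
  below \<delta> in absolute value. Both \<open>C0b\<close> and \<open>C0c\<close> satisfy the
  compactness condition.\<close>

lemma countable_uniform_approx:
  obtains D :: "('a::second_countable_topology \<Rightarrow> real) set" where "countable D"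
    and "\<And>\<psi>. \<psi> \<in> D \<Longrightarrow> \<psi> \<in> borel_measurable borel" and "\<And>\<psi>. \<psi> \<in> D \<Longrightarrow> \<exists>B\<ge>0. \<forall>x. \<bar>\<psi> x\<bar> \<le> B"
    and "\<And>\<phi> \<delta>. continuous_on UNIV \<phi> \<Longrightarrow> compact {x. \<delta> \<le> \<bar>\<phi> x\<bar>} \<Longrightarrow> \<delta> > 0 \<Longrightarrow>
      \<exists>\<psi>\<in>D. \<forall>x. \<bar>\<phi> x - \<psi> x\<bar> \<le> \<delta>"
proof -
  obtain \<B> :: "'a set set" where \<B>: "countable \<B>" "topological_basis \<B>"
    using ex_countable_basis by blast
  define D where "D = first_value ` lists (\<B> \<times> \<rat>)"
  show ?thesis
  proof (rule that[of D])
    show "countable D" unfolding D_def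
      by (intro countable_image countable_lists countable_SIGMA \<B> countable_rat)
    show "\<psi> \<in> borel_measurable borel" if "\<psi> \<in> D" for \<psi>
      using that topological_basis_open[OF \<B>(2)] unfolding D_def
      by (auto intro!: first_value_measurable simp: lists_eq_set)
    show "\<exists>B\<ge>0. \<forall>x. \<bar>\<psi> x\<bar> \<le> B" if "\<psi> \<in> D" for \<psi>
      using that first_value_bounded unfolding D_def by auto
    fix \<phi> :: "'a \<Rightarrow> real" and \<delta> :: real
    assume \<phi>: "continuous_on UNIV \<phi>" "compact {x. \<delta> \<le> \<bar>\<phi> x\<bar>}" "\<delta> > 0"
    have "\<exists>B\<in>\<B>. \<exists>q\<in>\<rat>. x \<in> B \<and> (\<forall>y\<in>B. \<bar>\<phi> y - q\<bar> \<le> \<delta>)" for x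
    proof -
      obtain q where q: "q \<in> \<rat>" "\<phi> x - \<delta> / 2 < q" "q < \<phi> x + \<delta> / 2"
        using Rats_dense_in_real[of "\<phi> x - \<delta> / 2" "\<phi> x + \<delta> / 2"] \<phi>(3) by auto
      have "open {y. \<bar>\<phi> y - q\<bar> < \<delta>}"
        using \<phi>(1) by (intro open_Collect_less continuous_intros) auto
      moreover have "x \<in> {y. \<bar>\<phi> y - q\<bar> < \<delta>}" using q \<phi>(3) by auto
      ultimately obtain B where "B \<in> \<B>" "x \<in> B" "B \<subseteq> {y. \<bar>\<phi> y - q\<bar> < \<delta>}"
        using topological_basisE[OF \<B>(2)] by metis
      then show ?thesis using q(1) by (auto intro!: bexI[of _ B] bexI[of _ q] less_imp_le)
    qed
    then obtain B q where Bq: "\<And>x. B x \<in> \<B>" "\<And>x. q x \<in> \<rat>" "\<And>x. x \<in> B x"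
      "\<And>x y. y \<in> B x \<Longrightarrow> \<bar>\<phi> y - q x\<bar> \<le> \<delta>" by metis
    obtain T where T: "finite T" "{x. \<delta> \<le> \<bar>\<phi> x\<bar>} \<subseteq> (\<Union>x\<in>T. B x)"
    proof (rule compactE_image[OF \<phi>(2), of UNIV B])
      show "open (B x)" for x using Bq(1) topological_basis_open[OF \<B>(2)] by blast
      show "{x. \<delta> \<le> \<bar>\<phi> x\<bar>} \<subseteq> (\<Union>x. B x)" using Bq(3) by blast
    qed
    obtain xs where xs: "set xs = T" using finite_list[OF T(1)] by blast
    define l where "l = map (\<lambda>x. (B x, q x)) xs"
    show "\<exists>\<psi>\<in>D. \<forall>x. \<bar>\<phi> x - \<psi> x\<bar> \<le> \<delta>"
    proof (intro bexI allI)
      show "first_value l \<in> D" unfolding D_def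
        by (rule imageI) (use Bq in \<open>auto simp: l_def lists_eq_set\<close>)
      fix x show "\<bar>\<phi> x - first_value l x\<bar> \<le> \<delta>"
      proof (cases l x rule: first_value_cases)
        case (1 a) then show ?thesis using Bq(4) by (auto simp: l_def)
      next
        case 2
        have "x \<notin> B x'" if "x' \<in> T" for x'
          using 2(1)[of "(B x', q x')"] that by (simp add: l_def xs)
        then have "x \<notin> (\<Union>x\<in>T. B x)" by blast
        then have "x \<notin> {x. \<delta> \<le> \<bar>\<phi> x\<bar>}" using T(2) by blast
        then show ?thesis using 2 by auto
      qed
    qed
  qed
qed

lemma C0b_D:
  assumes "g \<in> C0b"
  shows "continuous_on UNIV g" "g \<in> borel_measurable borel" "\<delta> > 0 \<Longrightarrow> compact {x. \<delta> \<le> \<bar>g x\<bar>}"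
    "\<exists>B\<ge>0. \<forall>x. \<bar>g x\<bar> \<le> B"
proof -
  show g: "continuous_on UNIV g" using assms by (simp add: C0b_def)
  then show "g \<in> borel_measurable borel" by (rule borel_measurable_continuous_onI)
  show "\<exists>B\<ge>0. \<forall>x. \<bar>g x\<bar> \<le> B" using assms by (auto simp: C0b_def bounded_pos intro: less_imp_le)
  assume "\<delta> > 0"
  moreover have "(g \<longlongrightarrow> 0) at_infinity" using assms by (simp add: C0b_def)
  ultimately obtain b where b: "\<forall>x. b \<le> norm x \<longrightarrow> dist (g x) 0 < \<delta>"
    unfolding tendsto_iff eventually_at_infinity by blast
  have "bounded {x. \<delta> \<le> \<bar>g x\<bar>}" unfolding bounded_iff
    using b by (intro exI[of _ b]) (auto simp: dist_real_def not_less[symmetric] intro: leI)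
  moreover have "closed {x. \<delta> \<le> \<bar>g x\<bar>}" using g by (intro closed_Collect_le continuous_intros)
  ultimately show "compact {x. \<delta> \<le> \<bar>g x\<bar>}" by (simp add: compact_eq_bounded_closed)
qed

lemma C0c_compact_level:
  assumes "\<phi> \<in> C0c \<Omega>" "\<delta> > 0" shows "compact {x. \<delta> \<le> \<bar>\<phi> x\<bar>}"
proof -
  have "closed {x. \<delta> \<le> \<bar>\<phi> x\<bar>}" using C0c_D[OF assms(1)] by (intro closed_Collect_le continuous_intros)
  moreover have "{x. \<delta> \<le> \<bar>\<phi> x\<bar>} = support \<phi> \<inter> {x. \<delta> \<le> \<bar>\<phi> x\<bar>}"
    using C0c_D(4)[OF assms(1)] assms(2) by auto
  ultimately show ?thesis using C0c_D(2)[OF assms(1)] by (metis compact_Int_closed)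
qed

lemma abs_integral_diff_le:
  fixes u v :: "'a \<Rightarrow> real"
  assumes "integrable M u" "integrable M v" "integrable M G" "\<And>x. \<bar>u x - v x\<bar> \<le> G x"
  shows "\<bar>integral\<^sup>L M u - integral\<^sup>L M v\<bar> \<le> integral\<^sup>L M G"
proof -
  have "\<bar>integral\<^sup>L M u - integral\<^sup>L M v\<bar> = \<bar>\<integral>x. u x - v x \<partial>M\<bar>" using assms by simp
  also have "\<dots> \<le> (\<integral>x. norm (u x - v x) \<partial>M)"
    using integral_norm_bound[of M "\<lambda>x. u x - v x"] by simp
  also have "\<dots> \<le> integral\<^sup>L M G" using assms by (intro integral_mono) auto
  finally show ?thesis .
qed

text \<open>Limits along \<open>U\<close> are stated for grid sums, limits along the sequence for
  integrals. The countable family therefore consists of integrals, and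
  \<open>grid_sum_tendsto_L1\<close> and \<open>grid_sum_tendsto_comp\<close> exchange the two along
  \<open>U\<close>, where the grid sizes tend to infinity.\<close>

lemma approximating_sequence:
  fixes U :: "(real \<times> (real^'k::finite \<Rightarrow> real)) filter"
  assumes U: "U \<noteq> bot" "\<And>P. eventually P U \<or> eventually (\<lambda>p. \<not> P p) U"
    and N: "filterlim fst at_top U" and \<Omega>: "open \<Omega>" and "C \<ge> 0"
    and C: "\<forall>\<^sub>F p in U. grid_sum \<Omega> (fst p) (\<lambda>y. \<bar>snd p y\<bar>) \<le> C"
  obtains p where "\<And>n. fst (p n) > 0" "\<And>n::nat. grid_sum \<Omega> (fst (p n)) (\<lambda>y. \<bar>snd (p n) y\<bar>) \<le> C"
    and "\<And>\<phi>. \<phi> \<in> C0c \<Omega> \<Longrightarrow> \<exists>c. ((\<lambda>p. grid_sum \<Omega> (fst p) (\<lambda>y. snd p y * \<phi> y)) \<longlongrightarrow> c) U \<and>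
      (\<lambda>n. \<integral>x. step_fn \<Omega> (fst (p n)) (snd (p n)) x * \<phi> x \<partial>lborel) \<longlonglongrightarrow> c"
    and "\<And>g \<phi>. g \<in> C0b \<Longrightarrow> \<phi> \<in> C0c \<Omega> \<Longrightarrow>
      \<exists>c. ((\<lambda>p. grid_sum \<Omega> (fst p) (\<lambda>y. g (snd p y) * \<phi> y)) \<longlongrightarrow> c) U \<and>
      (\<lambda>n. \<integral>x. g (step_fn \<Omega> (fst (p n)) (snd (p n)) x) * \<phi> x \<partial>lborel) \<longlonglongrightarrow> c"
proof -
  obtain D :: "(real^'k \<Rightarrow> real) set" where D: "countable D"
    "\<And>\<psi>. \<psi> \<in> D \<Longrightarrow> \<psi> \<in> borel_measurable borel" "\<And>\<psi>. \<psi> \<in> D \<Longrightarrow> \<exists>B\<ge>0. \<forall>x. \<bar>\<psi> x\<bar> \<le> B"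
    "\<And>\<phi> \<delta>. continuous_on UNIV \<phi> \<Longrightarrow> compact {x. \<delta> \<le> \<bar>\<phi> x\<bar>} \<Longrightarrow> \<delta> > 0 \<Longrightarrow>
      \<exists>\<psi>\<in>D. \<forall>x. \<bar>\<phi> x - \<psi> x\<bar> \<le> \<delta>"
    using countable_uniform_approx by metis
  obtain E :: "(real \<Rightarrow> real) set" where E: "countable E"
    "\<And>\<psi>. \<psi> \<in> E \<Longrightarrow> \<psi> \<in> borel_measurable borel" "\<And>\<psi>. \<psi> \<in> E \<Longrightarrow> \<exists>B\<ge>0. \<forall>x. \<bar>\<psi> x\<bar> \<le> B"
    "\<And>\<phi> \<delta>. continuous_on UNIV \<phi> \<Longrightarrow> compact {x. \<delta> \<le> \<bar>\<phi> x\<bar>} \<Longrightarrow> \<delta> > 0 \<Longrightarrow>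
      \<exists>\<psi>\<in>E. \<forall>x. \<bar>\<phi> x - \<psi> x\<bar> \<le> \<delta>"
    using countable_uniform_approx by metis
  define Z where "Z = (\<lambda>p::real \<times> (real^'k \<Rightarrow> real). step_fn \<Omega> (fst p) (snd p))"
  \<comment> \<open>On \<open>K\<close> all step functions share one L1 bound, so an error \<delta>
    in the test function costs at most \<open>\<delta> * C\<close> in the integral.\<close>
  define K where "K = {p. fst p > 0 \<and> grid_sum \<Omega> (fst p) (\<lambda>y. \<bar>snd p y\<bar>) \<le> C}"
  \<comment> \<open>Members of \<open>D\<close> need not have compact support. Cutting them off by
    balls of integer radius keeps the family countable and makes the integrals with
    \<open>e\<close>, which may be nonzero at 0, finite.\<close>
  define X where "X = (\<lambda>r::nat. indicator (cball (0::real^'k) (real r)) :: real^'k \<Rightarrow> real)"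
  have X: "X r \<in> borel_measurable borel" "integrable lborel (X r)" "X r x \<ge> 0" "X r x \<le> 1" for r x
    unfolding X_def by (auto intro: integrable_indicator_cball borel_measurable_indicator)
  have Xint: "integral\<^sup>L lborel (X r) \<ge> 0" for r using X by (intro integral_nonneg_AE) auto
  \<comment> \<open>\<open>H1\<close> approximates the integrals for the functional,
    \<open>H2\<close> those with \<open>g\<close> for the Young measure.\<close>
  define H1 where "H1 = (\<lambda>(\<psi>, r) p. \<integral>x. Z p x * (\<psi> x * X r x) \<partial>lborel) ` (D \<times> (UNIV :: nat set))"
  define H2 where "H2 = (\<lambda>(e, \<psi>, r) p. \<integral>x. e (Z p x) * (\<psi> x * X r x) \<partial>lborel) ` (E \<times> D \<times> (UNIV :: nat set))"
  have Zm: "Z p \<in> borel_measurable borel" if "p \<in> K" for p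
    using that step_fn_measurable unfolding Z_def K_def by auto
  have Zint: "integrable lborel (\<lambda>x. Z p x * \<psi> x)" "\<bar>\<integral>x. Z p x * \<psi> x \<partial>lborel\<bar> \<le> B * C"
    if "p \<in> K" "\<psi> \<in> borel_measurable borel" "\<And>x. \<bar>\<psi> x\<bar> \<le> B" for p \<psi> B
  proof -
    have "B \<ge> 0" using that(3)[of undefined] by linarith
    have p: "fst p > 0" "grid_sum \<Omega> (fst p) (\<lambda>y. \<bar>snd p y\<bar>) \<le> C" using that(1) by (auto simp: K_def)
    show "integrable lborel (\<lambda>x. Z p x * \<psi> x)"
      unfolding Z_def by (rule step_fn_mult_integrable(1)[OF p(1) that(2,3)])
    show "\<bar>\<integral>x. Z p x * \<psi> x \<partial>lborel\<bar> \<le> B * C"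
      unfolding Z_def using \<open>B \<ge> 0\<close>
      by (intro order_trans[OF step_fn_mult_integrable(2)[OF p(1) that(2,3)]] mult_left_mono p(2))
  qed
  have Eint: "integrable lborel (\<lambda>x. e (Z p x) * (\<psi> x * X r x))"
    "\<bar>\<integral>x. e (Z p x) * (\<psi> x * X r x) \<partial>lborel\<bar> \<le> Be * B * integral\<^sup>L lborel (X r)"
    if "p \<in> K" "e \<in> borel_measurable borel" "\<And>x. \<bar>e x\<bar> \<le> Be" "\<psi> \<in> borel_measurable borel" "\<And>x. \<bar>\<psi> x\<bar> \<le> B"
    for p e \<psi> Be B r
  proof -
    have Be: "Be \<ge> 0" using that(3)[of undefined] by linarith
    have m: "(\<lambda>x. e (Z p x) * (\<psi> x * X r x)) \<in> borel_measurable borel"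
      using measurable_compose[OF Zm[OF that(1)] that(2)] that(4) X(1) by measurable
    have le: "\<bar>e (Z p x) * (\<psi> x * X r x)\<bar> \<le> Be * B * X r x" for x
    proof -
      have "\<bar>e (Z p x)\<bar> * \<bar>\<psi> x\<bar> \<le> Be * B"
        by (rule mult_mono[OF that(3) that(5) Be]) simp
      from mult_right_mono[OF this X(3)[of r x]] show ?thesis
        using X(3)[of r x] by (simp add: abs_mult mult.assoc)
    qed
    show int: "integrable lborel (\<lambda>x. e (Z p x) * (\<psi> x * X r x))"
      by (rule Bochner_Integration.integrable_bound[OF integrable_mult_right[OF X(2)[of r], of "Be * B"]])
        (use m order_trans[OF le abs_ge_self] in auto)
    show "\<bar>\<integral>x. e (Z p x) * (\<psi> x * X r x) \<partial>lborel\<bar> \<le> Be * B * integral\<^sup>L lborel (X r)"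
      using abs_integral_diff_le[OF int integrable_zero integrable_mult_right[OF X(2)[of r], of "Be * B"]] le
      by simp
  qed
  have cnt: "countable (H1 \<union> H2)" unfolding H1_def H2_def
    by (intro countable_Un countable_image countable_SIGMA D(1) E(1) countableI_type)
  have bnd: "\<exists>B. \<forall>p\<in>K. \<bar>h p\<bar> \<le> B" if "h \<in> H1 \<union> H2" for h
    using that
  proof
    assume "h \<in> H1"
    then obtain \<psi> r where h: "\<psi> \<in> D" "h = (\<lambda>p. \<integral>x. Z p x * (\<psi> x * X r x) \<partial>lborel)"
      unfolding H1_def by auto
    obtain B where B: "B \<ge> 0" "\<And>x. \<bar>\<psi> x\<bar> \<le> B" using D(3)[OF h(1)] by blast
    have le: "\<bar>\<psi> x * X r x\<bar> \<le> B" for x using B by (auto simp: X_def indicator_def)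
    have m: "(\<lambda>x. \<psi> x * X r x) \<in> borel_measurable borel" using D(2)[OF h(1)] X(1) by measurable
    have "\<forall>p\<in>K. \<bar>h p\<bar> \<le> B * C" unfolding h(2) using Zint(2)[OF _ m le] by blast
    then show ?thesis by blast
  next
    assume "h \<in> H2"
    then obtain e \<psi> r where h: "e \<in> E" "\<psi> \<in> D" "h = (\<lambda>p. \<integral>x. e (Z p x) * (\<psi> x * X r x) \<partial>lborel)"
      unfolding H2_def by auto
    obtain B where B: "\<And>x. \<bar>\<psi> x\<bar> \<le> B" using D(3)[OF h(2)] by blast
    obtain Be where Be: "\<And>x. \<bar>e x\<bar> \<le> Be" using E(3)[OF h(1)] by blast
    have "\<forall>p\<in>K. \<bar>h p\<bar> \<le> Be * B * integral\<^sup>L lborel (X r)"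
      unfolding h(3) using Eint(2)[OF _ E(2)[OF h(1)] Be D(2)[OF h(2)] B] by blast
    then show ?thesis by blast
  qed
  have Kev: "\<forall>\<^sub>F p in U. p \<in> K"
  proof -
    have "\<forall>\<^sub>F p in U. fst p > 0" using N unfolding filterlim_at_top_dense by blast
    with C show ?thesis by eventually_elim (simp add: K_def)
  qed
  obtain p where p: "\<And>n::nat. p n \<in> K"
    and lim: "\<And>h. \<forall>\<eta>>0. \<exists>h'\<in>H1 \<union> H2. \<forall>p\<in>K. \<bar>h p - h' p\<bar> \<le> \<eta> \<Longrightarrow>
      \<exists>c. (h \<longlongrightarrow> c) U \<and> (\<lambda>n. h (p n)) \<longlonglongrightarrow> c"
    by (rule ultrafilter_sequence[OF U Kev cnt bnd]) blast+
  have cut: "\<exists>r. \<forall>x. \<phi> x * X r x = \<phi> x" if \<phi>: "\<phi> \<in> C0c \<Omega>" for \<phi>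
  proof -
    obtain R where R: "\<And>x. norm x > R \<Longrightarrow> \<phi> x = 0" using C0c_support_ball[OF \<phi>] by blast
    obtain r where "R \<le> real r" using real_arch_simple by blast
    then have "\<forall>x. \<phi> x * X r x = \<phi> x" using R by (auto simp: X_def indicator_def)
    then show ?thesis by blast
  qed
  show ?thesis
  proof (rule that[of p])
    show "fst (p n) > 0" "grid_sum \<Omega> (fst (p n)) (\<lambda>y. \<bar>snd (p n) y\<bar>) \<le> C" for n
      using p[of n] by (auto simp: K_def)
  next
    fix \<phi> assume \<phi>: "\<phi> \<in> C0c \<Omega>"
    obtain r where r: "\<And>x. \<phi> x * X r x = \<phi> x" using cut[OF \<phi>] by blast
    obtain B\<phi> where B\<phi>: "\<And>x. \<bar>\<phi> x\<bar> \<le> B\<phi>" using C0c_bounded[OF \<phi>] by blast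
    have "\<exists>h'\<in>H1 \<union> H2. \<forall>p\<in>K. \<bar>(\<integral>x. Z p x * \<phi> x \<partial>lborel) - h' p\<bar> \<le> \<eta>" if "\<eta> > 0" for \<eta>
    proof -
      \<comment> \<open>The denominator C + 1 gives \<open>\<delta> * C \<le> \<eta>\<close> also
        for C = 0.\<close>
      define \<delta> where "\<delta> = \<eta> / (C + 1)"
      have \<delta>: "\<delta> > 0" "\<delta> * C \<le> \<eta>" using \<open>\<eta> > 0\<close> \<open>C \<ge> 0\<close> by (auto simp: \<delta>_def field_simps)
      obtain \<psi> where \<psi>: "\<psi> \<in> D" "\<And>x. \<bar>\<phi> x - \<psi> x\<bar> \<le> \<delta>"
        using D(4)[OF C0c_D(1)[OF \<phi>] C0c_compact_level[OF \<phi> \<delta>(1)] \<delta>(1)] by blast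
      have le: "\<bar>\<phi> x - \<psi> x * X r x\<bar> \<le> \<delta>" for x
      proof -
        have "\<phi> x - \<psi> x * X r x = (\<phi> x - \<psi> x) * X r x" using r[of x] by (simp add: algebra_simps)
        then show ?thesis using mult_mono[OF \<psi>(2)[of x] X(4)[of r x]] X(3)[of r x] \<delta>(1) by (simp add: abs_mult)
      qed
      let ?h = "\<lambda>p. \<integral>x. Z p x * (\<psi> x * X r x) \<partial>lborel"
      have m: "(\<lambda>x. \<psi> x * X r x) \<in> borel_measurable borel" "\<phi> \<in> borel_measurable borel"
        using D(2)[OF \<psi>(1)] X(1) C0c_D[OF \<phi>] by auto
      have "\<bar>(\<integral>x. Z p x * \<phi> x \<partial>lborel) - ?h p\<bar> \<le> \<eta>" if "p \<in> K" for p
      proof -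
        have "\<bar>\<psi> x * X r x\<bar> \<le> B\<phi> + \<delta>" for x using le[of x] B\<phi>[of x] by linarith
        then have i: "integrable lborel (\<lambda>x. Z p x * (\<psi> x * X r x))" by (rule Zint(1)[OF that m(1)])
        have "\<bar>\<integral>x. Z p x * (\<phi> x - \<psi> x * X r x) \<partial>lborel\<bar> \<le> \<delta> * C"
          by (rule Zint(2)[OF that _ le]) (use m in measurable)
        then show ?thesis using Zint(1)[OF that m(2) B\<phi>] i \<delta>(2) by (simp add: right_diff_distrib)
      qed
      moreover have "?h \<in> H1" unfolding H1_def using \<psi>(1) by auto
      ultimately show ?thesis by (intro bexI[of _ ?h]) auto
    qed
    then obtain c where c: "((\<lambda>p. \<integral>x. Z p x * \<phi> x \<partial>lborel) \<longlongrightarrow> c) U"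
      "(\<lambda>n. \<integral>x. Z (p n) x * \<phi> x \<partial>lborel) \<longlonglongrightarrow> c"
      using lim[of "\<lambda>p. \<integral>x. Z p x * \<phi> x \<partial>lborel"] by blast
    have "((\<lambda>p. (\<integral>x. Z p x * \<phi> x \<partial>lborel) - grid_sum \<Omega> (fst p) (\<lambda>y. snd p y * \<phi> y)) \<longlongrightarrow> 0) U"
      unfolding Z_def by (rule grid_sum_tendsto_L1[OF \<phi> N C \<open>C \<ge> 0\<close>])
    from tendsto_diff[OF c(1) this] have "((\<lambda>p. grid_sum \<Omega> (fst p) (\<lambda>y. snd p y * \<phi> y)) \<longlongrightarrow> c) U" by simp
    with c(2) show "\<exists>c. ((\<lambda>p. grid_sum \<Omega> (fst p) (\<lambda>y. snd p y * \<phi> y)) \<longlongrightarrow> c) U \<and>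
      (\<lambda>n. \<integral>x. step_fn \<Omega> (fst (p n)) (snd (p n)) x * \<phi> x \<partial>lborel) \<longlonglongrightarrow> c"
      unfolding Z_def by blast
  next
    fix g \<phi> assume g: "g \<in> C0b" and \<phi>: "\<phi> \<in> C0c \<Omega>"
    obtain r where r: "\<And>x. \<phi> x * X r x = \<phi> x" using cut[OF \<phi>] by blast
    obtain B\<phi> where B\<phi>: "B\<phi> > 0" "\<And>x. \<bar>\<phi> x\<bar> \<le> B\<phi>" using C0c_bounded[OF \<phi>] by blast
    obtain Bg where Bg: "Bg \<ge> 0" "\<And>x. \<bar>g x\<bar> \<le> Bg" using C0b_D(4)[OF g] by blast
    define I where "I = integral\<^sup>L lborel (X r)"
    have "I \<ge> 0" unfolding I_def by (rule Xint)
    have "\<exists>h'\<in>H1 \<union> H2. \<forall>p\<in>K. \<bar>(\<integral>x. g (Z p x) * \<phi> x \<partial>lborel) - h' p\<bar> \<le> \<eta>" if "\<eta> > 0" for \<eta>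
    proof -
      \<comment> \<open>Replacing \<open>g\<close> and \<open>\<phi>\<close> changes the integrand
        by at most \<open>\<delta> * B\<phi> + (Bg + \<delta>) * \<delta>\<close> on a ball of
        volume I. The cap 1 on \<delta> turns \<open>Bg + \<delta>\<close> into
        \<open>Bg + 1\<close>, and the last summand 1 keeps the denominator positive.\<close>
      define \<delta> where "\<delta> = min 1 (\<eta> / ((B\<phi> + Bg + 1) * I + 1))"
      have pos: "(B\<phi> + Bg + 1) * I + 1 > 0" using B\<phi>(1) Bg(1) \<open>I \<ge> 0\<close> by (simp add: add_nonneg_pos)
      then have \<delta>: "\<delta> > 0" "\<delta> \<le> 1" using \<open>\<eta> > 0\<close> by (auto simp: \<delta>_def)
      have "\<delta> * ((B\<phi> + Bg + 1) * I + 1) \<le> \<eta> / ((B\<phi> + Bg + 1) * I + 1) * ((B\<phi> + Bg + 1) * I + 1)"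
        using pos by (intro mult_right_mono) (auto simp: \<delta>_def)
      also have "\<dots> = \<eta>" using pos by simp
      finally have \<delta>I: "\<delta> * (B\<phi> + Bg + 1) * I \<le> \<eta>" using \<delta>(1) by (simp add: algebra_simps)
      obtain \<psi> where \<psi>: "\<psi> \<in> D" "\<And>x. \<bar>\<phi> x - \<psi> x\<bar> \<le> \<delta>"
        using D(4)[OF C0c_D(1)[OF \<phi>] C0c_compact_level[OF \<phi> \<delta>(1)] \<delta>(1)] by blast
      obtain e where e: "e \<in> E" "\<And>x. \<bar>g x - e x\<bar> \<le> \<delta>"
        using E(4)[OF C0b_D(1)[OF g] C0b_D(3)[OF g \<delta>(1)] \<delta>(1)] by blast
      let ?h = "\<lambda>p. \<integral>x. e (Z p x) * (\<psi> x * X r x) \<partial>lborel"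
      have "\<bar>(\<integral>x. g (Z p x) * \<phi> x \<partial>lborel) - ?h p\<bar> \<le> \<eta>" if "p \<in> K" for p
      proof -
        have be: "\<bar>e x\<bar> \<le> Bg + \<delta>" for x using e(2)[of x] Bg(2)[of x] by linarith
        have b\<psi>: "\<bar>\<psi> x\<bar> \<le> B\<phi> + \<delta>" for x using \<psi>(2)[of x] B\<phi>(2)[of x] by linarith
        have "\<bar>(\<integral>x. g (Z p x) * (\<phi> x * X r x) \<partial>lborel) - ?h p\<bar> \<le> (\<integral>x. (\<delta> * (B\<phi> + Bg + 1)) * X r x \<partial>lborel)"
        proof (rule abs_integral_diff_le)
          show "integrable lborel (\<lambda>x. g (Z p x) * (\<phi> x * X r x))"
            by (rule Eint(1)[OF that C0b_D(2)[OF g] Bg(2) C0c_D(5)[OF \<phi>] B\<phi>(2)])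
          show "integrable lborel (\<lambda>x. e (Z p x) * (\<psi> x * X r x))"
            by (rule Eint(1)[OF that E(2)[OF e(1)] be D(2)[OF \<psi>(1)] b\<psi>])
          show "integrable lborel (\<lambda>x. (\<delta> * (B\<phi> + Bg + 1)) * X r x)" using X(2) by auto
          fix x
          have "g (Z p x) * \<phi> x - e (Z p x) * \<psi> x = (g (Z p x) - e (Z p x)) * \<phi> x + e (Z p x) * (\<phi> x - \<psi> x)"
            by (simp add: algebra_simps)
          also have "\<bar>\<dots>\<bar> \<le> \<delta> * B\<phi> + (Bg + 1) * \<delta>"
          proof (rule order_trans[OF abs_triangle_ineq add_mono])
            show "\<bar>(g (Z p x) - e (Z p x)) * \<phi> x\<bar> \<le> \<delta> * B\<phi>"
              unfolding abs_mult using e(2) B\<phi> \<delta> by (intro mult_mono) auto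
            have "\<bar>e (Z p x)\<bar> \<le> Bg + 1" using be[of "Z p x"] \<delta>(2) by linarith
            then show "\<bar>e (Z p x) * (\<phi> x - \<psi> x)\<bar> \<le> (Bg + 1) * \<delta>"
              unfolding abs_mult using \<psi>(2) Bg(1) by (intro mult_mono) auto
          qed
          finally have *: "\<bar>g (Z p x) * \<phi> x - e (Z p x) * \<psi> x\<bar> \<le> \<delta> * (B\<phi> + Bg + 1)" by (simp add: algebra_simps)
          have "g (Z p x) * (\<phi> x * X r x) - e (Z p x) * (\<psi> x * X r x) = (g (Z p x) * \<phi> x - e (Z p x) * \<psi> x) * X r x"
            by (simp add: algebra_simps)
          then show "\<bar>g (Z p x) * (\<phi> x * X r x) - e (Z p x) * (\<psi> x * X r x)\<bar> \<le> (\<delta> * (B\<phi> + Bg + 1)) * X r x"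
            using mult_right_mono[OF * X(3)[of r x]] X(3)[of r x] by (simp add: abs_mult)
        qed
        also have "\<dots> = \<delta> * (B\<phi> + Bg + 1) * I" by (simp add: I_def)
        also note \<delta>I
        finally show ?thesis by (simp add: r)
      qed
      moreover have "?h \<in> H2" unfolding H2_def using \<psi>(1) e(1) by (auto intro!: image_eqI[of _ _ "(e, \<psi>, r)"])
      ultimately show ?thesis by (intro bexI[of _ ?h]) auto
    qed
    then obtain c where c: "((\<lambda>p. \<integral>x. g (Z p x) * \<phi> x \<partial>lborel) \<longlongrightarrow> c) U"
      "(\<lambda>n. \<integral>x. g (Z (p n) x) * \<phi> x \<partial>lborel) \<longlonglongrightarrow> c"
      using lim[of "\<lambda>p. \<integral>x. g (Z p x) * \<phi> x \<partial>lborel"] by blast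
    have "((\<lambda>p. (\<integral>x. g (Z p x) * \<phi> x \<partial>lborel) - grid_sum \<Omega> (fst p) (\<lambda>y. g (snd p y) * \<phi> y)) \<longlongrightarrow> 0) U"
      unfolding Z_def by (rule grid_sum_tendsto_comp[OF \<Omega> \<phi> N Bg(2)])
    from tendsto_diff[OF c(1) this] have "((\<lambda>p. grid_sum \<Omega> (fst p) (\<lambda>y. g (snd p y) * \<phi> y)) \<longlongrightarrow> c) U" by simp
    with c(2) show "\<exists>c. ((\<lambda>p. grid_sum \<Omega> (fst p) (\<lambda>y. g (snd p y) * \<phi> y)) \<longlongrightarrow> c) U \<and>
      (\<lambda>n. \<integral>x. g (step_fn \<Omega> (fst (p n)) (snd (p n)) x) * \<phi> x \<partial>lborel) \<longlonglongrightarrow> c"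
      unfolding Z_def by blast
  qed
qed

section \<open>Signed measures and tightness\<close>

text \<open>The terms may be negative; \<open>ennreal\<close> sends those to 0, so the right side
  sums the positive parts.\<close>

lemma ennreal_sums_le_suminf:
  fixes f :: "nat \<Rightarrow> real"
  assumes "f sums s"
  shows "ennreal s \<le> (\<Sum>i. ennreal (f i))"
proof (rule LIMSEQ_le_const2)
  show "(\<lambda>n. ennreal (\<Sum>i<n. f i)) \<longlonglongrightarrow> ennreal s"
    using assms unfolding sums_def by (rule tendsto_ennrealI)
  have "ennreal (\<Sum>i<n. f i) \<le> (\<Sum>i<n. ennreal (f i))" for n
  proof -
    have "(\<Sum>i<n. f i) \<le> (\<Sum>i<n. max 0 (f i))" by (intro sum_mono) simp
    then have "ennreal (\<Sum>i<n. f i) \<le> ennreal (\<Sum>i<n. max 0 (f i))" by (rule ennreal_leI)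
    also have "\<dots> = (\<Sum>i<n. ennreal (max 0 (f i)))" by (subst sum_ennreal) auto
    also have "\<dots> = (\<Sum>i<n. ennreal (f i))"
      by (intro sum.cong) (auto simp: max_def ennreal_neg)
    finally show ?thesis .
  qed
  moreover have "(\<Sum>i<n. ennreal (f i)) \<le> (\<Sum>i. ennreal (f i))" for n
    by (rule sum_le_suminf) auto
  ultimately show "\<exists>N. \<forall>n\<ge>N. ennreal (\<Sum>i<n. f i) \<le> (\<Sum>i. ennreal (f i))"
    by (meson order_trans)
qed

definition upper_measure :: "(real set \<Rightarrow> real) \<Rightarrow> real measure" where
  "upper_measure \<mu> = measure_of UNIV (sets borel) (upper_variation \<mu>)"

lemma radon_measures_uminus: "\<mu> \<in> radon_measures \<Longrightarrow> (\<lambda>B. - \<mu> B) \<in> radon_measures"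
  by (auto simp: radon_measures_def total_variation_def add.commute intro!: sums_minus)

lemma radon_measure_Un:
  assumes \<mu>: "\<mu> \<in> radon_measures" and "A \<in> sets borel" "B \<in> sets borel" "A \<inter> B = {}"
  shows "\<mu> (A \<union> B) = \<mu> A + \<mu> B"
proof -
  have "range (binaryset A B) \<subseteq> sets borel \<and> disjoint_family (binaryset A B)"
    using assms(2-4) by (auto simp: range_binaryset_eq disjoint_family_on_def binaryset_def)
  then have "(\<lambda>n. \<mu> (binaryset A B n)) sums \<mu> (\<Union>n. binaryset A B n)"
    using \<mu> by (auto simp: radon_measures_def)
  moreover have "(\<lambda>n. \<mu> (binaryset A B n)) sums (\<mu> A + \<mu> B)"
    using \<mu> by (intro binaryset_sums) (simp add: radon_measures_def)
  ultimately show ?thesis by (metis UN_binaryset_eq sums_unique2)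
qed

lemma upper_variation_upper: "B \<in> sets borel \<Longrightarrow> B \<subseteq> A \<Longrightarrow> ennreal (\<mu> B) \<le> upper_variation \<mu> A"
  unfolding upper_variation_def by (intro SUP_upper) auto

lemma upper_variation_least:
  "(\<And>B. B \<in> sets borel \<Longrightarrow> B \<subseteq> A \<Longrightarrow> ennreal (\<mu> B) \<le> u) \<Longrightarrow> upper_variation \<mu> A \<le> u"
  unfolding upper_variation_def by (intro SUP_least) auto

lemma upper_variation_mono: "A \<subseteq> B \<Longrightarrow> upper_variation \<mu> A \<le> upper_variation \<mu> B"
  by (intro upper_variation_least upper_variation_upper) auto

lemma upper_variation_superadditive:
  assumes \<mu>: "\<mu> \<in> radon_measures" and "A \<inter> A' = {}"
  shows "upper_variation \<mu> A + upper_variation \<mu> A' \<le> upper_variation \<mu> (A \<union> A')"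
proof -
  have *: "ennreal (\<mu> B) + ennreal (\<mu> B') \<le> upper_variation \<mu> (A \<union> A')"
    if B: "B \<in> sets borel" "B \<subseteq> A" "B' \<in> sets borel" "B' \<subseteq> A'" for B B'
  proof -
    have "\<mu> {} = 0" using \<mu> by (simp add: radon_measures_def)
    \<comment> \<open>A set of negative measure is replaced by the empty set, which has the same
      value under \<open>ennreal\<close>; on nonnegative numbers \<open>ennreal\<close> is
      additive.\<close>
    then obtain C where C: "C \<in> sets borel" "C \<subseteq> A" "ennreal (\<mu> B) = ennreal (\<mu> C)" "\<mu> C \<ge> 0"
      using B by (cases "\<mu> B \<ge> 0") (auto simp: ennreal_neg intro: that[of B] that[of "{}"])
    obtain C' where C': "C' \<in> sets borel" "C' \<subseteq> A'" "ennreal (\<mu> B') = ennreal (\<mu> C')" "\<mu> C' \<ge> 0"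
      using B \<open>\<mu> {} = 0\<close> by (cases "\<mu> B' \<ge> 0") (auto simp: ennreal_neg intro: that[of B'] that[of "{}"])
    have "ennreal (\<mu> B) + ennreal (\<mu> B') = ennreal (\<mu> (C \<union> C'))"
      using C C' assms(2) by (subst radon_measure_Un[OF \<mu>]) auto
    also have "\<dots> \<le> upper_variation \<mu> (A \<union> A')"
      using C C' by (intro upper_variation_upper) auto
    finally show ?thesis .
  qed
  have ne: "{B \<in> sets borel. B \<subseteq> A} \<noteq> {}" "{B \<in> sets borel. B \<subseteq> A'} \<noteq> {}" for A A' :: "real set" by auto
  show ?thesis
    unfolding upper_variation_def[of \<mu> A] upper_variation_def[of \<mu> A']
      ennreal_SUP_add_left[OF ne(1), symmetric] ennreal_SUP_add_right[OF ne(1)]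
    by (intro SUP_least) (use * in auto)
qed

text \<open>Superadditivity on finite unions bounds the series by the variation of the union.
  Conversely, a Borel subset of the union is cut into its pieces in the sets \<open>A i\<close>, and
  its measure is at most the sum of their positive parts.\<close>

lemma upper_variation_countably_additive:
  assumes \<mu>: "\<mu> \<in> radon_measures"
  shows "countably_additive (sets borel) (upper_variation \<mu>)"
proof (rule countably_additiveI)
  fix A :: "nat \<Rightarrow> real set"
  assume A: "range A \<subseteq> sets borel" "disjoint_family A"
  show "(\<Sum>i. upper_variation \<mu> (A i)) = upper_variation \<mu> (\<Union>i. A i)"
  proof (rule antisym)
    have "(\<Sum>i<n. upper_variation \<mu> (A i)) \<le> upper_variation \<mu> (\<Union>i<n. A i)" for n
    proof (induction n)
      case (Suc n)
      have "(\<Sum>i<Suc n. upper_variation \<mu> (A i)) \<le> upper_variation \<mu> (\<Union>i<n. A i) + upper_variation \<mu> (A n)"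
        using Suc by (simp add: add_right_mono)
      also have "\<dots> \<le> upper_variation \<mu> ((\<Union>i<n. A i) \<union> A n)"
      proof (rule upper_variation_superadditive[OF \<mu>])
        have "A i \<inter> A n = {}" if "i < n" for i
          using disjoint_family_onD[OF A(2), of i n] that by simp
        then show "(\<Union>i<n. A i) \<inter> A n = {}" by blast
      qed
      also have "(\<Union>i<n. A i) \<union> A n = (\<Union>i<Suc n. A i)" by (auto simp: less_Suc_eq)
      finally show ?case .
    qed simp
    also have "upper_variation \<mu> (\<Union>i<n. A i) \<le> upper_variation \<mu> (\<Union>i. A i)" for n
      by (intro upper_variation_mono) auto
    finally have "(\<Sum>i<n. upper_variation \<mu> (A i)) \<le> upper_variation \<mu> (\<Union>i. A i)" for n .
    then show "(\<Sum>i. upper_variation \<mu> (A i)) \<le> upper_variation \<mu> (\<Union>i. A i)"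
      by (intro suminf_le_const) auto
    show "upper_variation \<mu> (\<Union>i. A i) \<le> (\<Sum>i. upper_variation \<mu> (A i))"
    proof (rule upper_variation_least)
      fix B :: "real set" assume B: "B \<in> sets borel" "B \<subseteq> (\<Union>i. A i)"
      have "range (\<lambda>i. B \<inter> A i) \<subseteq> sets borel \<and> disjoint_family (\<lambda>i. B \<inter> A i)"
        using A B(1) by (auto simp: disjoint_family_on_def)
      then have "(\<lambda>i. \<mu> (B \<inter> A i)) sums \<mu> (\<Union>i. B \<inter> A i)"
        using \<mu> unfolding radon_measures_def by blast
      moreover have "(\<Union>i. B \<inter> A i) = B" using B(2) by auto
      ultimately have "ennreal (\<mu> B) \<le> (\<Sum>i. ennreal (\<mu> (B \<inter> A i)))"
        using ennreal_sums_le_suminf by metis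
      also have "\<dots> \<le> (\<Sum>i. upper_variation \<mu> (A i))"
        using A(1) B(1) by (intro suminf_le upper_variation_upper) auto
      finally show "ennreal (\<mu> B) \<le> (\<Sum>i. upper_variation \<mu> (A i))" .
    qed
  qed
qed

lemma sets_upper_measure [simp, measurable_cong]: "sets (upper_measure \<mu>) = sets borel"
  unfolding upper_measure_def by (metis sets.sets_measure_of_eq space_borel)

lemma space_upper_measure [simp]: "space (upper_measure \<mu>) = UNIV"
  unfolding upper_measure_def by (simp add: space_measure_of_conv)

lemma emeasure_upper_measure:
  assumes "\<mu> \<in> radon_measures" "A \<in> sets borel"
  shows "emeasure (upper_measure \<mu>) A = upper_variation \<mu> A"
proof (rule emeasure_measure_of[OF upper_measure_def])
  have "upper_variation \<mu> {} \<le> 0"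
    using assms(1) by (intro upper_variation_least) (auto simp: radon_measures_def)
  then show "positive (sets (upper_measure \<mu>)) (upper_variation \<mu>)" by (simp add: positive_def)
  show "countably_additive (sets (upper_measure \<mu>)) (upper_variation \<mu>)"
    using upper_variation_countably_additive[OF assms(1)] by simp
qed (use assms in auto)

lemma finite_upper_measure: "\<mu> \<in> radon_measures \<Longrightarrow> finite_measure (upper_measure \<mu>)"
  by (rule finite_measureI)
    (auto simp: emeasure_upper_measure radon_measures_def total_variation_def top_unique)

text \<open>For Borel B inside A, \<open>\<mu> B = \<mu> A - \<mu> (A - B)\<close> is at most
  \<open>\<mu> A\<close> plus the upper variation of the negated measure on A. The supremum over B
  gives one inequality; the same argument for the negated measure gives the other.\<close>

lemma jordan_decomposition:
  assumes \<mu>: "\<mu> \<in> radon_measures" and A: "A \<in> sets borel"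
  shows "\<mu> A = measure (upper_measure \<mu>) A - measure (upper_measure (\<lambda>B. - \<mu> B)) A"
proof -
  have *: "measure (upper_measure \<mu>) A \<le> \<mu> A + measure (upper_measure (\<lambda>B. - \<mu> B)) A"
    if \<mu>: "\<mu> \<in> radon_measures" for \<mu>
  proof -
    interpret n: finite_measure "upper_measure (\<lambda>B. - \<mu> B)"
      by (rule finite_upper_measure[OF radon_measures_uminus[OF \<mu>]])
    interpret p: finite_measure "upper_measure \<mu>" by (rule finite_upper_measure[OF \<mu>])
    let ?n = "measure (upper_measure (\<lambda>B. - \<mu> B)) A"
    have n: "- \<mu> B \<le> ?n" if "B \<in> sets borel" "B \<subseteq> A" for B
    proof -
      have "ennreal (- \<mu> B) \<le> ennreal ?n"
        using upper_variation_upper[OF that, of "\<lambda>B. - \<mu> B"] emeasure_upper_measure[OF radon_measures_uminus[OF \<mu>] A]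
        by (simp add: n.emeasure_eq_measure)
      then show ?thesis by (simp add: ennreal_le_iff)
    qed
    have "upper_variation \<mu> A \<le> ennreal (\<mu> A + ?n)"
    proof (rule upper_variation_least)
      fix B :: "real set" assume B: "B \<in> sets borel" "B \<subseteq> A"
      have "\<mu> A = \<mu> B + \<mu> (A - B)"
        using radon_measure_Un[OF \<mu>, of B "A - B"] A B by (simp add: Un_absorb1)
      then show "ennreal (\<mu> B) \<le> ennreal (\<mu> A + ?n)"
        using n[of "A - B"] A B by (intro ennreal_leI) auto
    qed
    then have "ennreal (measure (upper_measure \<mu>) A) \<le> ennreal (\<mu> A + ?n)"
      using emeasure_upper_measure[OF \<mu> A] by (simp add: p.emeasure_eq_measure)
    then show ?thesis using n[OF A] by (simp add: ennreal_le_iff)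
  qed
  from *[OF \<mu>] *[OF radon_measures_uminus[OF \<mu>]] show ?thesis by simp
qed

section \<open>Comparing measures by continuous functions below open sets\<close>

text \<open>The points of large norm make \<open>bump\<close> vanish at infinity, so that it lies in
  \<open>C0b\<close>. They also keep this set nonempty when U is \<open>UNIV\<close>; the distance
  \<open>infdist\<close> to an empty set would be 0.\<close>

definition bump_zeros :: "'a::euclidean_space set \<Rightarrow> nat \<Rightarrow> 'a set" where
  "bump_zeros U m = - U \<union> {y. real m \<le> norm y}"

definition bump :: "'a::euclidean_space set \<Rightarrow> nat \<Rightarrow> 'a \<Rightarrow> real" where
  "bump U m x = min 1 (real m * infdist x (bump_zeros U m))"

lemma bump_zeros_ne: "bump_zeros U m \<noteq> {}"
proof -
  obtain y :: 'a where "norm y = real m" using vector_choose_size[of "real m"] by auto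
  then have "y \<in> bump_zeros U m" by (simp add: bump_zeros_def)
  then show ?thesis by blast
qed

lemma infdist_bump_zeros_ge:
  assumes "\<And>y. y \<in> bump_zeros U m \<Longrightarrow> d \<le> dist x y"
  shows "d \<le> infdist x (bump_zeros U m)"
  using bump_zeros_ne[of U m] assms by (auto simp: infdist_def intro!: cINF_greatest)

lemma eventually_infdist_bump_zeros:
  assumes "open U" "x \<in> U"
  obtains d where "d > 0" "\<forall>\<^sub>F m in sequentially. d \<le> infdist x (bump_zeros U m)"
proof -
  obtain d where d: "d > 0" "ball x d \<subseteq> U" using assms openE by blast
  have "\<forall>\<^sub>F m in sequentially. d \<le> infdist x (bump_zeros U m)"
    using eventually_ge_at_top[of "nat \<lceil>norm x + d\<rceil>"]
  proof eventually_elim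
    case (elim m)
    then have m: "norm x + d \<le> real m" by linarith
    show ?case
    proof (rule infdist_bump_zeros_ge)
      fix y assume y: "y \<in> bump_zeros U m"
      show "d \<le> dist x y"
      proof (cases "y \<in> U")
        case True
        then have "real m \<le> norm y" using y by (auto simp: bump_zeros_def)
        then show ?thesis using m norm_triangle_ineq2[of y x] by (simp add: dist_norm norm_minus_commute)
      next
        case False
        then have "y \<notin> ball x d" using d(2) by blast
        then show ?thesis by simp
      qed
    qed
  qed
  with d(1) show ?thesis using that by blast
qed

lemma bump_bounds: "0 \<le> bump U m x" "bump U m x \<le> 1" "\<bar>bump U m x\<bar> \<le> 1"
  by (auto simp: bump_def infdist_nonneg)

lemma bump_zero: "x \<in> bump_zeros U m \<Longrightarrow> bump U m x = 0"
  by (simp add: bump_def)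

lemma continuous_bump: "continuous_on UNIV (bump U m)"
  unfolding bump_def[abs_def] by (intro continuous_intros)

lemma bump_measurable [measurable]: "bump U m \<in> borel_measurable borel"
  using continuous_bump by (rule borel_measurable_continuous_onI)

lemma bump_tendsto:
  assumes "open U"
  shows "(\<lambda>m. bump U m x) \<longlonglongrightarrow> indicator U x"
proof (cases "x \<in> U")
  case True
  obtain d where d: "d > 0" "\<forall>\<^sub>F m in sequentially. d \<le> infdist x (bump_zeros U m)"
    using eventually_infdist_bump_zeros[OF assms True] by blast
  have "\<forall>\<^sub>F m in sequentially. bump U m x = 1"
    using d(2) eventually_ge_at_top[of "nat \<lceil>1 / d\<rceil>"]
  proof eventually_elim
    case (elim m)
    then have "1 / d \<le> real m" by linarith
    then have "1 \<le> real m * d" using d(1) by (simp add: field_simps)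
    also have "\<dots> \<le> real m * infdist x (bump_zeros U m)" using elim by (intro mult_left_mono) auto
    finally show ?case by (simp add: bump_def)
  qed
  then show ?thesis using True by (auto intro: tendsto_eventually)
next
  case False
  then have "bump U m x = 0" for m by (intro bump_zero) (simp add: bump_zeros_def)
  then show ?thesis using False by simp
qed

text \<open>A point of norm at most m has distance at least 1 from all points of norm at least m +
  1, and the slope \<open>Suc m\<close> is at least 1.\<close>

lemma bump_UNIV_eq_1:
  fixes x :: "'a::euclidean_space"
  assumes "norm x \<le> real m"
  shows "bump UNIV (Suc m) x = 1"
proof -
  have "1 \<le> infdist x (bump_zeros UNIV (Suc m))"
  proof (rule infdist_bump_zeros_ge)
    fix y :: 'a assume "y \<in> bump_zeros UNIV (Suc m)"
    then show "1 \<le> dist x y"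
      using assms norm_triangle_ineq2[of y x] by (simp add: bump_zeros_def dist_norm norm_minus_commute)
  qed
  also have "\<dots> \<le> real (Suc m) * infdist x (bump_zeros UNIV (Suc m))"
    using infdist_nonneg[of x] by (simp add: distrib_right)
  finally show ?thesis by (simp add: bump_def)
qed

lemma bump_C0b: "bump U m \<in> C0b"
proof -
  have "\<forall>\<^sub>F x in at_infinity. bump U m x = 0"
    unfolding eventually_at_infinity
    by (intro exI[of _ "real m"] allI impI bump_zero) (simp add: bump_zeros_def)
  then have "(bump U m \<longlongrightarrow> 0) at_infinity" by (rule tendsto_eventually)
  then show ?thesis
    using continuous_bump bump_bounds(3)[of U m] by (auto simp: C0b_def bounded_iff)
qed

lemma measure_bump_tendsto:
  assumes "finite_measure M" "sets M = sets borel" "open U"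
  shows "(\<lambda>m. integral\<^sup>L M (bump U m)) \<longlonglongrightarrow> measure M U"
proof -
  interpret finite_measure M by fact
  have [measurable_cong]: "sets M = sets borel" by fact
  have "(\<lambda>m. integral\<^sup>L M (bump U m)) \<longlonglongrightarrow> integral\<^sup>L M (indicator U)"
  proof (rule integral_dominated_convergence[where w = "\<lambda>_. 1"])
    show "indicator U \<in> borel_measurable M" using assms by (auto intro: borel_measurable_indicator)
    show "bump U m \<in> borel_measurable M" for m by measurable
    show "AE x in M. norm (bump U m x) \<le> 1" for m using bump_bounds(3)[of U m] by simp
  qed (use bump_tendsto[OF assms(3)] in auto)
  moreover have "space M = UNIV" using sets_eq_imp_space_eq[OF assms(2)] by simp
  ultimately show ?thesis using assms by simp
qed

text \<open>Every open set is an increasing union of members of this family, so continuity of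
  measures from below applies; basic sets by themselves may overlap.\<close>

definition finite_unions :: "'a set set \<Rightarrow> 'a set set" where
  "finite_unions \<B> = Union ` {F. finite F \<and> F \<subseteq> \<B>}"

lemma countable_finite_unions: "countable \<B> \<Longrightarrow> countable (finite_unions \<B>)"
  unfolding finite_unions_def by (intro countable_image countable_Collect_finite_subset)

text \<open>The inequality passes from bumps to finite unions of basic sets by dominated
  convergence, to open sets by increasing unions, and to Borel sets by outer regularity of
  \<open>N\<close>. The hypothesis concerns countably many bumps, so for measures depending on a
  parameter it can be checked outside a single null set.\<close>

lemma measure_le_if_bumps_le:
  fixes M N :: "'a::euclidean_space measure"
  assumes M: "finite_measure M" "sets M = sets borel" and N: "finite_measure N" "sets N = sets borel"
    and \<B>: "countable \<B>" "topological_basis \<B>"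
    and le: "\<And>U m. U \<in> finite_unions \<B> \<Longrightarrow> integral\<^sup>L M (bump U m) \<le> integral\<^sup>L N (bump U m)"
    and A: "A \<in> sets borel"
  shows "measure M A \<le> measure N A"
proof -
  interpret M: finite_measure M by fact
  interpret N: finite_measure N by fact
  have 1: "measure M U \<le> measure N U" if U: "U \<in> finite_unions \<B>" for U
  proof -
    have "open U" using U topological_basis_open[OF \<B>(2)] by (auto simp: finite_unions_def)
    then show ?thesis
      using LIMSEQ_le[OF measure_bump_tendsto[OF M] measure_bump_tendsto[OF N]] le[OF U] by blast
  qed
  have 2: "measure M U \<le> measure N U" if U: "open U" for U
  proof -
    obtain \<B>' where \<B>': "\<B>' \<subseteq> \<B>" "\<Union>\<B>' = U" using \<B>(2) U by (auto simp: topological_basis_def)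
    show ?thesis
    proof (cases "\<B>' = {}")
      case True then show ?thesis using \<B>'(2) by auto
    next
      case False
      define V where "V = (\<lambda>n. \<Union>(from_nat_into \<B>' ` {..n}))"
      have V: "V n \<in> finite_unions \<B>" for n
        unfolding V_def finite_unions_def using from_nat_into[OF False] \<B>'(1) by blast
      have "open (V n)" for n
        using V[of n] topological_basis_open[OF \<B>(2)]
        by (fastforce simp: finite_unions_def intro!: open_Union)
      then have s: "range V \<subseteq> sets borel" by auto
      have i: "incseq V" unfolding incseq_def V_def by (intro allI impI Union_mono image_mono) auto
      have "(\<Union>n. V n) = \<Union>(range (from_nat_into \<B>'))" by (auto simp: V_def)
      also have "\<dots> = U"
        using range_from_nat_into[OF False countable_subset[OF \<B>'(1) \<B>(1)]] \<B>'(2) by simp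
      finally have VU: "(\<Union>n. V n) = U" .
      have "(\<lambda>n. measure M (V n)) \<longlonglongrightarrow> measure M U" "(\<lambda>n. measure N (V n)) \<longlonglongrightarrow> measure N U"
        using M.finite_Lim_measure_incseq[of V] N.finite_Lim_measure_incseq[of V] s i
        unfolding M(2) N(2) VU by blast+
      then show ?thesis using 1[OF V] by (intro LIMSEQ_le) blast+
    qed
  qed
  have "emeasure N A = (INF U\<in>{U. A \<subseteq> U \<and> open U}. emeasure N U)"
    by (rule outer_regular[OF N(2) _ A]) (simp add: N.emeasure_finite)
  moreover have "emeasure M A \<le> emeasure N U" if "A \<subseteq> U" "open U" for U
  proof -
    have "emeasure M A \<le> emeasure M U" using that M(2) by (intro emeasure_mono) auto
    also have "\<dots> \<le> emeasure N U"
      using 2[OF that(2)] by (simp add: M.emeasure_eq_measure N.emeasure_eq_measure)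
    finally show ?thesis .
  qed
  ultimately have "emeasure M A \<le> emeasure N A" by (auto intro: INF_greatest)
  then show ?thesis by (simp add: M.emeasure_eq_measure N.emeasure_eq_measure)
qed

section \<open>Signs of functions from integrals against test functions\<close>

lemma C0c_I:
  assumes "continuous_on UNIV \<phi>" "closed S" "bounded S" "S \<subseteq> \<Omega>" "\<And>x. x \<notin> S \<Longrightarrow> \<phi> x = 0"
  shows "\<phi> \<in> C0c \<Omega>"
proof -
  have "support \<phi> \<subseteq> S" unfolding support_def by (rule closure_minimal) (use assms in auto)
  moreover have "compact (support \<phi>)"
    using bounded_subset[OF assms(3) \<open>support \<phi> \<subseteq> S\<close>] by (simp add: support_def compact_eq_bounded_closed)
  ultimately show ?thesis using assms by (auto simp: C0c_def)
qed

lemma C0c_mult: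
  assumes "\<phi> \<in> C0c \<Omega>" "continuous_on UNIV g"
  shows "(\<lambda>x. g x * \<phi> x) \<in> C0c \<Omega>"
proof (rule C0c_I)
  show "continuous_on UNIV (\<lambda>x. g x * \<phi> x)" using C0c_D[OF assms(1)] assms(2) by (intro continuous_intros)
  show "closed (support \<phi>)" "bounded (support \<phi>)" "support \<phi> \<subseteq> \<Omega>"
    using C0c_D[OF assms(1)] by (auto simp: compact_eq_bounded_closed)
qed (use C0c_D(4)[OF assms(1)] in auto)

text \<open>Subtracting \<open>1 / Suc m\<close> confines the support to a closed bounded set that
  keeps this distance from the complement of \<Omega>. A function that is merely 0 outside \<Omega>
  could have a support touching the boundary.\<close>

lemma C0c_exhaustion:
  fixes \<Omega> :: "(real^'k::finite) set"
  assumes "open \<Omega>"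
  obtains \<psi> where "\<And>m::nat. \<psi> m \<in> C0c \<Omega>" "\<And>m x. \<psi> m x \<ge> 0" "\<And>x. x \<in> \<Omega> \<Longrightarrow> \<exists>m. \<psi> m x > 0"
proof -
  define \<psi> where "\<psi> = (\<lambda>m x. max 0 (infdist x (bump_zeros \<Omega> m) - 1 / Suc m))"
  show ?thesis
  proof (rule that[of \<psi>])
    show "\<psi> m \<in> C0c \<Omega>" for m
    proof (rule C0c_I)
      let ?S = "{x. 1 / Suc m \<le> infdist x (bump_zeros \<Omega> m)}"
      show "continuous_on UNIV (\<psi> m)" unfolding \<psi>_def by (intro continuous_intros)
      show "closed ?S" by (intro closed_Collect_le continuous_intros)
      have S: "x \<in> \<Omega> \<and> norm x < real m" if "x \<in> ?S" for x
      proof -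
        have "0 < 1 / real (Suc m)" by simp
        also have "\<dots> \<le> infdist x (bump_zeros \<Omega> m)" using that by simp
        finally have "x \<notin> bump_zeros \<Omega> m" using infdist_zero by fastforce
        then show ?thesis unfolding bump_zeros_def by simp
      qed
      then show "?S \<subseteq> \<Omega>" by blast
      show "bounded ?S" unfolding bounded_iff using S less_imp_le by blast
    qed (auto simp: \<psi>_def)
    show "\<psi> m x \<ge> 0" for m x by (simp add: \<psi>_def)
    fix x assume "x \<in> \<Omega>"
    then obtain d where d: "d > 0" "\<forall>\<^sub>F m in sequentially. d \<le> infdist x (bump_zeros \<Omega> m)"
      using eventually_infdist_bump_zeros[OF assms] by blast
    have "(\<lambda>m. 1 / real (Suc m)) \<longlonglongrightarrow> 0" by (rule LIMSEQ_Suc[OF lim_1_over_n])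
    then have "\<forall>\<^sub>F m in sequentially. 1 / real (Suc m) < d"
      using d(1) by (rule order_tendstoD(2))
    with d(2) have "\<forall>\<^sub>F m in sequentially. \<psi> m x > 0"
      by eventually_elim (auto simp: \<psi>_def less_max_iff_disj)
    then show "\<exists>m. \<psi> m x > 0" by (auto simp: eventually_sequentially)
  qed
qed

text \<open>For a nonnegative test function \<open>\<psi>\<close>, compare the measures whose
  densities are the negative and the positive part of \<open>h * \<psi>\<close>. On bumps the first
  is at most the second, because a bump times \<open>\<psi>\<close> is again a test function. Hence
  the order holds on all Borel sets, and on the set where \<open>h * \<psi>\<close> is negative the
  second measure is 0, so the first is too.\<close>

lemma AE_nonneg_if_integral_nonneg:
  fixes h :: "real^'k::finite \<Rightarrow> real"
  assumes \<Omega>: "open \<Omega>" and h: "h \<in> borel_measurable (lebesgue_on \<Omega>)"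
    and int: "\<And>\<phi>. \<phi> \<in> C0c \<Omega> \<Longrightarrow> integrable (lebesgue_on \<Omega>) (\<lambda>x. h x * \<phi> x)"
    and nonneg: "\<And>\<phi>. \<phi> \<in> C0c \<Omega> \<Longrightarrow> (\<And>x. \<phi> x \<ge> 0) \<Longrightarrow> (\<integral>x. h x * \<phi> x \<partial>lebesgue_on \<Omega>) \<ge> 0"
  shows "AE x in lebesgue_on \<Omega>. h x \<ge> 0"
proof -
  have \<Omega>s: "\<Omega> \<inter> space lebesgue \<in> sets lebesgue" using \<Omega> by (auto intro: borel_open)
  \<comment> \<open>The comparison of measures works with Borel sets, so \<open>h\<close> is
    extended by 0 and replaced by a Borel function that agrees with it almost everywhere.\<close>
  have "(\<lambda>x. indicator \<Omega> x *\<^sub>R h x) \<in> borel_measurable lebesgue"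
    using h \<Omega>s by (simp add: borel_measurable_restrict_space_iff)
  then obtain H where H [measurable]: "H \<in> borel_measurable lborel"
    and AE_H: "AE x in lborel. indicator \<Omega> x *\<^sub>R h x = H x"
    using completion_ex_borel_measurable_real by blast
  have H\<phi>: "integrable lborel (\<lambda>x. H x * \<phi> x)"
    "(\<integral>x. H x * \<phi> x \<partial>lborel) = (\<integral>x. h x * \<phi> x \<partial>lebesgue_on \<Omega>)" if "\<phi> \<in> C0c \<Omega>" for \<phi>
  proof -
    have m: "(\<lambda>x. H x * \<phi> x) \<in> borel_measurable lborel"
      using C0c_D(5)[OF that] by measurable
    have i: "integrable lebesgue (\<lambda>x. indicator \<Omega> x *\<^sub>R (h x * \<phi> x))"
      using int[OF that] \<Omega>s by (simp add: integrable_restrict_space)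
    have ae: "AE x in lebesgue. indicator \<Omega> x *\<^sub>R (h x * \<phi> x) = H x * \<phi> x"
      using AE_completion[OF AE_H] by eventually_elim (auto simp: mult.assoc[symmetric])
    have "integrable lebesgue (\<lambda>x. H x * \<phi> x)"
      by (rule integrable_cong_AE_imp[OF i _ ae]) (use m in \<open>rule measurable_completion\<close>)
    then show "integrable lborel (\<lambda>x. H x * \<phi> x)" using m by (simp add: integrable_completion)
    have "(\<integral>x. h x * \<phi> x \<partial>lebesgue_on \<Omega>) = (\<integral>x. indicator \<Omega> x *\<^sub>R (h x * \<phi> x) \<partial>lebesgue)"
      using \<Omega>s by (rule integral_restrict_space)
    also have "\<dots> = (\<integral>x. H x * \<phi> x \<partial>lebesgue)"
      by (rule integral_cong_AE[OF borel_measurable_integrable[OF i] _ ae])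
        (use m in \<open>rule measurable_completion\<close>)
    also have "\<dots> = (\<integral>x. H x * \<phi> x \<partial>lborel)" using m by (rule integral_completion)
    finally show "(\<integral>x. H x * \<phi> x \<partial>lborel) = (\<integral>x. h x * \<phi> x \<partial>lebesgue_on \<Omega>)" ..
  qed
  obtain \<B> :: "(real^'k) set set" where \<B>: "countable \<B>" "topological_basis \<B>"
    using ex_countable_basis by blast
  have pos: "AE x in lborel. H x * \<psi> x \<ge> 0" if \<psi>: "\<psi> \<in> C0c \<Omega>" "\<And>x. \<psi> x \<ge> 0" for \<psi>
  proof -
    have [measurable]: "\<psi> \<in> borel_measurable borel" by (rule C0c_D(5)[OF \<psi>(1)])
    define M where "M = density lborel (\<lambda>x. ennreal (max 0 (- (H x * \<psi> x))))"
    define N where "N = density lborel (\<lambda>x. ennreal (max 0 (H x * \<psi> x)))"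
    have fin: "finite_measure M" "finite_measure N"
    proof -
      have 1: "integrable lborel (\<lambda>x. max 0 (- (H x * \<psi> x)))" "integrable lborel (\<lambda>x. max 0 (H x * \<psi> x))"
        using H\<phi>(1)[OF \<psi>(1)] by (auto intro!: integrable_max)
      show "finite_measure M" "finite_measure N"
        unfolding M_def N_def
        using 1 by (auto intro!: finite_measureI simp: emeasure_density nn_integral_eq_integral)
    qed
    have sets: "sets M = sets borel" "sets N = sets borel" by (auto simp: M_def N_def)
    have le: "integral\<^sup>L M (bump U m) \<le> integral\<^sup>L N (bump U m)" for U m
    proof -
      have 1: "integral\<^sup>L M (bump U m) = (\<integral>x. max 0 (- (H x * \<psi> x)) * bump U m x \<partial>lborel)"
        unfolding M_def by (subst integral_density) auto
      have 2: "integral\<^sup>L N (bump U m) = (\<integral>x. max 0 (H x * \<psi> x) * bump U m x \<partial>lborel)"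
        unfolding N_def by (subst integral_density) auto
      have "(\<integral>x. max 0 (H x * \<psi> x) * bump U m x \<partial>lborel) - (\<integral>x. max 0 (- (H x * \<psi> x)) * bump U m x \<partial>lborel)
        = (\<integral>x. max 0 (H x * \<psi> x) * bump U m x - max 0 (- (H x * \<psi> x)) * bump U m x \<partial>lborel)"
      proof (rule Bochner_Integration.integral_diff[symmetric])
        have b: "\<bar>c * bump U m x\<bar> \<le> \<bar>H x * \<psi> x\<bar>" if "\<bar>c\<bar> \<le> \<bar>H x * \<psi> x\<bar>" for x c
          using mult_mono[OF that bump_bounds(3)[of U m x]] by (simp add: abs_mult)
        show "integrable lborel (\<lambda>x. max 0 (H x * \<psi> x) * bump U m x)"
          by (rule Bochner_Integration.integrable_bound[OF H\<phi>(1)[OF \<psi>(1)]])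
            (measurable, intro AE_I2, unfold real_norm_def, intro b, auto)
        show "integrable lborel (\<lambda>x. max 0 (- (H x * \<psi> x)) * bump U m x)"
          by (rule Bochner_Integration.integrable_bound[OF H\<phi>(1)[OF \<psi>(1)]])
            (measurable, intro AE_I2, unfold real_norm_def, intro b, auto)
      qed
      also have "(\<lambda>x. max 0 (H x * \<psi> x) * bump U m x - max 0 (- (H x * \<psi> x)) * bump U m x) =
        (\<lambda>x. H x * (bump U m x * \<psi> x))"
        by (auto simp: fun_eq_iff max_def algebra_simps)
      also have "(\<integral>x. H x * (bump U m x * \<psi> x) \<partial>lborel) \<ge> 0"
        unfolding H\<phi>(2)[OF C0c_mult[OF \<psi>(1) continuous_bump]]
        by (intro nonneg C0c_mult \<psi>(1) continuous_bump mult_nonneg_nonneg \<psi>(2) bump_bounds(1))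
      finally show ?thesis unfolding 1 2 by simp
    qed
    define A where "A = {x. H x * \<psi> x < 0}"
    have A [measurable]: "A \<in> sets borel" unfolding A_def by measurable
    have "measure M A \<le> measure N A"
      by (rule measure_le_if_bumps_le[OF fin(1) sets(1) fin(2) sets(2) \<B> le A])
    also have "emeasure N A = 0"
    proof -
      have "emeasure N A = (\<integral>\<^sup>+x. ennreal (max 0 (H x * \<psi> x)) * indicator A x \<partial>lborel)"
        unfolding N_def by (rule emeasure_density) auto
      also have "\<dots> = (\<integral>\<^sup>+(x::real^'k). 0 \<partial>lborel)"
        by (rule nn_integral_cong) (auto simp: A_def indicator_def)
      finally show ?thesis by simp
    qed
    then have "measure N A = 0" by (simp add: measure_def)
    finally have "emeasure M A = 0"
      using measure_nonneg[of M A] finite_measure.emeasure_eq_measure[OF fin(1), of A] by simp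
    then have "(\<integral>\<^sup>+x. ennreal (max 0 (- (H x * \<psi> x))) * indicator A x \<partial>lborel) = 0"
      unfolding M_def by (subst (asm) emeasure_density) auto
    then have "AE x in lborel. ennreal (max 0 (- (H x * \<psi> x))) * indicator A x = 0"
      by (subst (asm) nn_integral_0_iff_AE) auto
    then show ?thesis
      by eventually_elim (auto simp: A_def indicator_def split: if_splits)
  qed
  \<comment> \<open>At each point of \<Omega> some \<open>\<psi> m\<close> is positive, which frees
    the sign of \<open>h\<close> from the test function; countably many null sets are
    combined.\<close>
  obtain \<psi> where \<psi>: "\<And>m::nat. \<psi> m \<in> C0c \<Omega>" "\<And>m x. \<psi> m x \<ge> 0" "\<And>x. x \<in> \<Omega> \<Longrightarrow> \<exists>m. \<psi> m x > 0"
    using C0c_exhaustion[OF \<Omega>] by blast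
  have "AE x in lborel. \<forall>m. H x * \<psi> m x \<ge> 0"
    unfolding AE_all_countable using pos \<psi> by blast
  with AE_H have "AE x in lborel. x \<in> \<Omega> \<longrightarrow> h x \<ge> 0"
  proof eventually_elim
    case (elim x)
    show ?case
    proof
      assume x: "x \<in> \<Omega>"
      then obtain m where "\<psi> m x > 0" using \<psi>(3) by blast
      moreover have "h x * \<psi> m x \<ge> 0" using elim x by auto
      ultimately show "h x \<ge> 0" by (simp add: zero_le_mult_iff)
    qed
  qed
  then show ?thesis using \<Omega>s by (simp add: AE_restrict_space_iff AE_completion)
qed

section \<open>Recognizing probability measures, and tightness\<close>

lemma signed_integral_eq:
  "signed_integral \<mu> g = integral\<^sup>L (upper_measure \<mu>) g - integral\<^sup>L (upper_measure (\<lambda>B. - \<mu> B)) g"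
  by (simp add: signed_integral_def upper_measure_def)

text \<open>The constant 1 is not in \<open>C0b\<close>; this recovers the total mass from integrals
  of members of \<open>C0b\<close>.\<close>

lemma signed_integral_bump_tendsto:
  assumes "\<mu> \<in> radon_measures"
  shows "(\<lambda>m. signed_integral \<mu> (bump UNIV m)) \<longlonglongrightarrow> \<mu> UNIV"
  unfolding signed_integral_eq jordan_decomposition[OF assms, of UNIV, simplified]
  by (intro tendsto_diff measure_bump_tendsto finite_upper_measure radon_measures_uminus assms) auto

text \<open>A nonnegative integral of a bump says that the negative part of \<mu> is at most the
  positive part there; the comparison of measures carries this to Borel sets, and the Jordan
  decomposition turns it into positivity.\<close>

lemma radon_prob_measuresI:
  assumes \<mu>: "\<mu> \<in> radon_measures" and "\<mu> UNIV = 1"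
    and \<B>: "countable \<B>" "topological_basis \<B>"
    and "\<And>U m. U \<in> finite_unions \<B> \<Longrightarrow> signed_integral \<mu> (bump U m) \<ge> 0"
  shows "\<mu> \<in> radon_prob_measures"
proof -
  have "\<mu> A \<ge> 0" if A: "A \<in> sets borel" for A
    using measure_le_if_bumps_le[OF finite_upper_measure[OF radon_measures_uminus[OF \<mu>]] sets_upper_measure
        finite_upper_measure[OF \<mu>] sets_upper_measure \<B> _ A] assms(5) jordan_decomposition[OF \<mu> A]
    by (simp add: signed_integral_eq)
  then show ?thesis using assms by (simp add: radon_prob_measures_def)
qed

text \<open>Tightness, that is, no loss of mass at infinity, comes from Markov's inequality in the form
  \<open>1 - bump UNIV m t \<le> \<bar>t\<bar> / (m - 1)\<close> and the bound on the \<open>L\<^sup>1\<close> norms.\<close>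

lemma young_measure_if_L1_bounded:
  fixes \<Omega> :: "(real^'k::finite) set"
  assumes \<Omega>: "open \<Omega>" and \<nu>: "parametrized_measure \<Omega> \<nu>"
    and Z: "\<And>n. integrable lborel (Z n)" "\<And>n::nat. (\<integral>x. \<bar>Z n x\<bar> \<partial>lborel) \<le> C"
    and b: "\<And>g \<phi>. g \<in> C0b \<Longrightarrow> \<phi> \<in> C0c \<Omega> \<Longrightarrow>
      has_bochner_integral (lebesgue_on \<Omega>) (\<lambda>x. signed_integral (\<nu> x) g * \<phi> x) (b g \<phi>)"
    and lim: "\<And>g \<phi>. g \<in> C0b \<Longrightarrow> \<phi> \<in> C0c \<Omega> \<Longrightarrow>
      (\<lambda>n. \<integral>x. g (Z n x) * \<phi> x \<partial>lborel) \<longlonglongrightarrow> b g \<phi>"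
  shows "young_measure \<Omega> \<nu>"
proof -
  define s where "s = (\<lambda>g x. signed_integral (\<nu> x) g)"
  have s_meas [measurable]: "s g \<in> borel_measurable (lebesgue_on \<Omega>)" if "g \<in> C0b" for g
    using \<nu> that by (simp add: parametrized_measure_def s_def)
  have s_int: "integrable (lebesgue_on \<Omega>) (\<lambda>x. s g x * \<phi> x)" "(\<integral>x. s g x * \<phi> x \<partial>lebesgue_on \<Omega>) = b g \<phi>"
    if "g \<in> C0b" "\<phi> \<in> C0c \<Omega>" for g \<phi>
    using b[OF that] by (auto simp: s_def has_bochner_integral_iff)
  have Z_meas [measurable]: "Z n \<in> borel_measurable borel" for n
    using borel_measurable_integrable[OF Z(1)[of n]] by simp
  have gZ: "integrable lborel (\<lambda>x. g (Z n x) * \<phi> x)" if "g \<in> C0b" "\<phi> \<in> C0c \<Omega>" for g n and \<phi> :: "real^'k \<Rightarrow> real"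
  proof -
    obtain B where B: "\<And>t. \<bar>g t\<bar> \<le> B" using C0b_D(4)[OF \<open>g \<in> C0b\<close>] by blast
    have B0: "0 \<le> B" using B[of 0] by linarith
    show ?thesis
    proof (rule Bochner_Integration.integrable_bound[OF integrable_mult_right[OF C0c_integrable[OF that(2)], of B]])
      show "(\<lambda>x. g (Z n x) * \<phi> x) \<in> borel_measurable lborel"
        using measurable_compose[OF Z_meas C0b_D(2)[OF that(1)]] C0c_D(5)[OF that(2)] by measurable
      show "AE x in lborel. norm (g (Z n x) * \<phi> x) \<le> norm (B * \<phi> x)"
        using B B0 by (intro AE_I2) (auto simp: abs_mult intro!: mult_right_mono)
    qed
  qed
  have \<phi>_int: "integrable (lebesgue_on \<Omega>) \<phi>" "(\<integral>x. \<phi> x \<partial>lebesgue_on \<Omega>) = (\<integral>x. \<phi> x \<partial>lborel)" if "\<phi> \<in> C0c \<Omega>" for \<phi>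
    using integrable_lborel_lebesgue_on[OF \<Omega> C0c_integrable[OF that]]
      integral_lebesgue_on_eq_lborel[OF \<Omega> C0c_D(5)[OF that] C0c_zero[OF that]] by auto
  have nonneg: "AE x in lebesgue_on \<Omega>. s g x \<ge> 0" if g: "g \<in> C0b" "\<And>t. g t \<ge> 0" for g
  proof (rule AE_nonneg_if_integral_nonneg[OF \<Omega> s_meas[OF g(1)] s_int(1)[OF g(1)]])
    fix \<phi> assume \<phi>: "\<phi> \<in> C0c \<Omega>" "\<And>x. \<phi> x \<ge> 0"
    show "(\<integral>x. s g x * \<phi> x \<partial>lebesgue_on \<Omega>) \<ge> 0"
      unfolding s_int(2)[OF g(1) \<phi>(1)]
      by (rule LIMSEQ_le_const[OF lim[OF g(1) \<phi>(1)]]) (use g(2) \<phi>(2) in auto)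
  qed
  \<comment> \<open>The shift of the index by 2 makes \<open>\<gamma> m\<close> equal to 1 up to
    \<open>Suc m\<close>, so the divisor in the tail estimate is positive.\<close>
  define \<gamma> where "\<gamma> = (\<lambda>m. bump UNIV (Suc (Suc m)) :: real \<Rightarrow> real)"
  have \<gamma>: "\<gamma> m \<in> C0b" "0 \<le> \<gamma> m t" "\<gamma> m t \<le> 1" for m t
    by (auto simp: \<gamma>_def bump_C0b bump_bounds)
  have \<gamma>_tail: "1 - \<gamma> m t \<le> \<bar>t\<bar> / real (Suc m)" for m t
  proof (cases "\<bar>t\<bar> \<le> real (Suc m)")
    case True
    then have "\<gamma> m t = 1" unfolding \<gamma>_def by (intro bump_UNIV_eq_1) simp
    then show ?thesis by simp
  next
    case False
    then have "1 \<le> \<bar>t\<bar> / real (Suc m)" by (simp add: field_simps)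
    then show ?thesis using \<gamma>(2)[of m t] by linarith
  qed
  \<comment> \<open>\<open>1 - \<gamma> m\<close> does not vanish at infinity, hence is not in
    \<open>C0b\<close>; its integrals are those of \<open>\<phi>\<close> minus those with
    \<open>\<gamma> m\<close>.\<close>
  have d_int: "integrable (lebesgue_on \<Omega>) (\<lambda>x. (1 - s (\<gamma> m) x) * \<phi> x)"
    "(\<integral>x. (1 - s (\<gamma> m) x) * \<phi> x \<partial>lebesgue_on \<Omega>) = (\<integral>x. \<phi> x \<partial>lborel) - b (\<gamma> m) \<phi>"
    if "\<phi> \<in> C0c \<Omega>" for m \<phi>
    using \<phi>_int[OF that] s_int[OF \<gamma>(1)[of m] that] by (auto simp: left_diff_distrib)
  have d_lim: "(\<lambda>n. \<integral>x. (1 - \<gamma> m (Z n x)) * \<phi> x \<partial>lborel) \<longlonglongrightarrow> (\<integral>x. (1 - s (\<gamma> m) x) * \<phi> x \<partial>lebesgue_on \<Omega>)"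
    if "\<phi> \<in> C0c \<Omega>" for m \<phi>
    unfolding d_int(2)[OF that] using C0c_integrable[OF that] gZ[OF \<gamma>(1) that]
    by (simp add: left_diff_distrib tendsto_diff[OF tendsto_const lim[OF \<gamma>(1) that]])
  have d_nonneg: "AE x in lebesgue_on \<Omega>. 1 - s (\<gamma> m) x \<ge> 0" for m
  proof (rule AE_nonneg_if_integral_nonneg[OF \<Omega> _ d_int(1)])
    show "(\<lambda>x. 1 - s (\<gamma> m) x) \<in> borel_measurable (lebesgue_on \<Omega>)" using s_meas[OF \<gamma>(1)] by measurable
    fix \<phi> assume \<phi>: "\<phi> \<in> C0c \<Omega>" "\<And>x. \<phi> x \<ge> 0"
    show "(\<integral>x. (1 - s (\<gamma> m) x) * \<phi> x \<partial>lebesgue_on \<Omega>) \<ge> 0"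
      by (rule LIMSEQ_le_const[OF d_lim[OF \<phi>(1)]]) (use \<gamma>(3) \<phi>(2) in auto)
  qed
  \<comment> \<open>The defect of mass of \<open>\<nu> x\<close>, that is, the mass lost at
    infinity. It turns out both nonnegative and nonpositive almost everywhere.\<close>
  define l where "l = (\<lambda>x. 1 - \<nu> x UNIV)"
  have s_lim: "(\<lambda>m. 1 - s (\<gamma> m) x) \<longlonglongrightarrow> l x" if "x \<in> \<Omega>" for x
  proof -
    have "\<nu> x \<in> radon_measures" using \<nu> that by (simp add: parametrized_measure_def)
    from LIMSEQ_Suc[OF LIMSEQ_Suc[OF signed_integral_bump_tendsto[OF this]]]
    show ?thesis unfolding l_def s_def \<gamma>_def by (intro tendsto_intros)
  qed
  have \<Omega>sp: "space (lebesgue_on \<Omega>) = \<Omega>" by simp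
  have l_meas: "l \<in> borel_measurable (lebesgue_on \<Omega>)"
  proof (rule borel_measurable_LIMSEQ_real)
    show "(\<lambda>x. 1 - s (\<gamma> m) x) \<in> borel_measurable (lebesgue_on \<Omega>)" for m using s_meas[OF \<gamma>(1)] by measurable
  qed (use s_lim \<Omega>sp in auto)
  have AE_d: "AE x in lebesgue_on \<Omega>. \<forall>m. 0 \<le> s (\<gamma> m) x \<and> 0 \<le> 1 - s (\<gamma> m) x"
    unfolding AE_all_countable using AE_conjI[OF nonneg[OF \<gamma>(1,2)] d_nonneg] by blast
  have l_int: "integrable (lebesgue_on \<Omega>) (\<lambda>x. l x * \<phi> x)"
    "(\<lambda>m. \<integral>x. (1 - s (\<gamma> m) x) * \<phi> x \<partial>lebesgue_on \<Omega>) \<longlonglongrightarrow> (\<integral>x. l x * \<phi> x \<partial>lebesgue_on \<Omega>)"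
    if \<phi>: "\<phi> \<in> C0c \<Omega>" for \<phi>
  proof -
    note m = borel_measurable_times[OF l_meas borel_measurable_integrable[OF \<phi>_int(1)[OF \<phi>]]]
      borel_measurable_integrable[OF d_int(1)[OF \<phi>]] integrable_norm[OF \<phi>_int(1)[OF \<phi>]]
    have lim: "AE x in lebesgue_on \<Omega>. (\<lambda>m. (1 - s (\<gamma> m) x) * \<phi> x) \<longlonglongrightarrow> l x * \<phi> x"
      by (rule AE_I2) (use s_lim in \<open>auto intro!: tendsto_mult_right\<close>)
    \<comment> \<open>The two signs collected in \<open>AE_d\<close> confine the factor to the unit
      interval, so \<open>\<phi>\<close> dominates.\<close>
    have bound: "AE x in lebesgue_on \<Omega>. norm ((1 - s (\<gamma> m) x) * \<phi> x) \<le> norm (\<phi> x)" for m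
      using AE_d
    proof eventually_elim
      case (elim x)
      then have "\<bar>1 - s (\<gamma> m) x\<bar> \<le> 1" by (simp add: abs_le_iff)
      from mult_right_mono[OF this, of "\<bar>\<phi> x\<bar>"] show ?case by (simp add: abs_mult)
    qed
    show "integrable (lebesgue_on \<Omega>) (\<lambda>x. l x * \<phi> x)"
      by (rule integrable_dominated_convergence[OF m lim bound])
    show "(\<lambda>m. \<integral>x. (1 - s (\<gamma> m) x) * \<phi> x \<partial>lebesgue_on \<Omega>) \<longlonglongrightarrow> (\<integral>x. l x * \<phi> x \<partial>lebesgue_on \<Omega>)"
      by (rule integral_dominated_convergence[OF m lim bound])
  qed
  have "AE x in lebesgue_on \<Omega>. - l x \<ge> 0"
  proof (rule AE_nonneg_if_integral_nonneg[OF \<Omega>])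
    show "(\<lambda>x. - l x) \<in> borel_measurable (lebesgue_on \<Omega>)" using l_meas by measurable
    show "integrable (lebesgue_on \<Omega>) (\<lambda>x. - l x * \<phi> x)" if "\<phi> \<in> C0c \<Omega>" for \<phi>
      using l_int(1)[OF that] by simp
    fix \<phi> assume \<phi>: "\<phi> \<in> C0c \<Omega>" "\<And>x. \<phi> x \<ge> 0"
    obtain B where B: "B > 0" "\<And>x. \<bar>\<phi> x\<bar> \<le> B" using C0c_bounded[OF \<phi>(1)] by blast
    \<comment> \<open>The bound is independent of n. Letting first n and then m tend to infinity
      leaves no lost mass.\<close>
    have "(\<integral>x. (1 - \<gamma> m (Z n x)) * \<phi> x \<partial>lborel) \<le> B * C / real (Suc m)" for m n
    proof -
      have "(\<integral>x. (1 - \<gamma> m (Z n x)) * \<phi> x \<partial>lborel) \<le> (\<integral>x. \<bar>Z n x\<bar> * (B / real (Suc m)) \<partial>lborel)"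
      proof (rule integral_mono)
        show "integrable lborel (\<lambda>x. (1 - \<gamma> m (Z n x)) * \<phi> x)"
          using C0c_integrable[OF \<phi>(1)] gZ[OF \<gamma>(1) \<phi>(1)] by (simp add: left_diff_distrib)
        show "integrable lborel (\<lambda>x. \<bar>Z n x\<bar> * (B / real (Suc m)))"
          using Z(1) by (intro integrable_mult_left) auto
        fix x
        have "(1 - \<gamma> m (Z n x)) * \<phi> x \<le> \<bar>Z n x\<bar> / real (Suc m) * B"
          using \<gamma>_tail[of m "Z n x"] B(2)[of x] \<phi>(2)[of x] by (intro mult_mono) auto
        then show "(1 - \<gamma> m (Z n x)) * \<phi> x \<le> \<bar>Z n x\<bar> * (B / real (Suc m))" by simp
      qed
      also have "\<dots> = (\<integral>x. \<bar>Z n x\<bar> \<partial>lborel) * (B / real (Suc m))" by simp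
      also have "\<dots> \<le> C * (B / real (Suc m))"
        using Z(2) B(1) by (intro mult_right_mono) auto
      finally show ?thesis by (simp add: mult.commute)
    qed
    then have "(\<integral>x. (1 - s (\<gamma> m) x) * \<phi> x \<partial>lebesgue_on \<Omega>) \<le> B * C / real (Suc m)" for m
      by (intro LIMSEQ_le_const2[OF d_lim[OF \<phi>(1)]]) blast
    moreover have "(\<lambda>m. B * C / real (Suc m)) \<longlonglongrightarrow> 0"
      using tendsto_mult_left[OF LIMSEQ_Suc[OF lim_1_over_n], of "B * C"] by simp
    ultimately have "(\<integral>x. l x * \<phi> x \<partial>lebesgue_on \<Omega>) \<le> 0"
      using LIMSEQ_le[OF l_int(2)[OF \<phi>(1)]] by blast
    then show "(\<integral>x. - l x * \<phi> x \<partial>lebesgue_on \<Omega>) \<ge> 0" by simp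
  qed
  moreover have "AE x in lebesgue_on \<Omega>. l x \<ge> 0"
    using AE_d AE_space
  proof eventually_elim
    case (elim x)
    then have "x \<in> \<Omega>" by simp
    show ?case by (rule LIMSEQ_le_const[OF s_lim[OF \<open>x \<in> \<Omega>\<close>]]) (use elim in blast)
  qed
  moreover obtain \<B> :: "real set set" where \<B>: "countable \<B>" "topological_basis \<B>"
    using ex_countable_basis by blast
  \<comment> \<open>Each bump has its own null set; countability of the family yields a common
    one.\<close>
  have "AE x in lebesgue_on \<Omega>. \<forall>U\<in>finite_unions \<B>. \<forall>m. s (bump U m) x \<ge> 0"
    unfolding AE_ball_countable[OF countable_finite_unions[OF \<B>(1)]] AE_all_countable
    using nonneg bump_C0b bump_bounds(1) by blast
  ultimately have "AE x in lebesgue_on \<Omega>. \<nu> x \<in> radon_prob_measures"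
    using AE_space
  proof eventually_elim
    case (elim x)
    then have "\<nu> x \<in> radon_measures" using \<nu> by (simp add: parametrized_measure_def)
    moreover have "\<nu> x UNIV = 1" using elim by (simp add: l_def)
    ultimately show ?case using elim by (intro radon_prob_measuresI[OF _ _ \<B>]) (auto simp: s_def)
  qed
  then show ?thesis using \<nu> by (simp add: young_measure_def)
qed

section \<open>Hyperfinite grid sums as limits along an ultrafilter\<close>

locale hyperreal_universe = nonstandard_extension ext for ext :: "('k::finite, 's) ext"
begin

section \<open>Hyperreal operations on germs\<close>

lemma hfun1_star_op:
  "hfun1 ext g (star_op ext a xs) = star_op ext (\<lambda>us. Num (g (the_num (a us)))) xs"
  unfolding hfun1_def star_op_comp1 by simp

lemma hfun2_star_op:
  "hfun2 ext g (star_op ext a xs) (star_op ext b xs) =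
   star_op ext (\<lambda>us. Num (g (the_num (a us)) (the_num (b us)))) xs"
  unfolding hfun2_def star_op_comp2 by simp

lemma hfield_star_op:
  "hfield ext \<phi> (star_op ext a xs) = star_op ext (\<lambda>us. Num (\<phi> (the_pt (a us)))) xs"
  unfolding hfield_def star_op_comp1 by simp

lemma happ_star_op:
  "happ ext (star_op ext a xs) (star_op ext b xs) =
   star_op ext (\<lambda>us. Num (the_fn (a us) (the_pt (b us)))) xs"
  unfolding happ_def star_op_comp2 by simp

lemma hcoord_star_op:
  "hcoord ext (star_op ext a xs) i = star_op ext (\<lambda>us. Num (the_pt (a us) $ i)) xs"
  unfolding hcoord_def star_op_comp1 by simp

lemma hconst_star_op: "hconst ext r = star_op ext (\<lambda>_. Num r) xs"
  unfolding hconst_def by (rule star_eq_star_op)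

text \<open>\<open>'k std\<close> mixes four sorts, and the extended order also asserts that both
  arguments are numbers; the existential quantifiers record this.\<close>

lemma hless_star_op:
  "hless ext (star_op ext a xs) (star_op ext b xs) \<longleftrightarrow>
   hev ext xs (\<lambda>us. \<exists>p q. a us = Num p \<and> b us = Num q \<and> p < q)"
proof -
  have "hless ext (star_op ext a xs) (star_op ext b xs) \<longleftrightarrow>
    hev ext [star_op ext a xs, star_op ext b xs] (\<lambda>us. \<exists>p q. us = [Num p, Num q] \<and> p < q)"
    by (simp add: hless_def hev_def)
  then show ?thesis unfolding hev_star_op2 by simp
qed

lemma hle_star_op:
  "hle ext (star_op ext a xs) (star_op ext b xs) \<longleftrightarrow>
   hev ext xs (\<lambda>us. \<exists>p q. a us = Num p \<and> b us = Num q \<and> p \<le> q)"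
proof -
  have "hle ext (star_op ext a xs) (star_op ext b xs) \<longleftrightarrow>
    hev ext [star_op ext a xs, star_op ext b xs] (\<lambda>us. \<exists>p q. us = [Num p, Num q] \<and> p \<le> q)"
    by (simp add: hle_def hev_def)
  then show ?thesis unfolding hev_star_op2 by simp
qed

lemma hmem_star_op:
  "hmem ext (star_op ext a xs) (star_op ext b xs) \<longleftrightarrow>
   hev ext xs (\<lambda>us. \<exists>p B. a us = Pt p \<and> b us = St B \<and> p \<in> B)"
proof -
  have "hmem ext (star_op ext a xs) (star_op ext b xs) \<longleftrightarrow>
    hev ext [star_op ext a xs, star_op ext b xs] (\<lambda>us. \<exists>p B. us = [Pt p, St B] \<and> p \<in> B)"
    by (simp add: hmem_def hev_def)
  then show ?thesis unfolding hev_star_op2 by simp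
qed

lemmas star_op_simps = hfun1_star_op hfun2_star_op hfield_star_op happ_star_op hcoord_star_op
  hless_star_op hle_star_op hmem_star_op star_set_iff std.sel

text \<open>Being within every standard d of r means convergence of \<open>h\<close> to r along the
  tuple filter. That filter is proper, so uniqueness of real limits makes the definite description
  well defined.\<close>

lemma standard_part_star_op:
  assumes "(h \<longlongrightarrow> c) (tuple_filter xs)"
  shows "standard_part ext (star_op ext (\<lambda>us. Num (h us)) xs) = c"
proof -
  have *: "hless ext (hfun1 ext abs (hfun2 ext (-) (star_op ext (\<lambda>us. Num (h us)) xs) (hconst ext r))) (hconst ext d)
    \<longleftrightarrow> eventually (\<lambda>us. dist (h us) r < d) (tuple_filter xs)" for r d
    unfolding hconst_star_op[of _ xs] star_op_simps eventually_tuple_filter dist_real_def by simp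
  have "(\<forall>d>0. eventually (\<lambda>us. dist (h us) r < d) (tuple_filter xs)) \<longleftrightarrow> (h \<longlongrightarrow> r) (tuple_filter xs)" for r
    by (simp add: tendsto_iff)
  then show ?thesis
    unfolding standard_part_def * using assms tendsto_unique[OF tuple_filter_ultra(1)]
    by (auto intro!: the_equality)
qed

lemma hfinite_star_op:
  assumes "hfinite ext (star_op ext (\<lambda>us. Num (h us)) xs)"
  obtains C where "eventually (\<lambda>us. \<bar>h us\<bar> \<le> C) (tuple_filter xs)"
  using assms unfolding hfinite_def hconst_star_op[of _ xs] star_op_simps eventually_tuple_filter
  by auto

text \<open>\<open>hsum\<close> is a definite description over internal representatives, so the
  point is that its value does not depend on them. Transfer turns equal members, and equal values at
  them, into equal standard sets and functions that agree on them, for almost all standard tuples;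
  hence the sums coincide.\<close>

lemma hsum_star_op:
  assumes fin: "\<And>us. finite (A us)"
    and X: "\<And>x. x \<in> X \<longleftrightarrow> hmem ext x (star_op ext (\<lambda>us. St (A us)) xs)"
    and f: "\<And>x. x \<in> X \<Longrightarrow> f x = happ ext (star_op ext (\<lambda>us. Fn (w us)) xs) x"
  shows "hsum ext f X = star_op ext (\<lambda>us. Num (sum (w us) (A us))) xs"
proof -
  define F0 where "F0 = star_op ext (\<lambda>us. Fn (w us)) xs"
  define S0 where "S0 = star_op ext (\<lambda>us. St (A us)) xs"
  let ?sum = "\<lambda>us. Num (sum (the_fn (us ! 0)) (the_st (us ! 1))) :: 'k std"
  have uniq: "star_op ext ?sum [F, S] = star_op ext ?sum [F0, S0]"
    if F: "\<forall>x\<in>X. f x = happ ext F x" and S: "X = {x. hmem ext x S}"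
      and St: "S \<in> star_set ext (St ` Collect finite)" for F S
  proof -
    \<comment> \<open>Both pairs of representatives sit in one tuple, at positions 0 to 3; position
      4 is for the point x that gets quantified.\<close>
    define zs where "zs = [F, S, F0, S0]"
    define p :: "nat \<Rightarrow> 'k std list \<Rightarrow> 'k std" where "p = (\<lambda>i us. us ! i)"
    have n: "F = star_op ext (p 0) zs" "S = star_op ext (p 1) zs"
      "F0 = star_op ext (p 2) zs" "S0 = star_op ext (p 3) zs"
      unfolding p_def zs_def by (subst star_op_nth; simp)+
    have n': "F = star_op ext (p 0) (zs @ [x])" "S = star_op ext (p 1) (zs @ [x])"
      "F0 = star_op ext (p 2) (zs @ [x])" "S0 = star_op ext (p 3) (zs @ [x])"
      "x = star_op ext (p 4) (zs @ [x])" for x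
      unfolding p_def zs_def by (subst star_op_nth; simp)+
    have 1: "hev ext zs (\<lambda>us. \<forall>v. (\<exists>q B. v = Pt q \<and> us ! 1 = St B \<and> q \<in> B) \<longleftrightarrow> (\<exists>q B. v = Pt q \<and> us ! 3 = St B \<and> q \<in> B))"
    proof -
      have "hev ext (zs @ [x]) (\<lambda>us. (\<exists>q B. us ! 4 = Pt q \<and> us ! 1 = St B \<and> q \<in> B) \<longleftrightarrow>
        (\<exists>q B. us ! 4 = Pt q \<and> us ! 3 = St B \<and> q \<in> B))" (is "hev ext _ (\<lambda>us. ?P us \<longleftrightarrow> ?Q us)") for x
      proof -
        have "hmem ext x S \<longleftrightarrow> hmem ext x S0" using S X[of x] by (auto simp: S0_def)
        moreover have "hmem ext x S \<longleftrightarrow> hev ext (zs @ [x]) ?P"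
          by (subst (1) n'(5), subst n'(2)[of x]) (simp add: hmem_star_op p_def)
        moreover have "hmem ext x S0 \<longleftrightarrow> hev ext (zs @ [x]) ?Q"
          by (subst (1) n'(5), subst n'(4)[of x]) (simp add: hmem_star_op p_def)
        ultimately have "hev ext (zs @ [x]) ?P \<longleftrightarrow> hev ext (zs @ [x]) ?Q" by simp
        \<comment> \<open>The equivalence is brought under \<open>hev\<close> by distinguishing
          whether both sides hold or both fail.\<close>
        then have "(hev ext (zs @ [x]) ?P \<and> hev ext (zs @ [x]) ?Q) \<or>
          (hev ext (zs @ [x]) (\<lambda>us. \<not> ?P us) \<and> hev ext (zs @ [x]) (\<lambda>us. \<not> ?Q us))"
          unfolding hev_not by blast
        then show ?thesis unfolding hev_conj[symmetric] by (auto elim: hev_mono)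
      qed
      then have "hev ext zs (\<lambda>us. \<forall>v. (\<exists>q B. (us @ [v]) ! 4 = Pt q \<and> (us @ [v]) ! 1 = St B \<and> q \<in> B) \<longleftrightarrow>
        (\<exists>q B. (us @ [v]) ! 4 = Pt q \<and> (us @ [v]) ! 3 = St B \<and> q \<in> B))"
        by (intro hev_all[THEN iffD2] allI)
      then show ?thesis by (rule hev_mono) (simp add: zs_def nth_append)
    qed
    have 2: "hev ext zs (\<lambda>us. \<forall>v. (\<exists>q B. v = Pt q \<and> us ! 3 = St B \<and> q \<in> B) \<longrightarrow>
      the_fn (us ! 0) (the_pt v) = the_fn (us ! 2) (the_pt v))"
    proof -
      have "hev ext (zs @ [x]) (\<lambda>us. (\<exists>q B. us ! 4 = Pt q \<and> us ! 3 = St B \<and> q \<in> B) \<longrightarrow>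
        the_fn (us ! 0) (the_pt (us ! 4)) = the_fn (us ! 2) (the_pt (us ! 4)))" (is "hev ext _ (\<lambda>us. ?P us \<longrightarrow> ?Q us)") for x
      proof (cases "hmem ext x S0")
        case True
        then have "happ ext F x = happ ext F0 x" using F X[of x] f[of x] by (auto simp: S0_def F0_def)
        moreover have "happ ext F x = happ ext F0 x \<longleftrightarrow> hev ext (zs @ [x]) ?Q"
        proof -
          have "happ ext F x = star_op ext (\<lambda>us. Num (the_fn (us ! 0) (the_pt (us ! 4)))) (zs @ [x])"
            by (subst (1) n'(5), subst n'(1)[of x]) (simp add: happ_star_op p_def)
          moreover have "happ ext F0 x = star_op ext (\<lambda>us. Num (the_fn (us ! 2) (the_pt (us ! 4)))) (zs @ [x])"
            by (subst (1) n'(5), subst n'(3)[of x]) (simp add: happ_star_op p_def)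
          ultimately show ?thesis by (simp add: star_op_eq_iff)
        qed
        ultimately have "hev ext (zs @ [x]) ?Q" by simp
        then show ?thesis by (rule hev_mono) simp
      next
        case False
        moreover have "hmem ext x S0 \<longleftrightarrow> hev ext (zs @ [x]) ?P"
          by (subst (1) n'(5), subst n'(4)[of x]) (simp add: hmem_star_op p_def)
        ultimately have "hev ext (zs @ [x]) (\<lambda>us. \<not> ?P us)" unfolding hev_not by blast
        then show ?thesis by (rule hev_mono) blast
      qed
      then have "hev ext zs (\<lambda>us. \<forall>v. (\<exists>q B. (us @ [v]) ! 4 = Pt q \<and> (us @ [v]) ! 3 = St B \<and> q \<in> B) \<longrightarrow>
        the_fn ((us @ [v]) ! 0) (the_pt ((us @ [v]) ! 4)) = the_fn ((us @ [v]) ! 2) (the_pt ((us @ [v]) ! 4)))"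
        by (intro hev_all[THEN iffD2] allI)
      then show ?thesis by (rule hev_mono) (simp add: zs_def nth_append)
    qed
    \<comment> \<open>Having the same members does not determine an object: anything that is not of
      the form \<open>St B\<close> has none, and \<open>the_st\<close> is unspecified there. The
      sorts are therefore secured separately.\<close>
    have 3: "hev ext zs (\<lambda>us. us ! 1 \<in> range St)"
    proof -
      have "hev ext zs (\<lambda>us. us ! 1 \<in> St ` Collect finite)"
        using St by (subst (asm) n(2)) (simp add: star_set_iff p_def)
      then show ?thesis by (rule hev_mono) auto
    qed
    have 4: "hev ext zs (\<lambda>us. us ! 3 \<in> range St)"
    proof -
      have "S0 \<in> star_set ext (range St)"
        unfolding S0_def star_set_iff by (rule hev_True) simp
      then show ?thesis by (subst (asm) n(4)) (simp add: star_set_iff p_def)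
    qed
    have "hev ext zs (\<lambda>us. sum (the_fn (us ! 0)) (the_st (us ! 1)) = sum (the_fn (us ! 2)) (the_st (us ! 3)))"
    proof (rule hev_mono)
      show "hev ext zs (\<lambda>us. (us ! 1 \<in> range St \<and> us ! 3 \<in> range St) \<and>
        (\<forall>v. (\<exists>q B. v = Pt q \<and> us ! 1 = St B \<and> q \<in> B) \<longleftrightarrow> (\<exists>q B. v = Pt q \<and> us ! 3 = St B \<and> q \<in> B)) \<and>
        (\<forall>v. (\<exists>q B. v = Pt q \<and> us ! 3 = St B \<and> q \<in> B) \<longrightarrow>
          the_fn (us ! 0) (the_pt v) = the_fn (us ! 2) (the_pt v)))"
        by (intro hev_conj[THEN iffD2] conjI 1 2 3 4)
      fix us :: "'k std list"
      assume us: "(us ! 1 \<in> range St \<and> us ! 3 \<in> range St) \<and>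
        (\<forall>v. (\<exists>q B. v = Pt q \<and> us ! 1 = St B \<and> q \<in> B) \<longleftrightarrow> (\<exists>q B. v = Pt q \<and> us ! 3 = St B \<and> q \<in> B)) \<and>
        (\<forall>v. (\<exists>q B. v = Pt q \<and> us ! 3 = St B \<and> q \<in> B) \<longrightarrow>
          the_fn (us ! 0) (the_pt v) = the_fn (us ! 2) (the_pt v))"
      then obtain B1 B3 where B: "us ! 1 = St B1" "us ! 3 = St B3" by blast
      then have "B1 = B3" using us by auto
      moreover have "the_fn (us ! 0) q = the_fn (us ! 2) q" if "q \<in> B3" for q
      proof -
        have "\<exists>q' B. Pt q = Pt q' \<and> us ! 3 = St B \<and> q' \<in> B" using that B by blast
        then have "the_fn (us ! 0) (the_pt (Pt q)) = the_fn (us ! 2) (the_pt (Pt q))" using us by blast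
        then show ?thesis by simp
      qed
      ultimately show "sum (the_fn (us ! 0)) (the_st (us ! 1)) = sum (the_fn (us ! 2)) (the_st (us ! 3))"
        using B by (auto intro: sum.cong)
    qed
    moreover have "star_op ext ?sum [F, S] = star_op ext (\<lambda>us. Num (sum (the_fn (us ! 0)) (the_st (us ! 1)))) zs"
      by (subst n(1), subst n(2)) (simp add: star_op_comp2 p_def)
    moreover have "star_op ext ?sum [F0, S0] = star_op ext (\<lambda>us. Num (sum (the_fn (us ! 2)) (the_st (us ! 3)))) zs"
      by (subst n(3), subst n(4)) (simp add: star_op_comp2 p_def)
    ultimately show ?thesis by (simp add: star_op_eq_iff)
  qed
  have mem: "F0 \<in> star_set ext (range Fn)" "S0 \<in> star_set ext (St ` Collect finite)"
    unfolding F0_def S0_def star_set_iff by (auto intro!: hev_True simp: fin)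
  have XS: "X = {x. hmem ext x S0}" using X by (auto simp: S0_def)
  have fF: "\<forall>x\<in>X. f x = happ ext F0 x" using f by (simp add: F0_def)
  have "hsum ext f X = star_op ext ?sum [F0, S0]"
    unfolding hsum_def
  proof (rule the_equality)
    show "\<exists>F\<in>star_set ext (range Fn). \<exists>S\<in>star_set ext (St ` Collect finite).
      (\<forall>x\<in>X. f x = happ ext F x) \<and> X = {x. hmem ext x S} \<and> star_op ext ?sum [F0, S0] = star_op ext ?sum [F, S]"
      using mem XS fF by blast
  qed (use uniq in blast)
  also have "\<dots> = star_op ext (\<lambda>us. Num (sum (w us) (A us))) xs"
    unfolding F0_def S0_def star_op_comp2 by simp
  finally show ?thesis .
qed

section \<open>The hyperfinite grid as a germ of finite grids\<close>

definition std_N :: "'k std list \<Rightarrow> real" where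
  "std_N us = fact (nat \<lfloor>the_num (us ! 0)\<rfloor>)"

lemma gridN_star_op:
  assumes "xs \<noteq> []" "xs ! 0 = N0"
  shows "gridN ext N0 = star_op ext (\<lambda>us. Num (std_N us)) xs"
    and "eps ext N0 = star_op ext (\<lambda>us. Num (1 / std_N us)) xs"
proof -
  have N0: "N0 = star_op ext (\<lambda>us. us ! 0) xs" using assms by (subst star_op_nth) auto
  show *: "gridN ext N0 = star_op ext (\<lambda>us. Num (std_N us)) xs"
    unfolding gridN_def by (subst N0) (simp add: hfun1_star_op std_N_def)
  show "eps ext N0 = star_op ext (\<lambda>us. Num (1 / std_N us)) xs"
    unfolding eps_def * by (simp add: hfun1_star_op)
qed

text \<open>The entry \<open>F\<close> is carried so that the tuple extends \<open>[N0, F]\<close>,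
  over which the sums are taken. The hyperinteger in \<open>gridX\<close> becomes an existential
  under \<open>hev\<close>, and the coordinates are finitely many, so quantification over them also
  passes through \<open>hev\<close>.\<close>

lemma grid_dom_iff:
  "y \<in> grid_dom ext N0 \<Omega> \<longleftrightarrow>
   hev ext [N0, F, y] (\<lambda>us. us ! 2 \<in> range Pt \<and> the_pt (us ! 2) \<in> grid_points \<Omega> (std_N us))"
proof -
  let ?zs = "[N0, F, y]"
  have "hcoord ext y i \<in> gridX ext N0 \<longleftrightarrow> hev ext ?zs (\<lambda>us. \<exists>n\<in>\<int>. - ((std_N us)\<^sup>2) \<le> n \<and>
      n \<le> (std_N us)\<^sup>2 \<and> the_pt (us ! 2) $ i = n * (1 / std_N us))" for i
  proof -
    \<comment> \<open>Position 3 holds the hyperinteger numerator.\<close>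
    let ?Q = "\<lambda>us. us ! 3 \<in> Num ` \<int> \<and>
      (- ((std_N us)\<^sup>2) \<le> the_num (us ! 3) \<and> the_num (us ! 3) \<le> (std_N us)\<^sup>2) \<and>
      the_pt (us ! 2) $ i = the_num (us ! 3) * (1 / std_N us)"
    have "(hcoord ext y i = hfun2 ext (*) n (eps ext N0) \<and> n \<in> hint ext \<and>
        hle ext (hfun1 ext (\<lambda>r. - (r ^ 2)) (gridN ext N0)) n \<and>
        hle ext n (hfun1 ext (\<lambda>r. r ^ 2) (gridN ext N0))) \<longleftrightarrow> hev ext (?zs @ [n]) ?Q" for n
    proof -
      let ?ws = "?zs @ [n]"
      have y: "y = star_op ext (\<lambda>us. us ! 2) ?ws" and n: "n = star_op ext (\<lambda>us. us ! 3) ?ws"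
        by (subst star_op_nth; simp)+
      have e: "hcoord ext y i = star_op ext (\<lambda>us. Num (the_pt (us ! 2) $ i)) ?ws"
        "hfun2 ext (*) n (eps ext N0) = star_op ext (\<lambda>us. Num (the_num (us ! 3) * (1 / std_N us))) ?ws"
        "n \<in> hint ext \<longleftrightarrow> hev ext ?ws (\<lambda>us. us ! 3 \<in> Num ` \<int>)"
        "hle ext (hfun1 ext (\<lambda>r. - (r ^ 2)) (gridN ext N0)) n \<longleftrightarrow>
          hev ext ?ws (\<lambda>us. \<exists>q. us ! 3 = Num q \<and> - ((std_N us)\<^sup>2) \<le> q)"
        "hle ext n (hfun1 ext (\<lambda>r. r ^ 2) (gridN ext N0)) \<longleftrightarrow>
          hev ext ?ws (\<lambda>us. \<exists>q. us ! 3 = Num q \<and> q \<le> (std_N us)\<^sup>2)"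
      proof -
        note g = gridN_star_op[of ?ws N0, simplified]
        show "hcoord ext y i = star_op ext (\<lambda>us. Num (the_pt (us ! 2) $ i)) ?ws"
          by (subst (1) y) (rule hcoord_star_op)
        show "hfun2 ext (*) n (eps ext N0) = star_op ext (\<lambda>us. Num (the_num (us ! 3) * (1 / std_N us))) ?ws"
          by (subst (1) n) (simp add: g hfun2_star_op)
        show "n \<in> hint ext \<longleftrightarrow> hev ext ?ws (\<lambda>us. us ! 3 \<in> Num ` \<int>)"
          unfolding hint_def by (subst (1) n) (rule star_set_iff)
        show "hle ext (hfun1 ext (\<lambda>r. - (r ^ 2)) (gridN ext N0)) n \<longleftrightarrow>
          hev ext ?ws (\<lambda>us. \<exists>q. us ! 3 = Num q \<and> - ((std_N us)\<^sup>2) \<le> q)"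
          using hle_star_op[of _ ?ws "\<lambda>us. us ! 3"] unfolding n[symmetric] g hfun1_star_op by simp
        show "hle ext n (hfun1 ext (\<lambda>r. r ^ 2) (gridN ext N0)) \<longleftrightarrow>
          hev ext ?ws (\<lambda>us. \<exists>q. us ! 3 = Num q \<and> q \<le> (std_N us)\<^sup>2)"
          using hle_star_op[of "\<lambda>us. us ! 3" ?ws] unfolding n[symmetric] g hfun1_star_op by simp
      qed
      show ?thesis
        unfolding e star_op_eq_iff hev_conj[symmetric] by (rule hev_cong) auto
    qed
    then have "hcoord ext y i \<in> gridX ext N0 \<longleftrightarrow> (\<exists>n. hev ext (?zs @ [n]) ?Q)"
      unfolding gridX_def mem_Collect_eq by blast
    also have "\<dots> \<longleftrightarrow> hev ext ?zs (\<lambda>us. \<exists>v. ?Q (us @ [v]))" by (rule hev_ex[symmetric])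
    also have "\<dots> \<longleftrightarrow> hev ext ?zs (\<lambda>us. \<exists>n\<in>\<int>. - ((std_N us)\<^sup>2) \<le> n \<and>
      n \<le> (std_N us)\<^sup>2 \<and> the_pt (us ! 2) $ i = n * (1 / std_N us))"
      by (rule hev_cong) (auto simp: nth_append std_N_def)
    finally show ?thesis .
  qed
  moreover have "y \<in> star_set ext (Pt ` \<Omega>) \<longleftrightarrow> hev ext ?zs (\<lambda>us. us ! 2 \<in> Pt ` \<Omega>)"
  proof -
    have y: "y = star_op ext (\<lambda>us. us ! 2) ?zs" by (subst star_op_nth; simp)
    show ?thesis by (subst (1) y) (rule star_set_iff)
  qed
  ultimately have "y \<in> grid_dom ext N0 \<Omega> \<longleftrightarrow> hev ext ?zs (\<lambda>us. us ! 2 \<in> Pt ` \<Omega>) \<and>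
    (\<forall>i\<in>UNIV. hev ext ?zs (\<lambda>us. \<exists>n\<in>\<int>. - ((std_N us)\<^sup>2) \<le> n \<and>
      n \<le> (std_N us)\<^sup>2 \<and> the_pt (us ! 2) $ i = n * (1 / std_N us)))"
    by (simp add: grid_dom_def)
  also have "\<dots> \<longleftrightarrow> hev ext ?zs (\<lambda>us. us ! 2 \<in> range Pt \<and> the_pt (us ! 2) \<in> grid_points \<Omega> (std_N us))"
    unfolding hev_Ball_finite[OF finite_class.finite_UNIV, symmetric] hev_conj[symmetric]
    by (rule hev_cong) (auto simp: grid_points_def)
  finally show ?thesis .
qed

text \<open>The summand stays generic as a functional \<open>w\<close> of the internal function. It
  is later the product with \<open>\<phi>\<close>, the composite with \<open>g\<close> times
  \<open>\<phi>\<close>, or the absolute value.\<close>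

lemma grid_hsum:
  assumes f: "\<And>x. x \<in> grid_dom ext N0 \<Omega> \<Longrightarrow>
    f x = star_op ext (\<lambda>us. Num (w (the_fn (us ! 1)) (the_pt (us ! 2)))) [N0, F, x]"
  shows "hfun2 ext (*) (hfun1 ext (\<lambda>r. r ^ CARD('k)) (eps ext N0)) (hsum ext f (grid_dom ext N0 \<Omega>)) =
    star_op ext (\<lambda>us. Num (grid_sum \<Omega> (std_N us) (w (the_fn (us ! 1))))) [N0, F]"
proof -
  have "hsum ext f (grid_dom ext N0 \<Omega>) =
    star_op ext (\<lambda>us. Num (sum (w (the_fn (us ! 1))) (grid_points \<Omega> (std_N us)))) [N0, F]"
  proof (rule hsum_star_op)
    show "finite (grid_points \<Omega> (std_N us))" for us by (rule finite_grid_points)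
    fix x
    have x: "x = star_op ext (\<lambda>us. us ! 2) ([N0, F] @ [x])" by (subst star_op_nth; simp)
    show "x \<in> grid_dom ext N0 \<Omega> \<longleftrightarrow> hmem ext x (star_op ext (\<lambda>us. St (grid_points \<Omega> (std_N us))) [N0, F])"
      unfolding star_op_take[of _ "[N0, F]" "[x]"] grid_dom_iff[of x N0 \<Omega> F]
        hmem_star_op[of "\<lambda>us. us ! 2" "[N0, F] @ [x]", folded x]
      unfolding append.simps
      \<comment> \<open>\<open>std_N\<close> reads position 0 only, so it agrees on
        \<open>[N0, F]\<close> and on the longer tuple.\<close>
      by (rule hev_cong) (auto simp: std_N_def)
    show "f x = happ ext (star_op ext (\<lambda>us. Fn (w (the_fn (us ! 1)))) [N0, F]) x" if "x \<in> grid_dom ext N0 \<Omega>"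
      unfolding f[OF that] star_op_take[of _ "[N0, F]" "[x]"]
        happ_star_op[of _ "[N0, F] @ [x]" "\<lambda>us. us ! 2", folded x]
      unfolding append.simps star_op_eq_iff
      by (rule hev_True) simp
  qed
  then show ?thesis
    by (simp add: gridN_star_op[of "[N0, F]" N0] hfun1_star_op hfun2_star_op grid_sum_def)
qed

end

section \<open>Functionals on \<open>C0c\<close> and their limits\<close>

lemma L1_functional_eq:
  assumes "open \<Omega>" "w \<in> borel_measurable borel" "\<phi> \<in> C0c \<Omega>"
  shows "L1_functional \<Omega> w \<phi> = (\<integral>x. w x * \<phi> x \<partial>lborel)"
  unfolding L1_functional_def
  by (rule integral_lebesgue_on_eq_lborel[OF assms(1)])
    (use assms(2) C0c_D(5)[OF assms(3)] C0c_zero[OF assms(3)] in auto)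

lemma abs_le_sup_norm:
  assumes "\<phi> \<in> C0c \<Omega>" shows "\<bar>\<phi> x\<bar> \<le> sup_norm \<phi>"
proof -
  obtain B where "\<And>x. \<bar>\<phi> x\<bar> \<le> B" using C0c_bounded[OF assms] by blast
  then show ?thesis unfolding sup_norm_def by (intro cSUP_upper) (auto simp: bdd_above_def)
qed

lemma C0c_lin:
  assumes "\<phi> \<in> C0c \<Omega>" "\<psi> \<in> C0c \<Omega>"
  shows "(\<lambda>x. a * \<phi> x + b * \<psi> x) \<in> C0c \<Omega>"
proof (rule C0c_I)
  show "continuous_on UNIV (\<lambda>x. a * \<phi> x + b * \<psi> x)"
    using C0c_D(1)[OF assms(1)] C0c_D(1)[OF assms(2)] by (intro continuous_intros)
  show "closed (support \<phi> \<union> support \<psi>)" "bounded (support \<phi> \<union> support \<psi>)"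
    using C0c_D(2)[OF assms(1)] C0c_D(2)[OF assms(2)] by (auto simp: compact_eq_bounded_closed)
  show "support \<phi> \<union> support \<psi> \<subseteq> \<Omega>" using C0c_D(3)[OF assms(1)] C0c_D(3)[OF assms(2)] by blast
  fix x assume "x \<notin> support \<phi> \<union> support \<psi>"
  then have "\<phi> x = 0" "\<psi> x = 0" using C0c_D(4)[OF assms(1)] C0c_D(4)[OF assms(2)] by blast+
  then show "a * \<phi> x + b * \<psi> x = 0" by simp
qed

lemma L1_functional_step_fn_dual:
  assumes "open \<Omega>" "N > 0" "grid_sum \<Omega> N (\<lambda>y. \<bar>w y\<bar>) \<le> C"
  shows "L1_functional \<Omega> (step_fn \<Omega> N w) \<in> C0c_dual \<Omega>"
    and "\<phi> \<in> C0c \<Omega> \<Longrightarrow> \<bar>L1_functional \<Omega> (step_fn \<Omega> N w) \<phi>\<bar> \<le> C * sup_norm \<phi>"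
proof -
  note L = L1_functional_eq[OF assms(1) step_fn_measurable[OF assms(2)]]
  have int: "integrable lborel (\<lambda>x. step_fn \<Omega> N w x * \<phi> x)" if "\<phi> \<in> C0c \<Omega>" for \<phi>
    by (rule step_fn_mult_integrable(1)[OF assms(2) C0c_D(5)[OF that] abs_le_sup_norm[OF that]])
  show le: "\<bar>L1_functional \<Omega> (step_fn \<Omega> N w) \<phi>\<bar> \<le> C * sup_norm \<phi>" if "\<phi> \<in> C0c \<Omega>" for \<phi>
  proof -
    have "\<bar>L1_functional \<Omega> (step_fn \<Omega> N w) \<phi>\<bar> \<le> sup_norm \<phi> * grid_sum \<Omega> N (\<lambda>y. \<bar>w y\<bar>)"
      unfolding L[OF that]
      by (rule step_fn_mult_integrable(2)[OF assms(2) C0c_D(5)[OF that] abs_le_sup_norm[OF that]])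
    also have "\<dots> \<le> sup_norm \<phi> * C"
      using abs_le_sup_norm[OF that, of undefined] by (intro mult_left_mono assms(3)) linarith
    finally show ?thesis by (simp add: mult.commute)
  qed
  have "linear_functional_on (C0c \<Omega>) (L1_functional \<Omega> (step_fn \<Omega> N w))"
    unfolding linear_functional_on_def
  proof (intro ballI allI)
    fix \<phi> \<psi> a b assume \<phi>: "\<phi> \<in> C0c \<Omega>" and \<psi>: "\<psi> \<in> C0c \<Omega>"
    have "(\<integral>x. step_fn \<Omega> N w x * (a * \<phi> x + b * \<psi> x) \<partial>lborel) =
      (\<integral>x. a * (step_fn \<Omega> N w x * \<phi> x) + b * (step_fn \<Omega> N w x * \<psi> x) \<partial>lborel)"
      by (simp add: algebra_simps)
    then show "L1_functional \<Omega> (step_fn \<Omega> N w) (\<lambda>x. a * \<phi> x + b * \<psi> x) =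
      a * L1_functional \<Omega> (step_fn \<Omega> N w) \<phi> + b * L1_functional \<Omega> (step_fn \<Omega> N w) \<psi>"
      using int[OF \<phi>] int[OF \<psi>] by (simp add: L \<phi> \<psi> C0c_lin)
  qed
  with le show "L1_functional \<Omega> (step_fn \<Omega> N w) \<in> C0c_dual \<Omega>" unfolding C0c_dual_def by blast
qed

text \<open>The constant C common to all members survives the pointwise limit. In this way
  \<open>grid_functional\<close> is shown to be linear and continuous, as the limit of the
  functionals of the sequence.\<close>

lemma C0c_dual_limit:
  assumes L: "\<And>n::nat. L n \<in> C0c_dual \<Omega>" "\<And>n \<phi>. \<phi> \<in> C0c \<Omega> \<Longrightarrow> \<bar>L n \<phi>\<bar> \<le> C * sup_norm \<phi>"
    and lim: "\<And>\<phi>. \<phi> \<in> C0c \<Omega> \<Longrightarrow> (\<lambda>n. L n \<phi>) \<longlonglongrightarrow> l \<phi>"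
  shows "l \<in> C0c_dual \<Omega>"
proof -
  have "\<bar>l \<phi>\<bar> \<le> C * sup_norm \<phi>" if "\<phi> \<in> C0c \<Omega>" for \<phi>
    by (rule LIMSEQ_le_const2[OF tendsto_rabs[OF lim[OF that]]]) (use L(2)[OF that] in auto)
  moreover have "linear_functional_on (C0c \<Omega>) l"
    unfolding linear_functional_on_def
  proof (intro ballI allI)
    fix \<phi> \<psi> a b assume \<phi>: "\<phi> \<in> C0c \<Omega>" and \<psi>: "\<psi> \<in> C0c \<Omega>"
    have "L n (\<lambda>x. a * \<phi> x + b * \<psi> x) = a * L n \<phi> + b * L n \<psi>" for n
      using L(1)[of n] \<phi> \<psi> by (simp add: C0c_dual_def linear_functional_on_def)
    then have "(\<lambda>n. L n (\<lambda>x. a * \<phi> x + b * \<psi> x)) \<longlonglongrightarrow> a * l \<phi> + b * l \<psi>"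
      by (simp only:) (intro tendsto_intros lim \<phi> \<psi>)
    then show "l (\<lambda>x. a * \<phi> x + b * \<psi> x) = a * l \<phi> + b * l \<psi>"
      using lim[OF C0c_lin[OF \<phi> \<psi>]] LIMSEQ_unique by blast
  qed
  ultimately show ?thesis unfolding C0c_dual_def by blast
qed

theorem theorem3p4:
  fixes ext :: "('k::finite, 's) ext"
    and \<Omega> :: "(real^'k) set"
    and N0 :: 's
    and z :: "'s \<Rightarrow> 's"
  assumes "open \<Omega>"
    and "transfer_principle ext"
    and "saturated ext (distributions \<Omega>)"
    and "infinite_hnat ext N0"
    and "z \<in> grid_functions ext N0 \<Omega>"
    and "hfinite ext (grid_norm1 ext N0 \<Omega> z)"
  shows "\<exists>zs :: nat \<Rightarrow> real^'k \<Rightarrow> real.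
           (\<forall>n. integrable (lebesgue_on \<Omega>) (zs n)) \<and>
           weak_star_tendsto \<Omega> (\<lambda>n. L1_functional \<Omega> (zs n)) (grid_functional ext N0 \<Omega> z) \<and>
           (\<forall>\<nu>. grid_measure ext N0 \<Omega> z \<nu> \<longrightarrow> young_tendsto \<Omega> zs \<nu>)"
proof -
  interpret hyperreal_universe ext by unfold_locales (rule assms(2))
  obtain F where F: "\<And>x. x \<in> grid_dom ext N0 \<Omega> \<Longrightarrow> z x = happ ext F x"
    using assms(5) unfolding grid_functions_def internal_on_def by blast
  have z: "z x = star_op ext (\<lambda>us. Num (the_fn (us ! 1) (the_pt (us ! 2)))) [N0, F, x]"
    if "x \<in> grid_dom ext N0 \<Omega>" for x
  proof -
    have "F = star_op ext (\<lambda>us. us ! 1) [N0, F, x]" "x = star_op ext (\<lambda>us. us ! 2) [N0, F, x]"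
      by (subst star_op_nth; simp)+
    then show ?thesis using F[OF that] happ_star_op[of "\<lambda>us. us ! 1" "[N0, F, x]" "\<lambda>us. us ! 2"] by metis
  qed
  have \<phi>x: "hfield ext \<phi> x = star_op ext (\<lambda>us. Num (\<phi> (the_pt (us ! 2)))) [N0, F, x]" for \<phi> x
  proof -
    have "x = star_op ext (\<lambda>us. us ! 2) [N0, F, x]" by (subst star_op_nth; simp)
    then show ?thesis using hfield_star_op[of \<phi> "\<lambda>us. us ! 2" "[N0, F, x]"] by metis
  qed
  have inner: "grid_inner ext N0 \<Omega> z (hfield ext \<phi>) =
    star_op ext (\<lambda>us. Num (grid_sum \<Omega> (std_N us) (\<lambda>y. the_fn (us ! 1) y * \<phi> y))) [N0, F]" for \<phi>
    unfolding grid_inner_def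
    by (rule grid_hsum[where w = "\<lambda>f y. f y * \<phi> y"]) (simp add: z \<phi>x hfun2_star_op)
  have inner_g: "grid_inner ext N0 \<Omega> (\<lambda>x. hfun1 ext g (z x)) (hfield ext \<phi>) =
    star_op ext (\<lambda>us. Num (grid_sum \<Omega> (std_N us) (\<lambda>y. g (the_fn (us ! 1) y) * \<phi> y))) [N0, F]" for g \<phi>
    unfolding grid_inner_def
    by (rule grid_hsum[where w = "\<lambda>f y. g (f y) * \<phi> y"]) (simp add: z \<phi>x hfun1_star_op hfun2_star_op)
  have norm1: "grid_norm1 ext N0 \<Omega> z =
    star_op ext (\<lambda>us. Num (grid_sum \<Omega> (std_N us) (\<lambda>y. \<bar>the_fn (us ! 1) y\<bar>))) [N0, F]"
    unfolding grid_norm1_def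
    by (rule grid_hsum[where w = "\<lambda>f y. \<bar>f y\<bar>"]) (simp add: z hfun1_star_op)
  \<comment> \<open>The first component is already the factorial N, not its index
    \<open>N0\<close>.\<close>
  define pr :: "'k std list \<Rightarrow> real \<times> (real^'k \<Rightarrow> real)" where "pr = (\<lambda>us. (std_N us, the_fn (us ! 1)))"
  define U where "U = filtermap pr (tuple_filter [N0, F])"
  have U: "U \<noteq> bot" "eventually P U \<or> eventually (\<lambda>p. \<not> P p) U" for P
    using tuple_filter_ultra[where xs = "[N0, F]"] by (auto simp: U_def filtermap_bot_iff eventually_filtermap)
  have U_lim: "filterlim fst at_top U"
    unfolding filterlim_at_top
  proof
    fix c :: real
    obtain m :: nat where m: "c \<le> real m" using real_arch_simple by blast
    have "N0 = star_op ext (\<lambda>us. us ! 0) [N0, F]" by (subst star_op_nth; simp)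
    then have "hless ext (hconst ext (real m)) N0 \<longleftrightarrow> hev ext [N0, F] (\<lambda>us. \<exists>q. us ! 0 = Num q \<and> real m < q)"
      using hless_star_op[of "\<lambda>_. Num (real m)" "[N0, F]" "\<lambda>us. us ! 0", folded hconst_star_op] by simp
    then have "hev ext [N0, F] (\<lambda>us. \<exists>q. us ! 0 = Num q \<and> real m < q)"
      using assms(4) by (simp add: infinite_hnat_def)
    then have "hev ext [N0, F] (\<lambda>us. c \<le> std_N us)"
    proof (rule hev_mono)
      fix us :: "'k std list" assume "\<exists>q. us ! 0 = Num q \<and> real m < q"
      then obtain q where q: "us ! 0 = Num q" "real m < q" by blast
      \<comment> \<open>A natural number is at most its factorial, so infinity of \<open>N0\<close>
        forces the grid sizes to infinity along \<open>U\<close>.\<close>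
      then have "m \<le> nat \<lfloor>q\<rfloor>" by linarith
      also have "\<dots> \<le> fact (nat \<lfloor>q\<rfloor>)" by (rule fact_ge_self)
      finally have "real m \<le> real (fact (nat \<lfloor>q\<rfloor>))" by (simp only: of_nat_le_iff)
      also have "\<dots> = std_N us" by (simp add: std_N_def q(1))
      finally have "real m \<le> std_N us" .
      with m show "c \<le> std_N us" by simp
    qed
    then show "\<forall>\<^sub>F p in U. c \<le> fst p"
      by (simp add: U_def eventually_filtermap pr_def eventually_tuple_filter)
  qed
  obtain C0 where C0: "eventually (\<lambda>us. \<bar>grid_sum \<Omega> (std_N us) (\<lambda>y. \<bar>the_fn (us ! 1) y\<bar>)\<bar> \<le> C0) (tuple_filter [N0, F])"
    using hfinite_star_op[OF assms(6)[unfolded norm1]] by blast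
  define C where "C = max 0 C0"
  have C_ev: "\<forall>\<^sub>F p in U. grid_sum \<Omega> (fst p) (\<lambda>y. \<bar>snd p y\<bar>) \<le> C"
    using C0 unfolding U_def eventually_filtermap by eventually_elim (auto simp: pr_def C_def)
  have "C \<ge> 0" by (simp add: C_def)
  obtain p where p: "\<And>n. fst (p n) > 0" "\<And>n::nat. grid_sum \<Omega> (fst (p n)) (\<lambda>y. \<bar>snd (p n) y\<bar>) \<le> C"
    and p_lim: "\<And>\<phi>. \<phi> \<in> C0c \<Omega> \<Longrightarrow> \<exists>c. ((\<lambda>p. grid_sum \<Omega> (fst p) (\<lambda>y. snd p y * \<phi> y)) \<longlongrightarrow> c) U \<and>
      (\<lambda>n. \<integral>x. step_fn \<Omega> (fst (p n)) (snd (p n)) x * \<phi> x \<partial>lborel) \<longlonglongrightarrow> c"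
    and p_lim_g: "\<And>g \<phi>. g \<in> C0b \<Longrightarrow> \<phi> \<in> C0c \<Omega> \<Longrightarrow>
      \<exists>c. ((\<lambda>p. grid_sum \<Omega> (fst p) (\<lambda>y. g (snd p y) * \<phi> y)) \<longlongrightarrow> c) U \<and>
      (\<lambda>n. \<integral>x. g (step_fn \<Omega> (fst (p n)) (snd (p n)) x) * \<phi> x \<partial>lborel) \<longlonglongrightarrow> c"
    by (rule approximating_sequence[OF U U_lim assms(1) \<open>C \<ge> 0\<close> C_ev]) blast
  define zs where "zs = (\<lambda>n. step_fn \<Omega> (fst (p n)) (snd (p n)))"
  have zs_int: "integrable lborel (zs n)" for n
    using step_fn_integral[OF p(1)] by (auto simp: zs_def has_bochner_integral_iff)
  have zs_meas: "zs n \<in> borel_measurable borel" for n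
    unfolding zs_def by (rule step_fn_measurable[OF p(1)])
  have zs_L1: "(\<integral>x. \<bar>zs n x\<bar> \<partial>lborel) \<le> C" for n
    using step_fn_integral[OF p(1)[of n], of \<Omega>] p(2)[of n]
    by (simp add: zs_def step_fn_abs has_bochner_integral_iff)
  have lim: "(\<lambda>n. L1_functional \<Omega> (zs n) \<phi>) \<longlonglongrightarrow> grid_functional ext N0 \<Omega> z \<phi>" if \<phi>: "\<phi> \<in> C0c \<Omega>" for \<phi>
  proof -
    obtain c where c: "((\<lambda>p. grid_sum \<Omega> (fst p) (\<lambda>y. snd p y * \<phi> y)) \<longlongrightarrow> c) U"
      "(\<lambda>n. \<integral>x. zs n x * \<phi> x \<partial>lborel) \<longlonglongrightarrow> c" using p_lim[OF \<phi>] by (auto simp: zs_def)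
    \<comment> \<open>The limit along the ultrafilter is the standard part, which identifies the
      unnamed limit c of the sequence.\<close>
    have "grid_functional ext N0 \<Omega> z \<phi> = c"
      unfolding grid_functional_def inner
      by (rule standard_part_star_op) (use c(1) in \<open>simp add: U_def filterlim_filtermap pr_def\<close>)
    then show ?thesis using c(2) L1_functional_eq[OF assms(1) zs_meas \<phi>] by simp
  qed
  have lim_g: "(\<lambda>n. \<integral>x. g (zs n x) * \<phi> x \<partial>lborel) \<longlonglongrightarrow>
      standard_part ext (grid_inner ext N0 \<Omega> (\<lambda>x. hfun1 ext g (z x)) (hfield ext \<phi>))"
    if g: "g \<in> C0b" and \<phi>: "\<phi> \<in> C0c \<Omega>" for g \<phi>
  proof -
    obtain c where c: "((\<lambda>p. grid_sum \<Omega> (fst p) (\<lambda>y. g (snd p y) * \<phi> y)) \<longlongrightarrow> c) U"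
      "(\<lambda>n. \<integral>x. g (zs n x) * \<phi> x \<partial>lborel) \<longlonglongrightarrow> c" using p_lim_g[OF g \<phi>] by (auto simp: zs_def)
    have "standard_part ext (grid_inner ext N0 \<Omega> (\<lambda>x. hfun1 ext g (z x)) (hfield ext \<phi>)) = c"
      unfolding inner_g
      by (rule standard_part_star_op) (use c(1) in \<open>simp add: U_def filterlim_filtermap pr_def\<close>)
    then show ?thesis using c(2) by simp
  qed
  have dual: "L1_functional \<Omega> (zs n) \<in> C0c_dual \<Omega>"
    "\<phi> \<in> C0c \<Omega> \<Longrightarrow> \<bar>L1_functional \<Omega> (zs n) \<phi>\<bar> \<le> C * sup_norm \<phi>" for n \<phi>
    unfolding zs_def using L1_functional_step_fn_dual[OF assms(1) p] by blast+
  show ?thesis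
  proof (intro exI[of _ zs] conjI allI impI)
    show int: "integrable (lebesgue_on \<Omega>) (zs n)" for n
      by (rule integrable_lborel_lebesgue_on[OF assms(1) zs_int])
    show "weak_star_tendsto \<Omega> (\<lambda>n. L1_functional \<Omega> (zs n)) (grid_functional ext N0 \<Omega> z)"
      unfolding weak_star_tendsto_def using dual(1) lim C0c_dual_limit[OF dual lim] by blast
    fix \<nu> assume "grid_measure ext N0 \<Omega> z \<nu>"
    then have \<nu>: "parametrized_measure \<Omega> \<nu>"
      and b: "\<And>g \<phi>. g \<in> C0b \<Longrightarrow> \<phi> \<in> C0c \<Omega> \<Longrightarrow>
        has_bochner_integral (lebesgue_on \<Omega>) (\<lambda>x. signed_integral (\<nu> x) g * \<phi> x)
          (standard_part ext (grid_inner ext N0 \<Omega> (\<lambda>x. hfun1 ext g (z x)) (hfield ext \<phi>)))"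
      unfolding grid_measure_def by auto
    have "young_measure \<Omega> \<nu>"
      by (rule young_measure_if_L1_bounded[OF assms(1) \<nu> zs_int zs_L1 b lim_g])
    \<comment> \<open>Cells may stick out of \<Omega>, so the integral over \<Omega> is only bounded
      by the one over the whole space.\<close>
    moreover have "(\<integral>x. \<bar>zs n x\<bar> \<partial>lebesgue_on \<Omega>) \<le> C" for n
    proof -
      have \<Omega>: "\<Omega> \<inter> space lebesgue \<in> sets lebesgue" using assms(1) by (auto intro: borel_open)
      have i: "integrable lebesgue (\<lambda>x. \<bar>zs n x\<bar>)"
        using zs_int[of n] zs_meas[of n] by (simp add: integrable_completion)
      have "(\<integral>x. \<bar>zs n x\<bar> \<partial>lebesgue_on \<Omega>) = (\<integral>x. indicator \<Omega> x *\<^sub>R \<bar>zs n x\<bar> \<partial>lebesgue)"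
        using \<Omega> by (rule integral_restrict_space)
      also have "\<dots> \<le> (\<integral>x. \<bar>zs n x\<bar> \<partial>lebesgue)"
        using i \<Omega> by (intro integral_mono integrable_mult_indicator) (auto simp: indicator_def)
      also have "\<dots> = (\<integral>x. \<bar>zs n x\<bar> \<partial>lborel)"
        using zs_meas[of n] by (intro integral_completion) simp
      also note zs_L1
      finally show ?thesis .
    qed
    moreover have "(\<lambda>n. \<integral>x. g (zs n x) * \<phi> x \<partial>lebesgue_on \<Omega>)
        \<longlonglongrightarrow> (\<integral>x. signed_integral (\<nu> x) g * \<phi> x \<partial>lebesgue_on \<Omega>)"
      if g: "g \<in> C0b" and \<phi>: "\<phi> \<in> C0c \<Omega>" for g \<phi>
    proof -
      have "(\<integral>x. g (zs n x) * \<phi> x \<partial>lebesgue_on \<Omega>) = (\<integral>x. g (zs n x) * \<phi> x \<partial>lborel)" for n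
        using measurable_compose[OF zs_meas C0b_D(2)[OF g]] C0c_D(5)[OF \<phi>] C0c_zero[OF \<phi>]
        by (intro integral_lebesgue_on_eq_lborel assms(1)) auto
      then show ?thesis
        using lim_g[OF g \<phi>] has_bochner_integral_integral_eq[OF b[OF g \<phi>]] by simp
    qed
    ultimately show "young_tendsto \<Omega> zs \<nu>" unfolding young_tendsto_def using int by blast
  qed
qed

end
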